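(* Let ${\cal M}^{\rm cyc}_{0,5}=\overline{\cal M}_{0,5}-\bigcup_{c\in\mathbb Z/5}D_{c,c+1}$, and let $\psi_c:\mathbb C^*\times\mathbb C^*\hookrightarrow\overline{\cal M}_{0,5}$, $c\in\mathbb Z/5$, be the five embeddings obtained from $$\psi_1:(X,Y)\longmapsto(\infty,-1,0,X,X(1+Y))$$ by the five cyclic shifts of the configuration of five points. (i) The surface ${\cal M}^{\rm cyc}_{0,5}$ is the union of the five open subsets $\psi_c(\mathbb C^*\times\mathbb C^* )$ of $\overline{\cal M}_{0,5}$. (ii) The functions $$X_{a,b;c}=r(x_c,x_{c+1},x_{c+2},x_{c+3})^a\; r(x_c,x_{c+2},x_{c+3},x_{c+4})^b,\qquad a,b\in\mathbb Z,\ a\le0,\ b\ge0,\ c\in\mathbb Z/5,$$ (considered as a set of functions, i.e. with coinciding functions counted once) form a basis of the space of regular functions on the surface ${\cal M}^{\rm cyc}_{0,5}$.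
   Context: $\overline{\cal M}_{0,5}$ is the Deligne–Mumford–Knudsen compactification (over $\mathbb C$) of the moduli space ${\cal M}_{0,5}$ of configurations $(x_1,\dots,x_5)$ of five distinct points of $\mathbb P^1$ modulo $PGL_2$. $D_{ij}\subset\overline{\cal M}_{0,5}$, $i\neq j$, is the boundary divisor (a projective line) parametrizing configurations where $x_i$ collides with $x_j$; there are ten such lines and their complement is ${\cal M}_{0,5}$. Indices are modulo $5$. The cross-ratio is $r(x_1,x_2,x_3,x_4)=\frac{(x_1-x_2)(x_3-x_4)}{(x_1-x_4)(x_2-x_3)}$, so $r(\infty,-1,0,z)=z$. *)

theory Defs
  imports Complex_Main "HOL-Library.Numeral_Type" "HOL-Library.Function_Algebras"
begin

section \<open>The projective line and the cross-ratio\<close>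

datatype cp1 = Fin complex | Infty

text \<open>Homogeneous coordinates: \<^term>\<open>Fin z\<close> is \<open>[z : 1]\<close> and \<^term>\<open>Infty\<close> is \<open>[1 : 0]\<close>.\<close>

fun hx :: "cp1 \<Rightarrow> complex" where
  "hx (Fin z) = z"
| "hx Infty = 1"

fun hy :: "cp1 \<Rightarrow> complex" where
  "hy (Fin z) = 1"
| "hy Infty = 0"

definition of_hom :: "complex \<Rightarrow> complex \<Rightarrow> cp1" where
  "of_hom u v = (if v = 0 then Infty else Fin (u / v))"

definition moebius :: "(cp1 \<Rightarrow> cp1) \<Rightarrow> bool" where
  "moebius m \<longleftrightarrow> (\<exists>a b c d. a * d - b * c \<noteq> 0 \<and>
     m = (\<lambda>p. of_hom (a * hx p + b * hy p) (c * hx p + d * hy p)))"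

text \<open>The homogeneous form of the difference \<open>x - y\<close>.\<close>

definition pdiff :: "cp1 \<Rightarrow> cp1 \<Rightarrow> complex" where
  "pdiff x y = hx x * hy y - hx y * hy x"

text \<open>The ratio defining the cross-ratio is determinate exactly when no three of the four points
  coincide; two of them may coincide, and then the cross-ratio is 0, -1 or \<open>\<infinity>\<close>.\<close>

definition cr_determinate :: "cp1 \<Rightarrow> cp1 \<Rightarrow> cp1 \<Rightarrow> cp1 \<Rightarrow> bool" where
  "cr_determinate x1 x2 x3 x4 \<longleftrightarrow>
     pdiff x1 x2 * pdiff x3 x4 \<noteq> 0 \<or> pdiff x1 x4 * pdiff x2 x3 \<noteq> 0"

definition cross_ratio :: "cp1 \<Rightarrow> cp1 \<Rightarrow> cp1 \<Rightarrow> cp1 \<Rightarrow> cp1" where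
  "cross_ratio x1 x2 x3 x4 = of_hom (pdiff x1 x2 * pdiff x3 x4) (pdiff x1 x4 * pdiff x2 x3)"

lemma cross_ratio_normalization: "cross_ratio Infty (Fin (-1)) (Fin 0) (Fin z) = Fin z"
  by (simp add: cross_ratio_def pdiff_def of_hom_def)


section \<open>Stable five-pointed curves of genus 0\<close>

text \<open>A nodal curve all of whose components are projective lines. The marked points are indexed by
  the type \<^typ>\<open>5\<close>, that is, by \<open>\<int>/5\<close>. An unordered pair \<open>{v, w}\<close> in \<open>nodes\<close> is a node joining the
  components \<open>v\<close> and \<open>w\<close>, and \<open>node_pt C v w\<close> is its position on \<open>v\<close>.\<close>

record pcurve =
  comps :: "nat set"
  nodes :: "nat set set"
  node_pt :: "nat \<Rightarrow> nat \<Rightarrow> cp1"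
  mark_comp :: "5 \<Rightarrow> nat"
  mark_pt :: "5 \<Rightarrow> cp1"

text \<open>Connectedness together with \<open>#nodes + 1 = #components\<close> says that the dual graph is a tree,
  i.e. that the curve has arithmetic genus 0.\<close>

definition dual_tree :: "pcurve \<Rightarrow> bool" where
  "dual_tree C \<longleftrightarrow>
     finite (comps C) \<and> comps C \<noteq> {} \<and>
     nodes C \<subseteq> {{v, w} |v w. v \<in> comps C \<and> w \<in> comps C \<and> v \<noteq> w} \<and>
     (\<forall>v\<in>comps C. \<forall>w\<in>comps C. (v, w) \<in> {(a, b). {a, b} \<in> nodes C}\<^sup>*) \<and>
     card (nodes C) + 1 = card (comps C)"

definition stable_curve :: "pcurve \<Rightarrow> bool" where
  "stable_curve C \<longleftrightarrow>
     dual_tree C \<and>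
     (\<forall>i. mark_comp C i \<in> comps C) \<and>
     (\<forall>v\<in>comps C.
        inj_on (node_pt C v) {w. {v, w} \<in> nodes C} \<and>
        inj_on (mark_pt C) {i. mark_comp C i = v} \<and>
        node_pt C v ` {w. {v, w} \<in> nodes C} \<inter> mark_pt C ` {i. mark_comp C i = v} = {} \<and>
        3 \<le> card {w. {v, w} \<in> nodes C} + card {i. mark_comp C i = v})"

definition curve_iso :: "pcurve \<Rightarrow> pcurve \<Rightarrow> bool" where
  "curve_iso C C' \<longleftrightarrow> (\<exists>\<sigma> \<phi>.
     bij_betw \<sigma> (comps C) (comps C') \<and>
     (\<forall>v\<in>comps C. moebius (\<phi> v)) \<and>
     (\<forall>v\<in>comps C. \<forall>w\<in>comps C. {v, w} \<in> nodes C \<longleftrightarrow> {\<sigma> v, \<sigma> w} \<in> nodes C') \<and>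
     (\<forall>v w. {v, w} \<in> nodes C \<longrightarrow> node_pt C' (\<sigma> v) (\<sigma> w) = \<phi> v (node_pt C v w)) \<and>
     (\<forall>i. mark_comp C' i = \<sigma> (mark_comp C i)) \<and>
     (\<forall>i. mark_pt C' i = \<phi> (mark_comp C i) (mark_pt C i)))"

type_synonym mpoint = "pcurve set"

definition M05bar :: "mpoint set" where
  "M05bar = {C. stable_curve C} //
     {(C, C'). stable_curve C \<and> stable_curve C' \<and> curve_iso C C'}"

text \<open>The point of the component \<open>v\<close> at which the rest of the curve carrying the \<open>i\<close>-th marked point
  is attached (or that marked point itself, if it lies on \<open>v\<close>): the image of the \<open>i\<close>-th marked point
  when the curve is contracted to \<open>v\<close>.\<close>

definition branch :: "pcurve \<Rightarrow> nat \<Rightarrow> 5 \<Rightarrow> cp1" where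
  "branch C v i =
     (if mark_comp C i = v then mark_pt C i
      else node_pt C v (THE w. {v, w} \<in> nodes C \<and>
        (w, mark_comp C i) \<in> {(a, b). {a, b} \<in> nodes C \<and> a \<noteq> v \<and> b \<noteq> v}\<^sup>*))"

text \<open>The cross-ratio of four marked points as a map from \<^term>\<open>M05bar\<close> to the projective line: the
  forgetful map to the moduli space of stable four-pointed curves, identified with the projective
  line by the cross-ratio. It is computed on any component on which it is determinate.\<close>

definition mcross :: "mpoint \<Rightarrow> 5 \<Rightarrow> 5 \<Rightarrow> 5 \<Rightarrow> 5 \<Rightarrow> cp1" where
  "mcross p i j k l = (THE r. \<exists>C\<in>p. \<exists>v\<in>comps C.
     cr_determinate (branch C v i) (branch C v j) (branch C v k) (branch C v l) \<and>
     r = cross_ratio (branch C v i) (branch C v j) (branch C v k) (branch C v l))"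

text \<open>The boundary divisor where the \<open>i\<close>-th and \<open>j\<close>-th marked points collide: some node separates
  them from the other three marked points.\<close>

definition bdiv :: "5 \<Rightarrow> 5 \<Rightarrow> mpoint set" where
  "bdiv i j = {p \<in> M05bar. \<exists>C\<in>p. \<exists>v w. {v, w} \<in> nodes C \<and>
     {k. (v, mark_comp C k) \<in> {(a, b). {a, b} \<in> nodes C - {{v, w}}}\<^sup>*} = {i, j}}"

definition Mcyc :: "mpoint set" where
  "Mcyc = M05bar - (\<Union>c. bdiv c (c + 1))"

text \<open>The point of \<^term>\<open>M05bar\<close> given by a configuration of five points of the projective line, no
  three of which coincide: the stable curve with a component to which it contracts as the given
  configuration (so points that coincide are moved to a further component attached there).
  If the five points are distinct, this is the projective line with these marked points.\<close>

definition config_point :: "(5 \<Rightarrow> cp1) \<Rightarrow> mpoint" where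
  "config_point x = (THE p. p \<in> M05bar \<and> (\<exists>C\<in>p. \<exists>v\<in>comps C. \<forall>i. branch C v i = x i))"


section \<open>Varieties in products of projective lines\<close>

text \<open>A variety is given by a set \<open>S\<close> and an injective coordinate map \<open>\<kappa>\<close> from \<open>S\<close> to a product of
  projective lines. \<open>mform d a\<close> is the multihomogeneous polynomial of multidegree \<open>d\<close> with
  coefficients \<open>a\<close>; a change of homogeneous coordinates multiplies its value by a nonzero factor that
  depends only on \<open>d\<close>.\<close>

definition mform :: "('i::finite \<Rightarrow> nat) \<Rightarrow> (('i \<Rightarrow> nat) \<Rightarrow> complex) \<Rightarrow> ('i \<Rightarrow> cp1) \<Rightarrow> complex" where
  "mform d a x =
     (\<Sum>e \<in> {e. \<forall>i. e i \<le> d i}. a e * (\<Prod>i\<in>UNIV. hx (x i) ^ e i * hy (x i) ^ (d i - e i)))"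

definition zariski_open :: "('a \<Rightarrow> 'i::finite \<Rightarrow> cp1) \<Rightarrow> 'a set \<Rightarrow> 'a set \<Rightarrow> bool" where
  "zariski_open \<kappa> S U \<longleftrightarrow> (\<exists>T. U = {p \<in> S. \<exists>(d, a) \<in> T. mform d a (\<kappa> p) \<noteq> 0})"

definition regular_on :: "('a \<Rightarrow> 'i::finite \<Rightarrow> cp1) \<Rightarrow> 'a set \<Rightarrow> ('a \<Rightarrow> complex) \<Rightarrow> bool" where
  "regular_on \<kappa> U f \<longleftrightarrow> (\<forall>p\<in>U. \<exists>V. zariski_open \<kappa> U V \<and> p \<in> V \<and>
     (\<exists>d a b. \<forall>q\<in>V. mform d b (\<kappa> q) \<noteq> 0 \<and> f q = mform d a (\<kappa> q) / mform d b (\<kappa> q)))"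

definition morphism ::
  "('a \<Rightarrow> 'i::finite \<Rightarrow> cp1) \<Rightarrow> 'a set \<Rightarrow> ('b \<Rightarrow> 'j::finite \<Rightarrow> cp1) \<Rightarrow> 'b set \<Rightarrow> ('a \<Rightarrow> 'b) \<Rightarrow> bool" where
  "morphism \<kappa> S \<kappa>' T f \<longleftrightarrow> f ` S \<subseteq> T \<and>
     (\<forall>V. zariski_open \<kappa>' T V \<longrightarrow>
        zariski_open \<kappa> S {p \<in> S. f p \<in> V} \<and>
        (\<forall>g. regular_on \<kappa>' V g \<longrightarrow> regular_on \<kappa> {p \<in> S. f p \<in> V} (\<lambda>p. g (f p))))"

definition embedding ::
  "('a \<Rightarrow> 'i::finite \<Rightarrow> cp1) \<Rightarrow> 'a set \<Rightarrow> ('b \<Rightarrow> 'j::finite \<Rightarrow> cp1) \<Rightarrow> 'b set \<Rightarrow> ('a \<Rightarrow> 'b) \<Rightarrow> bool" where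
  "embedding \<kappa> S \<kappa>' T f \<longleftrightarrow> inj_on f S \<and> morphism \<kappa> S \<kappa>' T f \<and>
     morphism \<kappa>' (f ` S) \<kappa> S (inv_into S f)"

text \<open>The five forgetful maps to the moduli space of stable four-pointed curves. They embed
  \<^term>\<open>M05bar\<close> as a closed subvariety of the product of five projective lines, which is how it
  acquires its structure of a variety here. The cross-ratio of the same four points in another
  order is a fixed Moebius transform of the one chosen.\<close>

definition mcoord :: "mpoint \<Rightarrow> 5 \<Rightarrow> cp1" where
  "mcoord p i = mcross p (i + 1) (i + 2) (i + 3) (i + 4)"

definition torus :: "(complex \<times> complex) set" where
  "torus = {(X, Y). X \<noteq> 0 \<and> Y \<noteq> 0}"

definition torus_coord :: "complex \<times> complex \<Rightarrow> bool \<Rightarrow> cp1" where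
  "torus_coord = (\<lambda>(X, Y) s. Fin (if s then X else Y))"


section \<open>The five charts and the functions\<close>

definition base_config :: "complex \<Rightarrow> complex \<Rightarrow> 5 \<Rightarrow> cp1" where
  "base_config X Y k =
     (if k = 0 then Infty
      else if k = 1 then Fin (-1)
      else if k = 2 then Fin 0
      else if k = 3 then Fin X
      else Fin (X * (1 + Y)))"

text \<open>\<open>psi c (X, Y)\<close> is the configuration with
  \<open>(x_c, x_{c+1}, \<dots>, x_{c+4}) = (\<infinity>, -1, 0, X, X (1 + Y))\<close>.\<close>

definition psi :: "5 \<Rightarrow> complex \<times> complex \<Rightarrow> mpoint" where
  "psi c = (\<lambda>(X, Y). config_point (\<lambda>i. base_config X Y (i - c)))"

text \<open>Integral powers of a point of the projective line as complex numbers; at \<^term>\<open>Infty\<close> the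
  exponent \<open>n\<close> gives 0 for negative \<open>n\<close> and 1 for \<open>n = 0\<close>. (Positive powers at \<^term>\<open>Infty\<close> and
  negative powers at \<^term>\<open>Fin 0\<close> have junk value 0.)\<close>

definition cp1_power :: "cp1 \<Rightarrow> int \<Rightarrow> complex" where
  "cp1_power r n = hx r powi n * hy r powi (- n)"

text \<open>Functions on \<^term>\<open>Mcyc\<close> are represented by functions that vanish elsewhere.\<close>

definition Xfun :: "int \<Rightarrow> int \<Rightarrow> 5 \<Rightarrow> mpoint \<Rightarrow> complex" where
  "Xfun a b c = (\<lambda>p. if p \<in> Mcyc
     then cp1_power (mcross p c (c + 1) (c + 2) (c + 3)) a *
          cp1_power (mcross p c (c + 2) (c + 3) (c + 4)) b
     else 0)"

definition regular_functions_Mcyc :: "(mpoint \<Rightarrow> complex) set" where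
  "regular_functions_Mcyc = {f. regular_on mcoord Mcyc f \<and> (\<forall>p. p \<notin> Mcyc \<longrightarrow> f p = 0)}"

definition fun_scale :: "complex \<Rightarrow> (mpoint \<Rightarrow> complex) \<Rightarrow> mpoint \<Rightarrow> complex" where
  "fun_scale k f = (\<lambda>p. k * f p)"

lemma vector_space_fun_scale: "vector_space fun_scale"
  by unfold_locales (auto simp: fun_scale_def fun_eq_iff algebra_simps)

end

theory Submission
  imports Defs
    "HOL-Computational_Algebra.Polynomial_Factorial"
    "HOL-Computational_Algebra.Field_as_Ring"
    "HOL-Computational_Algebra.Fundamental_Theorem_Algebra"
begin

text \<open>
  A stable five-pointed curve of genus 0 is a star whose leaves carry two marked points each, so it is
  determined by the configuration of the five points seen on its centre. Hence \<^term>\<open>M05bar\<close> is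
  the set of configurations without triple coincidences modulo Moebius transformations, and the
  divisor \<open>D\<^sub>i\<^sub>j\<close> is \<open>x\<^sub>i = x\<^sub>j\<close>. If no two cyclically adjacent points coincide, some \<open>x\<^sub>c\<close> differs from
  all other points (coincidences form a matching of a pentagon), which places the point in a chart.

  The inverses \<open>v\<^sub>i\<close> of the coordinates \<open>mcoord p i\<close> are regular on \<^term>\<open>Mcyc\<close>. With
  \<open>w\<^sub>k = v\<^bsub>2k-1\<^esub>\<close> they satisfy \<open>w\<^bsub>k-1\<^esub> w\<^bsub>k+1\<^esub> = 1 + w\<^sub>k\<close>, the exchange relation of the cluster algebra of type
  \<open>A\<^sub>2\<close>; the functions in the statement are the cluster monomials \<open>w\<^sub>k\<^sup>m w\<^bsub>k+1\<^esub>\<^sup>n\<close>. As Laurent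
  polynomials in \<open>a = w\<^sub>0\<close> and \<open>b = w\<^sub>1\<close> their lowest terms are the monomials \<open>a\<^sup>i b\<^sup>j\<close>, each
  exponent \<open>(i, j)\<close> occurring once; this gives independence. A regular function is a Laurent polynomial on every
  chart. Regularity on the two adjacent charts forces the coefficient of its lowest power \<open>b\<^bsup>-N\<^esup>\<close>
  to be divisible by \<open>(1 + a)\<^sup>N\<close>, and symmetrically with \<open>a\<close> and \<open>b\<close> exchanged, so that its polar
  part is removed by subtracting cluster monomials, until a polynomial in \<open>a\<close> and \<open>b\<close> is left.
\<close>

section \<open>Moebius transformations and the cross-ratio\<close>

text \<open>The index \<open>2k - 1\<close> comes from the charts. The coordinates of
  \<open>psi c\<close> are the inverse of \<open>vcoord (c + 4)\<close> and
  \<open>vcoord (c + 1)\<close>, two cluster variables with consecutive \<open>k\<close>, and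
  passing from \<open>psi c\<close> to \<open>psi (c + 2)\<close> exchanges one of them. The factor
  \<open>1 + a\<close> is the right-hand side of this exchange: with \<open>x\<close> the inverse of
  the variable preceding \<open>a\<close> the relation reads \<open>b = x * (1 + a)\<close>, so a
  pole of order N along \<open>b = 0\<close> would give a pole along \<open>1 + a = 0\<close> inside
  the adjacent chart unless the leading coefficient cancels it. The lowest exponents of the five
  cluster variables are (1, 0), (0, 1), (-1, 0), (-1, -1), (0, -1). These rays cut the plane into
  five cones, one for each chart, and two families of functions coincide exactly on a shared ray;
  this is why the lattice points index the set of functions without repetition. Only the charts 0, 2
  and 3 enter the reduction to a polynomial. The other two are reached by density: a regular
  function that vanishes on one chart vanishes on all.\<close>

lemma UNIV_5: "(UNIV :: 5 set) = {0, 1, 2, 3, 4}"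
  by (rule sym, rule card_subset_eq) simp_all

lemma five_cases: "i = 0 \<or> i = 1 \<or> i = 2 \<or> i = 3 \<or> i = 4" for i :: 5
  using UNIV_5 by auto

lemma hom_nonzero: "hx p \<noteq> 0 \<or> hy p \<noteq> 0"
  by (cases p) auto

lemma of_hom_hx_hy [simp]: "of_hom (hx p) (hy p) = p"
  by (cases p) (auto simp: of_hom_def)

lemma of_hom_scale: "k \<noteq> 0 \<Longrightarrow> of_hom (k * u) (k * v) = of_hom u v"
  by (auto simp: of_hom_def)

text \<open>The factor between a pair of homogeneous coordinates and the normalised pair chosen by
  \<open>hx\<close> and \<open>hy\<close>. For \<open>u = v = 0\<close>, which is not a point, it is
  0.\<close>

definition hscale :: "complex \<Rightarrow> complex \<Rightarrow> complex" where
  "hscale u v = (if v = 0 then u else v)"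

lemma hscale:
  assumes "u \<noteq> 0 \<or> v \<noteq> 0"
  shows hscale_nonzero: "hscale u v \<noteq> 0"
    and hscale_hx: "hscale u v * hx (of_hom u v) = u"
    and hscale_hy: "hscale u v * hy (of_hom u v) = v"
  using assms by (auto simp: hscale_def of_hom_def)

lemma pdiff_eq_0_iff [simp]: "pdiff x y = 0 \<longleftrightarrow> x = y"
  by (cases x; cases y) (auto simp: pdiff_def)

lemma pdiff_commute: "pdiff y x = - pdiff x y"
  by (simp add: pdiff_def)

lemma moebius_of_hom:
  assumes "u \<noteq> 0 \<or> v \<noteq> 0"
  shows "of_hom (a * hx (of_hom u v) + b * hy (of_hom u v)) (c * hx (of_hom u v) + d * hy (of_hom u v))
    = of_hom (a * u + b * v) (c * u + d * v)"
proof -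
  have "of_hom (a * u + b * v) (c * u + d * v) =
    of_hom (hscale u v * (a * hx (of_hom u v) + b * hy (of_hom u v)))
      (hscale u v * (c * hx (of_hom u v) + d * hy (of_hom u v)))"
    by (subst (1 2 3 4) hscale_hx[OF assms, symmetric] hscale_hy[OF assms, symmetric])
       (simp add: algebra_simps hscale_hx[OF assms] hscale_hy[OF assms])
  then show ?thesis
    using hscale_nonzero[OF assms] by (simp add: of_hom_scale)
qed

lemma linear_nonzero:
  fixes a b c d u v :: complex
  assumes "a * d - b * c \<noteq> 0" "u \<noteq> 0 \<or> v \<noteq> 0"
  shows "a * u + b * v \<noteq> 0 \<or> c * u + d * v \<noteq> 0"
proof (rule ccontr)
  assume "\<not> ?thesis"
  then have *: "a * u + b * v = 0" "c * u + d * v = 0" by auto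
  have "(a * d - b * c) * u = d * (a * u + b * v) - b * (c * u + d * v)"
    "(a * d - b * c) * v = a * (c * u + d * v) - c * (a * u + b * v)"
    by (simp_all add: algebra_simps)
  then show False using assms unfolding * by auto
qed

lemma moebiusI:
  assumes "m = (\<lambda>p. of_hom (a * hx p + b * hy p) (c * hx p + d * hy p))" "a * d - b * c \<noteq> 0"
  shows "moebius m"
  using assms unfolding moebius_def by blast

lemma moebiusE:
  assumes "moebius m"
  obtains a b c d where "a * d - b * c \<noteq> 0"
    "\<And>p. m p = of_hom (a * hx p + b * hy p) (c * hx p + d * hy p)"
    "\<And>p. a * hx p + b * hy p \<noteq> 0 \<or> c * hx p + d * hy p \<noteq> 0"
proof -
  obtain a b c d where "a * d - b * c \<noteq> 0"
    "m = (\<lambda>p. of_hom (a * hx p + b * hy p) (c * hx p + d * hy p))"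
    using assms by (auto simp: moebius_def)
  then show thesis using linear_nonzero[OF _ hom_nonzero] by (intro that[of a d b c]) auto
qed

lemma moebius_comp:
  assumes "moebius m" "moebius m'"
  shows "moebius (m' \<circ> m)"
proof -
  from assms(1) obtain a b c d where m: "a * d - b * c \<noteq> 0"
    "\<And>p. m p = of_hom (a * hx p + b * hy p) (c * hx p + d * hy p)"
    "\<And>p. a * hx p + b * hy p \<noteq> 0 \<or> c * hx p + d * hy p \<noteq> 0"
    by (rule moebiusE) blast
  from assms(2) obtain a' b' c' d' where m': "a' * d' - b' * c' \<noteq> 0"
    "\<And>p. m' p = of_hom (a' * hx p + b' * hy p) (c' * hx p + d' * hy p)"
    by (rule moebiusE) blast
  have "(m' \<circ> m) = (\<lambda>p. of_hom ((a' * a + b' * c) * hx p + (a' * b + b' * d) * hy p)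
      ((c' * a + d' * c) * hx p + (c' * b + d' * d) * hy p))"
    by (rule ext) (simp add: m(2) m'(2) moebius_of_hom[OF m(3)] algebra_simps)
  moreover have "(a' * a + b' * c) * (c' * b + d' * d) - (a' * b + b' * d) * (c' * a + d' * c)
      = (a' * d' - b' * c') * (a * d - b * c)"
    by (simp add: algebra_simps)
  moreover have "(a' * d' - b' * c') * (a * d - b * c) \<noteq> 0"
    using m(1) m'(1) by simp
  ultimately show ?thesis
    by - (rule moebiusI, assumption, simp only: not_False_eq_True)
qed

lemma moebius_inverse:
  assumes "moebius m"
  obtains m' where "moebius m'" "\<And>p. m' (m p) = p"
proof -
  from assms obtain a b c d where m: "a * d - b * c \<noteq> 0"
    "\<And>p. m p = of_hom (a * hx p + b * hy p) (c * hx p + d * hy p)"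
    "\<And>p. a * hx p + b * hy p \<noteq> 0 \<or> c * hx p + d * hy p \<noteq> 0"
    by (rule moebiusE) blast
  \<comment> \<open>The adjugate matrix: its product with the matrix of \<open>m\<close> is the
    determinant times the identity.\<close>
  define m' where "m' = (\<lambda>p. of_hom (d * hx p + (- b) * hy p) ((- c) * hx p + a * hy p))"
  have "moebius m'"
    unfolding moebius_def m'_def using m(1)
    by (intro exI[of _ d] exI[of _ "-b"] exI[of _ "-c"] exI[of _ a]) (simp add: algebra_simps)
  moreover have "m' (m p) = p" for p
  proof -
    have "m' (m p) = of_hom ((a * d - b * c) * hx p) ((a * d - b * c) * hy p)"
      unfolding m'_def m(2) moebius_of_hom[OF m(3)] by (simp add: algebra_simps)
    then show ?thesis using m(1) by (simp add: of_hom_scale)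
  qed
  ultimately show thesis by (rule that)
qed

lemma moebius_id: "moebius (\<lambda>p. p)"
  unfolding moebius_def by (intro exI[of _ 1] exI[of _ 0]) simp

lemma moebius_inj: "moebius m \<Longrightarrow> m p = m q \<longleftrightarrow> p = q"
  by (metis moebius_inverse)

text \<open>\<open>pdiff\<close> is the determinant of two coordinate vectors, so a linear map
  multiplies it by its own determinant \<open>D\<close>; the factors \<open>s\<close> come from
  renormalising the image vectors.\<close>

lemma moebius_pdiff:
  assumes "moebius m"
  obtains s D where "\<And>p. s p \<noteq> (0 :: complex)" "D \<noteq> 0"
    "\<And>p q. s p * s q * pdiff (m p) (m q) = D * pdiff p q"
proof -
  from assms obtain a b c d where m: "a * d - b * c \<noteq> 0"
    "\<And>p. m p = of_hom (a * hx p + b * hy p) (c * hx p + d * hy p)"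
    "\<And>p. a * hx p + b * hy p \<noteq> 0 \<or> c * hx p + d * hy p \<noteq> 0"
    by (rule moebiusE) blast
  define s where "s p = hscale (a * hx p + b * hy p) (c * hx p + d * hy p)" for p
  have hx: "s p * hx (m p) = a * hx p + b * hy p" and hy: "s p * hy (m p) = c * hx p + d * hy p" for p
    unfolding s_def m(2) by (rule hscale_hx hscale_hy, rule m(3))+
  have "s p * s q * pdiff (m p) (m q) = (a * d - b * c) * pdiff p q" for p q
  proof -
    have "s p * s q * pdiff (m p) (m q) =
        (s p * hx (m p)) * (s q * hy (m q)) - (s q * hx (m q)) * (s p * hy (m p))"
      by (simp add: pdiff_def algebra_simps)
    also have "\<dots> = (a * d - b * c) * pdiff p q"
      unfolding hx hy by (simp add: pdiff_def algebra_simps)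
    finally show ?thesis .
  qed
  moreover have "s p \<noteq> 0" for p
    unfolding s_def by (rule hscale_nonzero) (rule m(3))
  ultimately show thesis using m(1) that by blast
qed

text \<open>Each of the four points occurs once in the numerator and once in the denominator, so its
  scaling factor cancels; so does \<open>D^2\<close>.\<close>

lemma cross_ratio_moebius:
  assumes "moebius m"
  shows "cross_ratio (m p) (m q) (m r) (m s) = cross_ratio p q r s"
proof -
  obtain t D where t: "\<And>p. t p \<noteq> (0 :: complex)" "D \<noteq> 0"
    "\<And>p q. t p * t q * pdiff (m p) (m q) = D * pdiff p q"
    using moebius_pdiff[OF assms] by metis
  have "D^2 * (pdiff p q * pdiff r s) = (D * pdiff p q) * (D * pdiff r s)" for p q r s
    by (simp add: power2_eq_square)
  also have "\<dots> p q r s = (t p * t q * t r * t s) * (pdiff (m p) (m q) * pdiff (m r) (m s))" for p q r s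
    unfolding t(3)[symmetric] by simp
  finally have *: "D^2 * (pdiff p q * pdiff r s) =
    (t p * t q * t r * t s) * (pdiff (m p) (m q) * pdiff (m r) (m s))" for p q r s .
  have "cross_ratio p q r s = of_hom (D^2 * (pdiff p q * pdiff r s)) (D^2 * (pdiff p s * pdiff q r))"
    using t(2) by (simp add: cross_ratio_def of_hom_scale)
  also have "\<dots> = of_hom ((t p * t q * t r * t s) * (pdiff (m p) (m q) * pdiff (m r) (m s)))
     ((t p * t q * t r * t s) * (pdiff (m p) (m s) * pdiff (m q) (m r)))"
    unfolding * by (simp add: mult_ac)
  also have "\<dots> = cross_ratio (m p) (m q) (m r) (m s)"
    unfolding cross_ratio_def using t(1) by (intro of_hom_scale) auto
  finally show ?thesis by simp
qed

lemma cr_determinate_iff: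
  "cr_determinate x1 x2 x3 x4 \<longleftrightarrow> x1 \<noteq> x2 \<and> x3 \<noteq> x4 \<or> x1 \<noteq> x4 \<and> x2 \<noteq> x3"
  by (simp add: cr_determinate_def)

lemma cr_determinate_moebius:
  "moebius m \<Longrightarrow> cr_determinate (m p) (m q) (m r) (m s) \<longleftrightarrow> cr_determinate p q r s"
  by (simp add: cr_determinate_iff moebius_inj)

lemma moebius_cross_ratio:
  assumes "p \<noteq> q" "p \<noteq> r" "q \<noteq> r"
  shows "moebius (cross_ratio p q r)"
proof -
  have "cross_ratio p q r = (\<lambda>s. of_hom
     ((- pdiff p q * hy r) * hx s + (pdiff p q * hx r) * hy s)
     ((- hy p * pdiff q r) * hx s + (hx p * pdiff q r) * hy s))"
    by (rule ext) (simp add: cross_ratio_def pdiff_def[of r] pdiff_def[of p] algebra_simps)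
  \<comment> \<open>The determinant of the cross-ratio as a linear map in its fourth argument; it
    vanishes only if two of the other three points coincide.\<close>
  moreover have "(- pdiff p q * hy r) * (hx p * pdiff q r) - (pdiff p q * hx r) * (- hy p * pdiff q r)
     = - (pdiff p q * pdiff q r * pdiff p r)"
    by (simp add: pdiff_def algebra_simps)
  ultimately show ?thesis
    using assms unfolding moebius_def
    by (metis (no_types, lifting) mult_eq_0_iff neg_equal_0_iff_equal pdiff_eq_0_iff)
qed

lemma cross_ratio_values:
  assumes "p \<noteq> q" "p \<noteq> r" "q \<noteq> r"
  shows "cross_ratio p q r p = Infty" "cross_ratio p q r q = Fin (-1)" "cross_ratio p q r r = Fin 0"
  using assms pdiff_commute[of r q] by (auto simp: cross_ratio_def of_hom_def)

text \<open>Both triples are sent to infinity, -1, 0 by their cross-ratios; one of these maps is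
  composed with the inverse of the other.\<close>

lemma moebius_three_points:
  assumes "p \<noteq> q" "p \<noteq> r" "q \<noteq> r" "p' \<noteq> q'" "p' \<noteq> r'" "q' \<noteq> r'"
  obtains m where "moebius m" "m p = p'" "m q = q'" "m r = r'"
proof -
  obtain m' where m': "moebius m'" "\<And>s. m' (cross_ratio p' q' r' s) = s"
    using moebius_inverse[OF moebius_cross_ratio[OF assms(4-6)]] by metis
  have "moebius (m' \<circ> cross_ratio p q r)"
    using moebius_comp[OF moebius_cross_ratio[OF assms(1-3)] m'(1)] .
  moreover have "m' Infty = p'" "m' (Fin (-1)) = q'" "m' (Fin 0) = r'"
    using m'(2) cross_ratio_values[OF assms(4-6)] by metis+
  ultimately show thesis
    using that[of "m' \<circ> cross_ratio p q r"] cross_ratio_values[OF assms(1-3)] by simp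
qed

text \<open>Two components of a curve separate the marked points into those attached at the node on the
  one and those attached at the node on the other, so a cross-ratio determinate on both
  is \<open>0\<close>, \<open>-1\<close> or \<open>\<infinity>\<close> on both.\<close>

lemma cross_ratio_two_components:
  assumes "cr_determinate x1 x2 x3 x4" "cr_determinate y1 y2 y3 y4"
    and "x1 = n \<or> y1 = n'" "x2 = n \<or> y2 = n'" "x3 = n \<or> y3 = n'" "x4 = n \<or> y4 = n'"
  shows "cross_ratio x1 x2 x3 x4 = cross_ratio y1 y2 y3 y4"
proof -
  have "cross_ratio a b a d = Fin (-1)" "cross_ratio b a d a = Fin (-1)" if "a \<noteq> b" "a \<noteq> d" for a b d
    using that pdiff_commute[of a b] pdiff_commute[of a d] by (auto simp: cross_ratio_def of_hom_def)
  moreover have "cross_ratio a a b d = Fin 0" "cross_ratio b d a a = Fin 0"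
    if "a \<noteq> b" "a \<noteq> d" for a b d
    using that by (auto simp: cross_ratio_def of_hom_def)
  moreover have "cross_ratio a b d a = Infty" "cross_ratio b a a d = Infty" for a b d
    by (auto simp: cross_ratio_def of_hom_def)
  ultimately show ?thesis
    using assms unfolding cr_determinate_iff by (elim disjE) auto
qed

section \<open>Stable curves and configurations\<close>

text \<open>The condition on the leaves matters for two components: both are then centres of the
  star, and only the one with three marked points qualifies.\<close>

definition centre :: "pcurve \<Rightarrow> nat \<Rightarrow> bool" where
  "centre C v \<longleftrightarrow> v \<in> comps C \<and> nodes C = (\<lambda>w. {v, w}) ` (comps C - {v}) \<and>
     (\<forall>w\<in>comps C - {v}. card {i. mark_comp C i = w} = 2)"

section \<open>Existence of a central component\<close>

lemma handshake:
  assumes "finite E" "\<forall>e\<in>E. \<exists>v w. e = {v, w} \<and> v \<noteq> w \<and> v \<in> V \<and> w \<in> V" "finite V"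
  shows "(\<Sum>v\<in>V. card {w. {v, w} \<in> E}) = 2 * card E"
  using assms(1,2)
proof (induction E rule: finite_induct)
  case (insert e E)
  then obtain a b where ab: "e = {a, b}" "a \<noteq> b" "a \<in> V" "b \<in> V" by auto
  have fin: "finite {w. {v, w} \<in> E}" for v
    by (rule finite_subset[of _ V]) (use insert.prems assms(3) in \<open>force simp: doubleton_eq_iff\<close>)+
  have "card {w. {v, w} \<in> insert e E} = (if v \<in> {a, b} then 1 else 0) + card {w. {v, w} \<in> E}" for v
  proof -
    have "{w. {v, w} \<in> insert e E} = (if v = a then {b} else if v = b then {a} else {}) \<union> {w. {v, w} \<in> E}"
      using ab by (auto simp: doubleton_eq_iff)
    moreover have "(if v = a then {b} else if v = b then {a} else {}) \<inter> {w. {v, w} \<in> E} = {}"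
      using insert.hyps(2) ab by (auto simp: insert_commute)
    ultimately show ?thesis using fin by (simp add: card_Un_disjoint)
  qed
  then have "(\<Sum>v\<in>V. card {w. {v, w} \<in> insert e E}) =
      (\<Sum>v\<in>V. if v \<in> {a, b} then 1 else 0) + (\<Sum>v\<in>V. card {w. {v, w} \<in> E})"
    by (simp only: sum.distrib)
  also have "(\<Sum>v\<in>V. if v \<in> {a, b} then 1 else (0::nat)) = card (V \<inter> {a, b})"
    using assms(3) by (simp add: sum.If_cases Int_def)
  also have "V \<inter> {a, b} = {a, b}" using ab by auto
  finally show ?case using insert ab by simp
qed simp

lemma sum_marks:
  assumes "finite V" "\<forall>i. mark_comp C i \<in> V"
  shows "(\<Sum>v\<in>V. card {i. mark_comp C i = v}) = 5"
proof -
  have "(\<Sum>v\<in>V. card {i. mark_comp C i = v}) = card (\<Union>v\<in>V. {i. mark_comp C i = v})"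
    by (rule card_UN_disjoint[symmetric]) (use assms in auto)
  also have "(\<Union>v\<in>V. {i. mark_comp C i = v}) = (UNIV :: 5 set)"
    using assms(2) by auto
  finally show ?thesis by simp
qed

text \<open>For \<open>n\<close> components, adding up the stability conditions gives
  \<open>3 * n \<le> 2 * (n - 1) + 5\<close>, hence \<open>n \<le> 3\<close>.\<close>

lemma stable_curve_components:
  assumes "stable_curve C"
  shows "finite (comps C)" "card (nodes C) + 1 = card (comps C)" "comps C \<noteq> {}"
    "\<And>e. e \<in> nodes C \<Longrightarrow> \<exists>v w. e = {v, w} \<and> v \<noteq> w \<and> v \<in> comps C \<and> w \<in> comps C"
    "\<And>i. mark_comp C i \<in> comps C"
    "\<And>v. v \<in> comps C \<Longrightarrow> 3 \<le> card {w. {v, w} \<in> nodes C} + card {i. mark_comp C i = v}"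
    "finite (nodes C)" "card (comps C) \<le> 3"
proof -
  show *: "finite (comps C)" "card (nodes C) + 1 = card (comps C)" "comps C \<noteq> {}"
    "\<And>e. e \<in> nodes C \<Longrightarrow> \<exists>v w. e = {v, w} \<and> v \<noteq> w \<and> v \<in> comps C \<and> w \<in> comps C"
    "\<And>i. mark_comp C i \<in> comps C"
    "\<And>v. v \<in> comps C \<Longrightarrow> 3 \<le> card {w. {v, w} \<in> nodes C} + card {i. mark_comp C i = v}"
    using assms unfolding stable_curve_def dual_tree_def by (auto simp: subset_iff)
  show fin: "finite (nodes C)"
    by (rule finite_subset[of _ "Pow (comps C)"]) (use *(1,4) in fastforce)+
  have "3 * card (comps C) = (\<Sum>v\<in>comps C. 3)" by simp
  also have "\<dots> \<le> (\<Sum>v\<in>comps C. card {w. {v, w} \<in> nodes C} + card {i. mark_comp C i = v})"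
    by (rule sum_mono) (rule *(6))
  also have "\<dots> = 2 * card (nodes C) + 5"
    using handshake[OF fin, of "comps C"] sum_marks[of "comps C" C] *(1,4,5) by (simp add: sum.distrib)
  finally show "card (comps C) \<le> 3" using *(2) by simp
qed

text \<open>A leaf has degree one, hence at least two marked points. A leaf with more would leave
  fewer than \<open>5 - 2 * (n - 1)\<close> for \<open>v\<close>, which contradicts the stability of
  \<open>v\<close> for \<open>n = 3\<close> components and the assumption \<open>marks\<close> for
  \<open>n = 2\<close>.\<close>

lemma centreI:
  assumes C: "stable_curve C" and v: "v \<in> comps C" and E: "nodes C = (\<lambda>w. {v, w}) ` (comps C - {v})"
    and marks: "card (comps C) = 2 \<Longrightarrow> card {i. mark_comp C i = v} = 3"
  shows "centre C v"
proof -
  note C' = stable_curve_components[OF C]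
  let ?m = "\<lambda>w. card {i. mark_comp C i = w}"
  have deg: "{u. {w, u} \<in> nodes C} = {v}" if "w \<in> comps C - {v}" for w
  proof -
    have "u = v" if u: "{w, u} \<in> nodes C" for u
    proof -
      obtain x where "{w, u} = {v, x}" using u unfolding E by blast
      then show ?thesis using that \<open>w \<in> comps C - {v}\<close> by (simp add: doubleton_eq_iff)
    qed
    moreover have "{w, v} \<in> nodes C"
      unfolding E using that by (intro image_eqI[of _ _ w]) (simp_all add: insert_commute)
    ultimately show ?thesis by blast
  qed
  have ge: "2 \<le> ?m w" if "w \<in> comps C - {v}" for w
    using C'(6)[of w] deg[OF that] that by simp
  have "{w. {v, w} \<in> nodes C} = comps C - {v}"
    unfolding E by (auto simp: doubleton_eq_iff)
  then have mv: "4 \<le> card (comps C) + ?m v"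
    using C'(6)[OF v] card_Suc_Diff1[OF C'(1) v] by simp
  have sum: "?m v + (\<Sum>w\<in>comps C - {v}. ?m w) = 5"
    using sum_marks[OF C'(1), of C] C'(1,5) v by (simp add: sum.remove)
  have "?m w = 2" if w: "w \<in> comps C - {v}" for w
  proof (rule ccontr)
    assume ne: "?m w \<noteq> 2"
    have "(\<Sum>w\<in>comps C - {v}. 2) < (\<Sum>w\<in>comps C - {v}. ?m w)"
    proof (rule sum_strict_mono_ex1)
      show "\<exists>w\<in>comps C - {v}. 2 < ?m w"
        using ge[OF w] w ne by (intro bexI[of _ w]) auto
    qed (use C'(1) ge in auto)
    moreover have "(\<Sum>w\<in>comps C - {v}. 2) = 2 * (card (comps C) - 1)" using C'(1) v by simp
    ultimately have *: "2 * (card (comps C) - 1) + ?m v < 5" using sum by linarith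
    moreover have "card {v, w} \<le> card (comps C)"
      using w v C'(1) by (intro card_mono) auto
    then have "2 \<le> card (comps C)" using w by auto
    moreover have "card (comps C) \<noteq> 2" using marks * by auto
    ultimately show False using mv by linarith
  qed
  then show ?thesis using v E unfolding centre_def by blast
qed

lemma stable_curve_centre:
  assumes C: "stable_curve C"
  obtains v where "centre C v"
proof -
  note C' = stable_curve_components[OF C]
  have "card (comps C) \<noteq> 0" using C'(1,3) by simp
  then consider "card (comps C) = 1" | "card (comps C) = 2" | "card (comps C) = 3"
    using C'(8) by linarith
  then show thesis
  proof cases
    case 1
    then obtain v where v: "comps C = {v}" by (auto simp: card_1_singleton_iff)
    then have "nodes C = {}" using C'(2,7) by simp
    then have "centre C v" using v by (intro centreI[OF C]) auto
    then show thesis by (rule that)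
  next
    case 2
    then obtain v w where vw: "comps C = {v, w}" "v \<noteq> w" by (auto simp: card_2_iff)
    have "nodes C \<subseteq> {{v, w}}" using C'(4) vw by fastforce
    moreover have "card (nodes C) = 1" using C'(2) 2 by simp
    ultimately have E: "nodes C = {{v, w}}" by (auto simp: card_1_singleton_iff)
    let ?m = "\<lambda>w. card {i. mark_comp C i = w}"
    have "?m v + ?m w = 5"
      using sum_marks[OF C'(1), of C] C'(5) vw by simp
    moreover have "{u. {v, u} \<in> nodes C} = {w}" "{u. {w, u} \<in> nodes C} = {v}"
      unfolding E using vw by (auto simp: doubleton_eq_iff)
    then have "?m v \<ge> 2" "?m w \<ge> 2" using C'(6)[of v] C'(6)[of w] vw by simp_all
    \<comment> \<open>Five marked points split as 2 + 3, and the component with three is the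
      centre.\<close>
    ultimately consider "?m v = 3" | "?m w = 3" by linarith
    then show thesis
    proof cases
      case 1
      have "centre C v" by (rule centreI[OF C]) (use vw E 1 in auto)
      then show thesis by (rule that)
    next
      case 2
      have "centre C w" by (rule centreI[OF C]) (use vw E 2 in \<open>auto simp: insert_commute\<close>)
      then show thesis by (rule that)
    qed
  next
    case 3
    then obtain x y z where xyz: "comps C = {x, y, z}" "x \<noteq> y" "x \<noteq> z" "y \<noteq> z"
      by (auto simp: card_3_iff)
    have sub: "nodes C \<subseteq> {{x, y}, {x, z}, {y, z}}"
    proof
      fix e assume "e \<in> nodes C"
      then obtain v w where "e = {v, w}" "v \<noteq> w" "v \<in> {x, y, z}" "w \<in> {x, y, z}"
        using C'(4)[of e] unfolding xyz(1) by blast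
      then show "e \<in> {{x, y}, {x, z}, {y, z}}" by (auto simp: insert_commute)
    qed
    have "card (nodes C) = 2" using C'(2) 3 by simp
    then obtain e f where E: "nodes C = {e, f}" "e \<noteq> f" by (auto simp: card_2_iff)
    \<comment> \<open>Any two of the three possible edges on three vertices share a vertex.\<close>
    then consider "nodes C = {{x, y}, {x, z}}" | "nodes C = {{y, x}, {y, z}}" | "nodes C = {{z, x}, {z, y}}"
    proof -
      have "e \<in> {{x, y}, {x, z}, {y, z}}" "f \<in> {{x, y}, {x, z}, {y, z}}"
        using sub unfolding E(1) by (simp_all only: insert_subset)
      then have "e = {x, y} \<or> e = {x, z} \<or> e = {y, z}" "f = {x, y} \<or> f = {x, z} \<or> f = {y, z}"
        by simp_all
      then show thesis
        using that E by (elim disjE) (simp_all add: insert_commute)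
    qed
    then have "\<exists>v\<in>comps C. nodes C = (\<lambda>w. {v, w}) ` (comps C - {v})"
    proof cases
      case 1 then show ?thesis using xyz by (intro bexI[of _ x]) (auto simp: insert_Diff_if)
    next
      case 2 then show ?thesis using xyz by (intro bexI[of _ y]) (auto simp: insert_Diff_if)
    next
      case 3 then show ?thesis using xyz by (intro bexI[of _ z]) (auto simp: insert_Diff_if)
    qed
    then obtain v where "v \<in> comps C" "nodes C = (\<lambda>w. {v, w}) ` (comps C - {v})" by blast
    then have "centre C v" using 3 by (intro centreI[OF C]) auto
    then show thesis by (rule that)
  qed
qed

section \<open>Marked points seen from a component\<close>

definition no_triple :: "(5 \<Rightarrow> cp1) \<Rightarrow> bool" where
  "no_triple x \<longleftrightarrow> (\<forall>i j k. i \<noteq> j \<longrightarrow> i \<noteq> k \<longrightarrow> j \<noteq> k \<longrightarrow> \<not> (x i = x j \<and> x i = x k))"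

lemma centre_edge:
  assumes "centre C v"
  shows "{a, b} \<in> nodes C \<longleftrightarrow> a = v \<and> b \<in> comps C - {v} \<or> b = v \<and> a \<in> comps C - {v}"
proof -
  have "nodes C = (\<lambda>w. {v, w}) ` (comps C - {v})"
    using assms by (simp add: centre_def)
  then have "{a, b} \<in> nodes C \<longleftrightarrow> (\<exists>w\<in>comps C - {v}. {a, b} = {v, w})"
    by auto
  then show ?thesis by (auto simp: doubleton_eq_iff)
qed

lemma stable_curve_inj:
  assumes "stable_curve C" "v \<in> comps C"
  shows "{v, w} \<in> nodes C \<Longrightarrow> {v, w'} \<in> nodes C \<Longrightarrow> node_pt C v w = node_pt C v w' \<longleftrightarrow> w = w'"
    and "mark_comp C i = v \<Longrightarrow> mark_comp C j = v \<Longrightarrow> mark_pt C i = mark_pt C j \<longleftrightarrow> i = j"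
    and "{v, w} \<in> nodes C \<Longrightarrow> mark_comp C i = v \<Longrightarrow> node_pt C v w \<noteq> mark_pt C i"
proof -
  have *: "inj_on (node_pt C v) {w. {v, w} \<in> nodes C}" "inj_on (mark_pt C) {i. mark_comp C i = v}"
    "node_pt C v ` {w. {v, w} \<in> nodes C} \<inter> mark_pt C ` {i. mark_comp C i = v} = {}"
    using assms unfolding stable_curve_def by blast+
  show "{v, w} \<in> nodes C \<Longrightarrow> {v, w'} \<in> nodes C \<Longrightarrow> node_pt C v w = node_pt C v w' \<longleftrightarrow> w = w'"
    using *(1) by (auto simp: inj_on_def)
  show "mark_comp C i = v \<Longrightarrow> mark_comp C j = v \<Longrightarrow> mark_pt C i = mark_pt C j \<longleftrightarrow> i = j"
    using *(2) by (auto simp: inj_on_def)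
  show "{v, w} \<in> nodes C \<Longrightarrow> mark_comp C i = v \<Longrightarrow> node_pt C v w \<noteq> mark_pt C i"
    using *(3) by blast
qed

context
  fixes C v
  assumes C: "stable_curve C" and v: "centre C v"
begin

lemma centre_comps: "v \<in> comps C"
  using v by (simp add: centre_def)

lemma mark_comp_comps: "mark_comp C i \<in> comps C"
  using C by (simp add: stable_curve_def)

text \<open>No edge of a star avoids the centre, so the relation in \<open>branch\<close> is empty
  and a mark off the centre is seen at the node leading directly to its leaf.\<close>

lemma branch_centre:
  "branch C v i = (if mark_comp C i = v then mark_pt C i else node_pt C v (mark_comp C i))"
proof (cases "mark_comp C i = v")
  case False
  have R: "{(a, b). {a, b} \<in> nodes C \<and> a \<noteq> v \<and> b \<noteq> v} = {}"
    using centre_edge[OF v] by auto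
  have "{v, mark_comp C i} \<in> nodes C"
    using False mark_comp_comps by (simp add: centre_edge[OF v])
  then have "(THE w. {v, w} \<in> nodes C \<and>
        (w, mark_comp C i) \<in> {(a, b). {a, b} \<in> nodes C \<and> a \<noteq> v \<and> b \<noteq> v}\<^sup>*) = mark_comp C i"
    unfolding R by (intro the_equality) auto
  then show ?thesis using False by (simp add: branch_def)
qed (simp add: branch_def)

text \<open>The centre is the only neighbour of a leaf, and from it every other component is reached
  without passing through the leaf.\<close>

lemma branch_leaf:
  assumes "w \<in> comps C" "w \<noteq> v"
  shows "branch C w i = (if mark_comp C i = w then mark_pt C i else node_pt C w v)"
proof (cases "mark_comp C i = w")
  case False
  let ?R = "{(a, b). {a, b} \<in> nodes C \<and> a \<noteq> w \<and> b \<noteq> w}"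
  have "(v, mark_comp C i) \<in> ?R\<^sup>*"
  proof (cases "mark_comp C i = v")
    case False
    then have "(v, mark_comp C i) \<in> ?R"
      using mark_comp_comps assms \<open>mark_comp C i \<noteq> w\<close> by (simp add: centre_edge[OF v])
    then show ?thesis by blast
  qed simp
  moreover have "{w, x} \<in> nodes C \<longleftrightarrow> x = v" for x
    using assms by (auto simp: centre_edge[OF v])
  ultimately have "(THE x. {w, x} \<in> nodes C \<and> (x, mark_comp C i) \<in> ?R\<^sup>*) = v"
    by (intro the_equality) auto
  then show ?thesis using False by (simp add: branch_def)
qed (simp add: branch_def)

text \<open>The special points of a component are distinct, so two marks are seen at one point only
  through a common node.\<close>

lemma branch_centre_eq_iff:
  assumes "i \<noteq> j"
  shows "branch C v i = branch C v j \<longleftrightarrow> mark_comp C i = mark_comp C j \<and> mark_comp C i \<noteq> v"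
proof -
  note inj = stable_curve_inj[OF C centre_comps]
  have e: "{v, mark_comp C k} \<in> nodes C" if "mark_comp C k \<noteq> v" for k
    using that mark_comp_comps by (simp add: centre_edge[OF v])
  show ?thesis
    using assms inj(1)[OF e e] inj(2) inj(3)[OF e] unfolding branch_centre by (metis (full_types))
qed

lemma leaf_marks:
  assumes "w \<in> comps C" "w \<noteq> v"
  obtains i j where "i \<noteq> j" "{k. mark_comp C k = w} = {i, j}"
proof -
  have "card {i. mark_comp C i = w} = 2"
    using v assms unfolding centre_def by blast
  then show thesis using that by (auto simp: card_2_iff)
qed

lemma no_triple_branch_centre: "no_triple (branch C v)"
  unfolding no_triple_def
proof (intro allI impI notI)
  fix i j k :: 5
  assume ijk: "i \<noteq> j" "i \<noteq> k" "j \<noteq> k" and "branch C v i = branch C v j \<and> branch C v i = branch C v k"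
  then have *: "mark_comp C j = mark_comp C i" "mark_comp C k = mark_comp C i" "mark_comp C i \<noteq> v"
    using branch_centre_eq_iff by metis+
  obtain p q where "{l. mark_comp C l = mark_comp C i} = {p, q}"
    using leaf_marks[OF mark_comp_comps *(3)] by metis
  then have "{i, j, k} \<subseteq> {p, q}" using * by auto
  then show False using ijk by auto
qed

text \<open>The three marks outside a leaf are all seen at its single node. Triple coincidences thus
  distinguish the leaves from the centre.\<close>

lemma not_no_triple_branch_leaf:
  assumes "w \<in> comps C" "w \<noteq> v"
  shows "\<not> no_triple (branch C w)"
proof -
  obtain p q where pq: "p \<noteq> q" "{l. mark_comp C l = w} = {p, q}"
    using leaf_marks[OF assms] by metis
  have "card (UNIV - {p, q} :: 5 set) = 3"
    using pq(1) by (simp add: card_Diff_subset)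
  then obtain i j k where ijk: "UNIV - {p, q} = {i, j, k}" "i \<noteq> j" "i \<noteq> k" "j \<noteq> k"
    by (auto simp: card_3_iff)
  then have "mark_comp C l \<noteq> w" if "l \<in> {i, j, k}" for l
    using pq(2) that by blast
  then have "branch C w l = node_pt C w v" if "l \<in> {i, j, k}" for l
    using that unfolding branch_leaf[OF assms] by simp
  then have "branch C w i = branch C w j \<and> branch C w i = branch C w k" by simp
  then show ?thesis
    using ijk(2-) unfolding no_triple_def by blast
qed

lemma centre_iff: "w \<in> comps C \<Longrightarrow> no_triple (branch C w) \<longleftrightarrow> w = v"
  using no_triple_branch_centre not_no_triple_branch_leaf by blast

lemma cross_ratio_component:
  assumes w: "w \<in> comps C"
    and "cr_determinate (branch C v i) (branch C v j) (branch C v k) (branch C v l)"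
    and "cr_determinate (branch C w i) (branch C w j) (branch C w k) (branch C w l)"
  shows "cross_ratio (branch C w i) (branch C w j) (branch C w k) (branch C w l) =
    cross_ratio (branch C v i) (branch C v j) (branch C v k) (branch C v l)"
proof (cases "w = v")
  case False
  have "branch C w i = node_pt C w v \<or> branch C v i = node_pt C v w" for i
    unfolding branch_leaf[OF w False] branch_centre using False by auto
  then show ?thesis
    using assms by (intro cross_ratio_two_components[of _ _ _ _ _ _ _ _ "node_pt C w v" "node_pt C v w"])
qed simp

end

section \<open>Isomorphism of curves and equivalence of central configurations\<close>

lemma no_triple_determinate:
  assumes "no_triple x" "distinct [i, j, k, l]"
  shows "cr_determinate (x i) (x j) (x k) (x l)"
  using assms unfolding cr_determinate_iff no_triple_def by (simp, metis)

text \<open>An isomorphism preserves the star and the number of marks on each leaf, so it carries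
  the centre to a centre, and a curve has only one.\<close>

lemma curve_iso_centre:
  assumes C: "stable_curve C" and C': "stable_curve C'" and v: "centre C v" and v': "centre C' v'"
    and "curve_iso C C'"
  obtains m where "moebius m" "\<And>i. branch C' v' i = m (branch C v i)"
proof -
  obtain \<sigma> \<phi> where \<sigma>: "bij_betw \<sigma> (comps C) (comps C')"
    and \<phi>: "\<And>v. v \<in> comps C \<Longrightarrow> moebius (\<phi> v)"
    and e: "\<And>v w. v \<in> comps C \<Longrightarrow> w \<in> comps C \<Longrightarrow> {v, w} \<in> nodes C \<longleftrightarrow> {\<sigma> v, \<sigma> w} \<in> nodes C'"
    and n: "\<And>v w. {v, w} \<in> nodes C \<Longrightarrow> node_pt C' (\<sigma> v) (\<sigma> w) = \<phi> v (node_pt C v w)"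
    and mc: "\<And>i. mark_comp C' i = \<sigma> (mark_comp C i)"
    and mp: "\<And>i. mark_pt C' i = \<phi> (mark_comp C i) (mark_pt C i)"
    using \<open>curve_iso C C'\<close> unfolding curve_iso_def by blast
  note vc = centre_comps[OF C v]
  have inj: "\<sigma> a = \<sigma> b \<longleftrightarrow> a = b" if "a \<in> comps C" "b \<in> comps C" for a b
    using \<sigma> that by (auto simp: bij_betw_def inj_on_def)
  have im: "\<sigma> ` comps C = comps C'" using \<sigma> by (simp add: bij_betw_def)
  have "nodes C' = (\<lambda>w. {\<sigma> v, w}) ` (comps C' - {\<sigma> v})"
  proof (intro subset_antisym subsetI)
    fix f assume f: "f \<in> nodes C'"
    obtain p q where "f = {p, q}" "p \<in> comps C'" "q \<in> comps C'"
      using stable_curve_components(4)[OF C' f] by blast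
    then obtain a b where ab: "f = {\<sigma> a, \<sigma> b}" "a \<in> comps C" "b \<in> comps C"
      using im by (metis imageE)
    then have "{a, b} \<in> nodes C" using f e by simp
    then have "a = v \<and> b \<noteq> v \<or> b = v \<and> a \<noteq> v" using centre_edge[OF v] by auto
    then show "f \<in> (\<lambda>w. {\<sigma> v, w}) ` (comps C' - {\<sigma> v})"
      using ab im inj by (auto simp: insert_commute)
  next
    fix f assume "f \<in> (\<lambda>w. {\<sigma> v, w}) ` (comps C' - {\<sigma> v})"
    then obtain u where "f = {\<sigma> v, u}" "u \<in> comps C'" "u \<noteq> \<sigma> v"
      by blast
    then obtain w where w: "f = {\<sigma> v, \<sigma> w}" "w \<in> comps C" "\<sigma> w \<noteq> \<sigma> v"
      using im by (metis imageE)
    then have "{v, w} \<in> nodes C" using centre_edge[OF v] by auto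
    then show "f \<in> nodes C'" using e[OF vc w(2)] w(1) by simp
  qed
  moreover have "card {i. mark_comp C' i = u} = 2" if u: "u \<in> comps C' - {\<sigma> v}" for u
  proof -
    obtain w where w: "u = \<sigma> w" "w \<in> comps C" "w \<noteq> v" using u im by auto
    have "{i. mark_comp C' i = u} = {i. mark_comp C i = w}"
      unfolding mc w(1) using inj[OF mark_comp_comps[OF C v] w(2)] by simp
    then show ?thesis using v w unfolding centre_def by simp
  qed
  ultimately have c: "centre C' (\<sigma> v)" using im vc unfolding centre_def by blast
  have "no_triple (branch C' (\<sigma> v))" by (rule no_triple_branch_centre[OF C' c])
  then have \<sigma>v: "\<sigma> v = v'" using centre_iff[OF C' v'] im vc by blast
  have "branch C' v' i = \<phi> v (branch C v i)" for i
  proof -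
    have "mark_comp C i \<noteq> v \<Longrightarrow> {v, mark_comp C i} \<in> nodes C"
      using centre_edge[OF v] mark_comp_comps[OF C v] by simp
    then show ?thesis
      unfolding branch_centre[OF C v] branch_centre[OF C' c, unfolded \<sigma>v] 
      using mc mp n[of v "mark_comp C i"] \<sigma>v inj[OF mark_comp_comps[OF C v] vc, of i] by auto
  qed
  then show thesis using that \<phi>[OF vc] by blast
qed

text \<open>The coincidences seen on the centre determine which marks share a leaf. A leaf has
  exactly three special points, its node and two marks, which can be moved to any three distinct
  points, so leaves carry no moduli.\<close>

lemma curve_isoI:
  assumes C: "stable_curve C" and C': "stable_curve C'" and v: "centre C v" and v': "centre C' v'"
    and m: "moebius m" "\<And>i. branch C' v' i = m (branch C v i)"
  shows "curve_iso C C'"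
proof -
  note vc = centre_comps[OF C v] and vc' = centre_comps[OF C' v']
  note mc = mark_comp_comps[OF C v] and mc' = mark_comp_comps[OF C' v']
  have same: "mark_comp C i = mark_comp C j \<and> mark_comp C i \<noteq> v \<longleftrightarrow>
      mark_comp C' i = mark_comp C' j \<and> mark_comp C' i \<noteq> v'" if "i \<noteq> j" for i j
    using branch_centre_eq_iff[OF C v that] branch_centre_eq_iff[OF C' v' that] m(2)
      moebius_inj[OF m(1)] by simp
  have partner: "\<exists>j. j \<noteq> i \<and> mark_comp D j = mark_comp D i"
    if D: "stable_curve D" "centre D u" and i: "mark_comp D i \<noteq> u" for D u i
  proof -
    obtain p q where pq: "p \<noteq> q" "{k. mark_comp D k = mark_comp D i} = {p, q}"
      using leaf_marks[OF D mark_comp_comps[OF D] i] by metis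
    then have "mark_comp D p = mark_comp D i" "mark_comp D q = mark_comp D i" by blast+
    then show ?thesis using pq(1) by metis
  qed
  \<comment> \<open>A mark is off the centre iff another mark is seen at the same point, and
    \<open>m\<close> preserves coincidences.\<close>
  have at_centre: "mark_comp C i = v \<longleftrightarrow> mark_comp C' i = v'" for i
    using partner[OF C v, of i] partner[OF C' v', of i] same by metis
  have mark_eq: "mark_comp C i = mark_comp C j \<longleftrightarrow> mark_comp C' i = mark_comp C' j" for i j
    using same[of i j] at_centre by metis
  \<comment> \<open>Components are matched through the marks that they carry; every leaf carries
    some.\<close>
  define \<sigma> where "\<sigma> w = (if w = v then v' else mark_comp C' (SOME i. mark_comp C i = w))" for w
  have \<sigma>v [simp]: "\<sigma> v = v'" by (simp add: \<sigma>_def)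
  have \<sigma>m: "\<sigma> (mark_comp C i) = mark_comp C' i" for i
  proof (cases "mark_comp C i = v")
    case False
    have "mark_comp C (SOME j. mark_comp C j = mark_comp C i) = mark_comp C i"
      by (rule someI[of "\<lambda>j. mark_comp C j = mark_comp C i"]) simp
    then have "mark_comp C' (SOME j. mark_comp C j = mark_comp C i) = mark_comp C' i"
      using mark_eq by blast
    then show ?thesis using False by (simp add: \<sigma>_def)
  next
    case True
    then have "mark_comp C' i = v'" using at_centre by blast
    then show ?thesis using True by simp
  qed
  have comps: "comps D = insert u (range (mark_comp D))" if D: "stable_curve D" "centre D u" for D u
  proof -
    have "w \<in> range (mark_comp D)" if w: "w \<in> comps D" "w \<noteq> u" for w
    proof -
      obtain p q where "{k. mark_comp D k = w} = {p, q}"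
        using leaf_marks[OF D w] by metis
      then have "mark_comp D p = w" by blast
      then show ?thesis by blast
    qed
    then show ?thesis
      using mark_comp_comps[OF D] centre_comps[OF D] by auto
  qed
  have \<sigma>: "bij_betw \<sigma> (comps C) (comps C')"
    unfolding comps[OF C v] comps[OF C' v'] bij_betw_def
  proof
    show "inj_on \<sigma> (insert v (range (mark_comp C)))"
    proof (rule inj_onI)
      fix a b assume "a \<in> insert v (range (mark_comp C))" "b \<in> insert v (range (mark_comp C))" "\<sigma> a = \<sigma> b"
      then show "a = b" using \<sigma>m \<sigma>v at_centre mark_eq by (elim insertE rangeE) metis+
    qed
    show "\<sigma> ` insert v (range (mark_comp C)) = insert v' (range (mark_comp C'))"
      by (simp add: image_image \<sigma>m)
  qed
  then have \<sigma>_eq: "\<sigma> a = \<sigma> b \<longleftrightarrow> a = b" if "a \<in> comps C" "b \<in> comps C" for a b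
    using that by (auto simp: bij_betw_def inj_on_def)
  have \<sigma>c: "\<sigma> a \<in> comps C'" if "a \<in> comps C" for a
    using that \<sigma> by (auto simp: bij_betw_def)
  have "\<exists>\<psi>. moebius \<psi> \<and> (w = v \<longrightarrow> \<psi> = m) \<and> (w \<noteq> v \<longrightarrow> \<psi> (node_pt C w v) = node_pt C' (\<sigma> w) v' \<and>
      (\<forall>i. mark_comp C i = w \<longrightarrow> mark_pt C' i = \<psi> (mark_pt C i)))" if w: "w \<in> comps C" for w
  proof (cases "w = v")
    case False
    obtain p q where pq: "p \<noteq> q" "{k. mark_comp C k = w} = {p, q}"
      using leaf_marks[OF C v w False] by metis
    then have m': "mark_comp C p = w" "mark_comp C q = w" by blast+
    then have m'': "mark_comp C' p = \<sigma> w" "mark_comp C' q = \<sigma> w" using \<sigma>m[of p] \<sigma>m[of q] m' by simp_all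
    have \<sigma>w: "\<sigma> w \<in> comps C'" "\<sigma> w \<noteq> v'"
      using \<sigma>c[OF w] \<sigma>_eq[OF w vc] False by simp_all
    have e: "{w, v} \<in> nodes C" "{\<sigma> w, v'} \<in> nodes C'"
      using w \<sigma>w False by (simp_all add: centre_edge[OF v] centre_edge[OF v'])
    obtain \<psi> where "moebius \<psi>" "\<psi> (node_pt C w v) = node_pt C' (\<sigma> w) v'"
       "\<psi> (mark_pt C p) = mark_pt C' p" "\<psi> (mark_pt C q) = mark_pt C' q"
      using stable_curve_inj[OF C w] stable_curve_inj[OF C' \<sigma>w(1)] e m' m'' pq(1)
      by (metis moebius_three_points)
    moreover have "i = p \<or> i = q" if "mark_comp C i = w" for i
      using that pq(2) by blast
    ultimately show ?thesis using False by (intro exI[of _ \<psi>]) metis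
  qed (use m in auto)
  then obtain \<phi> where \<phi>: "\<And>w. w \<in> comps C \<Longrightarrow> moebius (\<phi> w)" "\<phi> v = m"
     "\<And>w. w \<in> comps C \<Longrightarrow> w \<noteq> v \<Longrightarrow> \<phi> w (node_pt C w v) = node_pt C' (\<sigma> w) v'"
     "\<And>w i. w \<in> comps C \<Longrightarrow> w \<noteq> v \<Longrightarrow> mark_comp C i = w \<Longrightarrow> mark_pt C' i = \<phi> w (mark_pt C i)"
    using vc by metis
  show ?thesis
    unfolding curve_iso_def
  proof (intro exI[of _ \<sigma>] exI[of _ \<phi>] conjI ballI allI impI)
    fix a b assume "a \<in> comps C" "b \<in> comps C"
    then show "{a, b} \<in> nodes C \<longleftrightarrow> {\<sigma> a, \<sigma> b} \<in> nodes C'"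
      using \<sigma>_eq \<sigma>c \<sigma>_eq[OF _ vc] unfolding centre_edge[OF v] centre_edge[OF v'] by simp
  next
    fix a b assume "{a, b} \<in> nodes C"
    then consider "a = v" "b \<in> comps C" "b \<noteq> v" | "b = v" "a \<in> comps C" "a \<noteq> v"
      unfolding centre_edge[OF v] by blast
    then show "node_pt C' (\<sigma> a) (\<sigma> b) = \<phi> a (node_pt C a b)"
    proof cases
      case 1
      then obtain i where i: "b = mark_comp C i" using comps[OF C v] by auto
      then have "branch C v i = node_pt C v b" "branch C' v' i = node_pt C' v' (\<sigma> b)"
        using 1 at_centre[of i] by (simp_all add: branch_centre[OF C v] branch_centre[OF C' v'] \<sigma>m)
      then show ?thesis using 1 m(2)[of i] \<phi>(2) by simp
    next
      case 2
      then show ?thesis using \<phi>(3) by simp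
    qed
  next
    fix i
    show "mark_pt C' i = \<phi> (mark_comp C i) (mark_pt C i)"
    proof (cases "mark_comp C i = v")
      case True
      then show ?thesis
        using m(2)[of i] at_centre[of i] \<phi>(2) by (simp add: branch_centre[OF C v] branch_centre[OF C' v'])
    qed (use \<phi>(4) mc in blast)
  qed (use \<sigma> \<phi>(1) \<sigma>m in auto)
qed

definition curve_rel :: "(pcurve \<times> pcurve) set" where
  "curve_rel = {(C, C'). stable_curve C \<and> stable_curve C' \<and> curve_iso C C'}"

text \<open>Isomorphism is translated into Moebius equivalence of central configurations, where
  identity, inverse and composite are at hand, and translated back.\<close>

lemma equiv_curve_rel: "equiv {C. stable_curve C} curve_rel"
proof (rule equivI)
  show "curve_rel \<subseteq> {C. stable_curve C} \<times> {C. stable_curve C}"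
    by (auto simp: curve_rel_def)
  show "refl_on {C. stable_curve C} curve_rel"
  proof (rule refl_onI)
    fix C assume "C \<in> {C. stable_curve C}"
    then show "(C, C) \<in> curve_rel"
      using curve_isoI[of C C] moebius_id stable_curve_centre[of C]
      by (metis (mono_tags, lifting) case_prodI curve_rel_def mem_Collect_eq)
  qed
  show "sym curve_rel"
  proof (rule symI)
    fix C C' assume "(C, C') \<in> curve_rel"
    then have C: "stable_curve C" "stable_curve C'" "curve_iso C C'" by (auto simp: curve_rel_def)
    then obtain v v' where v: "centre C v" "centre C' v'" using stable_curve_centre by metis
    obtain m where m: "moebius m" "\<And>i. branch C' v' i = m (branch C v i)"
      using curve_iso_centre[OF C(1,2) v C(3)] by metis
    obtain m' where m': "moebius m'" "\<And>p. m' (m p) = p" using moebius_inverse[OF m(1)] by metis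
    have "curve_iso C' C"
      by (rule curve_isoI[OF C(2,1) v(2,1) m'(1)]) (simp add: m m')
    then show "(C', C) \<in> curve_rel" using C by (simp add: curve_rel_def)
  qed
  show "trans curve_rel"
  proof (rule transI)
    fix C C' C'' assume "(C, C') \<in> curve_rel" "(C', C'') \<in> curve_rel"
    then have C: "stable_curve C" "stable_curve C'" "stable_curve C''" "curve_iso C C'" "curve_iso C' C''"
      by (auto simp: curve_rel_def)
    then obtain v v' v'' where v: "centre C v" "centre C' v'" "centre C'' v''"
      using stable_curve_centre by metis
    obtain m where m: "moebius m" "\<And>i. branch C' v' i = m (branch C v i)"
      using curve_iso_centre[OF C(1,2) v(1,2) C(4)] by metis
    obtain m' where m': "moebius m'" "\<And>i. branch C'' v'' i = m' (branch C' v' i)"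
      using curve_iso_centre[OF C(2,3) v(2,3) C(5)] by metis
    have "curve_iso C C''"
      by (rule curve_isoI[OF C(1,3) v(1,3) moebius_comp[OF m(1) m'(1)]]) (simp add: m m')
    then show "(C, C'') \<in> curve_rel" using C by (simp add: curve_rel_def)
  qed
qed

lemma M05bar_eq: "M05bar = {C. stable_curve C} // curve_rel"
  by (simp add: M05bar_def curve_rel_def)

text \<open>The points of \<^term>\<open>M05bar\<close> are the configurations without triple collisions modulo Moebius
  transformations: the configuration seen on the central component determines the curve.\<close>

definition represents :: "(5 \<Rightarrow> cp1) \<Rightarrow> mpoint \<Rightarrow> bool" where
  "represents x p \<longleftrightarrow> p \<in> M05bar \<and> no_triple x \<and> (\<exists>C\<in>p. \<exists>v\<in>comps C. \<forall>i. branch C v i = x i)"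

lemma M05bar_stable: "p \<in> M05bar \<Longrightarrow> C \<in> p \<Longrightarrow> stable_curve C"
  using equiv_curve_rel unfolding M05bar_eq by (metis Union_quotient UnionI mem_Collect_eq)

lemma M05bar_iso: "p \<in> M05bar \<Longrightarrow> C \<in> p \<Longrightarrow> C' \<in> p \<longleftrightarrow> (C, C') \<in> curve_rel"
  using equiv_curve_rel unfolding M05bar_eq
  by (metis (no_types, lifting) quotient_eq_iff in_quotient_imp_closed)

lemma M05bar_eqI: "p \<in> M05bar \<Longrightarrow> p' \<in> M05bar \<Longrightarrow> C \<in> p \<Longrightarrow> C' \<in> p' \<Longrightarrow> curve_iso C C' \<Longrightarrow> p = p'"
  using quotient_eq_iff[OF equiv_curve_rel, of p p' C C'] M05bar_stable
  unfolding M05bar_eq curve_rel_def by blast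

text \<open>A component that sees a configuration without triple coincidences can only be the
  centre.\<close>

lemma representsE:
  assumes "represents x p"
  obtains C v where "C \<in> p" "stable_curve C" "centre C v" "branch C v = x"
proof -
  obtain C v where C: "C \<in> p" "v \<in> comps C" "\<And>i. branch C v i = x i" and x: "no_triple x" and p: "p \<in> M05bar"
    using assms unfolding represents_def by metis
  have s: "stable_curve C" using M05bar_stable[OF p C(1)] .
  obtain w where w: "centre C w" using stable_curve_centre[OF s] .
  have "branch C v = x" using C(3) by blast
  then show thesis using that C(1) s w centre_iff[OF s w C(2)] x by metis
qed

lemma represents_exists:
  assumes "p \<in> M05bar"
  obtains x where "represents x p"
proof -
  obtain C where C: "stable_curve C" "p = curve_rel `` {C}"
    using assms unfolding M05bar_eq by (auto elim: quotientE)
  then have "C \<in> p"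
    using equiv_class_self[OF equiv_curve_rel] by simp
  moreover obtain v where v: "centre C v" using stable_curve_centre[OF C(1)] .
  ultimately have "represents (branch C v) p"
    unfolding represents_def using assms no_triple_branch_centre[OF C(1) v] centre_comps[OF C(1) v] by blast
  then show thesis by (rule that)
qed

lemma represents_unique:
  assumes "represents x p" "represents x p'"
  shows "p = p'"
proof -
  obtain C v where C: "C \<in> p" "stable_curve C" "centre C v" "branch C v = x"
    using representsE[OF assms(1)] .
  obtain C' v' where C': "C' \<in> p'" "stable_curve C'" "centre C' v'" "branch C' v' = x"
    using representsE[OF assms(2)] .
  have "curve_iso C C'"
    by (rule curve_isoI[OF C(2) C'(2) C(3) C'(3) moebius_id]) (simp add: C(4) C'(4))
  then show ?thesis
    using M05bar_eqI C(1) C'(1) assms unfolding represents_def by blast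
qed

lemma config_point_eqI:
  assumes "represents x p"
  shows "config_point x = p"
  unfolding config_point_def
proof (rule the_equality)
  show "p \<in> M05bar \<and> (\<exists>C\<in>p. \<exists>v\<in>comps C. \<forall>i. branch C v i = x i)"
    using assms unfolding represents_def by blast
  show "p' = p" if "p' \<in> M05bar \<and> (\<exists>C\<in>p'. \<exists>v\<in>comps C. \<forall>i. branch C v i = x i)" for p'
    using that assms represents_unique unfolding represents_def by blast
qed

text \<open>Without triple coincidences the cross-ratio is determinate on the centre. Other
  components on which it is determinate give the same value, and other curves of the class change
  the configuration by a Moebius transformation only; so the definite description in
  \<open>mcross\<close> is meaningful.\<close>

lemma mcross_represents:
  assumes "represents x p" "distinct [i, j, k, l]"
  shows "mcross p i j k l = cross_ratio (x i) (x j) (x k) (x l)"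
proof -
  obtain C v where C: "C \<in> p" "stable_curve C" "centre C v" "branch C v = x"
    using representsE[OF assms(1)] .
  have x: "no_triple x" and p: "p \<in> M05bar" using assms(1) by (auto simp: represents_def)
  note det = no_triple_determinate[OF x assms(2)]
  show ?thesis
    unfolding mcross_def
  proof (rule the_equality)
    show "\<exists>C\<in>p. \<exists>v\<in>comps C.
       cr_determinate (branch C v i) (branch C v j) (branch C v k) (branch C v l) \<and>
       cross_ratio (x i) (x j) (x k) (x l) =
         cross_ratio (branch C v i) (branch C v j) (branch C v k) (branch C v l)"
      using C(1,4) det centre_comps[OF C(2,3)] by blast
  next
    fix r
    assume "\<exists>C\<in>p. \<exists>v\<in>comps C.
       cr_determinate (branch C v i) (branch C v j) (branch C v k) (branch C v l) \<and>
       r = cross_ratio (branch C v i) (branch C v j) (branch C v k) (branch C v l)"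
    then obtain C' w where C': "C' \<in> p" "w \<in> comps C'"
      "cr_determinate (branch C' w i) (branch C' w j) (branch C' w k) (branch C' w l)"
      "r = cross_ratio (branch C' w i) (branch C' w j) (branch C' w k) (branch C' w l)" by blast
    have s: "stable_curve C'" using M05bar_stable[OF p C'(1)] .
    obtain v' where v': "centre C' v'" using stable_curve_centre[OF s] .
    have "curve_iso C C'" using M05bar_iso[OF p C(1)] C'(1) by (simp add: curve_rel_def)
    then obtain m where m: "moebius m" "\<And>i. branch C' v' i = m (x i)"
      using curve_iso_centre[OF C(2) s C(3) v'] C(4) by metis
    have "r = cross_ratio (branch C' v' i) (branch C' v' j) (branch C' v' k) (branch C' v' l)"
      unfolding C'(4) using C'(2,3) det
      by (intro cross_ratio_component[OF s v']) (simp_all add: m(2) cr_determinate_moebius[OF m(1)])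
    then show "r = cross_ratio (x i) (x j) (x k) (x l)"
      by (simp add: m(2) cross_ratio_moebius[OF m(1)])
  qed
qed

section \<open>Realisation of configurations by stable curves\<close>

lemma no_triple_fibre:
  assumes "no_triple x"
  shows "card {k. x k = q} \<le> 2"
proof (rule ccontr)
  assume "\<not> ?thesis"
  then have "3 \<le> card {k. x k = q}" by simp
  then obtain T where T: "T \<subseteq> {k. x k = q}" "card T = 3"
    by (metis obtain_subset_with_card_n)
  then obtain i j k where "T = {i, j, k}" "i \<noteq> j" "i \<noteq> k" "j \<noteq> k"
    by (auto simp: card_3_iff)
  moreover from this have "x i = x j \<and> x i = x k" using T(1) by auto
  ultimately show False using assms unfolding no_triple_def by blast
qed

text \<open>Five marks fall into fibres of at most two elements. This bound is the stability of the
  component that carries the configuration.\<close>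

lemma no_triple_card_range:
  assumes "no_triple x"
  shows "3 \<le> card (range x)"
proof -
  have "5 = card (\<Union>q\<in>range x. {k. x k = q})"
  proof -
    have "(\<Union>q\<in>range x. {k. x k = q}) = UNIV" by auto
    then show ?thesis by simp
  qed
  also have "\<dots> \<le> (\<Sum>q\<in>range x. card {k. x k = q})"
    by (rule card_UN_le) simp
  also have "\<dots> \<le> (\<Sum>q\<in>range x. 2)"
    by (rule sum_mono) (rule no_triple_fibre[OF assms])
  finally show ?thesis by simp
qed

text \<open>The configuration is put on component 0, and each value taken twice becomes a node
  leading to a further component with the two marks.\<close>

lemma curve_of_config:
  assumes x: "no_triple x"
  obtains C where "stable_curve C" "centre C 0" "branch C 0 = x"
proof -
  obtain g :: "cp1 \<Rightarrow> nat" where g: "inj_on g (range x)"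
    using finite_imp_inj_to_nat_seg[of "range x"] by auto
  obtain h :: "5 \<Rightarrow> nat" where h: "inj h"
    using finite_imp_inj_to_nat_seg[of "UNIV :: 5 set"] by auto
  define coll where "coll = {i. \<exists>j. j \<noteq> i \<and> x j = x i}"
  define L where "L = (\<lambda>i. Suc (g (x i))) ` coll"
  \<comment> \<open>\<open>g\<close> labels the leaves by the values taken twice, and
    \<open>Suc\<close> reserves 0 for the centre. On a leaf the node is at infinity and the marks
    are at distinct finite points given by \<open>h\<close>.\<close>
  define C where "C = \<lparr>comps = insert 0 L, nodes = (\<lambda>w. {0, w}) ` L,
     node_pt = (\<lambda>a b. if a = 0 then inv_into (range x) g (b - 1) else Infty),
     mark_comp = (\<lambda>i. if i \<in> coll then Suc (g (x i)) else 0),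
     mark_pt = (\<lambda>i. if i \<in> coll then Fin (of_nat (h i)) else x i)\<rparr>"
  have [simp]: "comps C = insert 0 L" "nodes C = (\<lambda>w. {0, w}) ` L"
    "mark_comp C i = (if i \<in> coll then Suc (g (x i)) else 0)"
    "mark_pt C i = (if i \<in> coll then Fin (of_nat (h i)) else x i)"
    "node_pt C a b = (if a = 0 then inv_into (range x) g (b - 1) else Infty)" for i a b
    by (simp_all add: C_def)
  have g_eq: "g (x i) = g (x j) \<longleftrightarrow> x i = x j" for i j
    using g by (auto simp: inj_on_def)
  have coll_cong: "j \<in> coll" if "x i = x j" "i \<in> coll" for i j
    using that unfolding coll_def by auto metis
  have L0: "0 \<notin> L" "finite L" by (auto simp: L_def)
  have nb0: "{0, w} \<in> nodes C \<longleftrightarrow> w \<in> L" for w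
    using L0(1) by (auto simp: doubleton_eq_iff)
  have nbL: "{a, w} \<in> nodes C \<longleftrightarrow> w = 0" if "a \<in> L" for a w
    using L0(1) that by (auto simp: doubleton_eq_iff)
  have inv: "inv_into (range x) g (g (x i)) = x i" for i
    using g by simp
  have leaf: "{k. mark_comp C k = Suc (g (x i))} = {k. x k = x i}" if "i \<in> coll" for i
    using that coll_cong[of i] by (auto simp: g_eq)
  have leaf_card: "card {k. x k = x i} = 2" if i: "i \<in> coll" for i
  proof -
    obtain j where "j \<noteq> i" "x j = x i" using i by (auto simp: coll_def)
    then have "card {i, j} \<le> card {k. x k = x i}" by (intro card_mono) auto
    then show ?thesis using no_triple_fibre[OF x, of "x i"] \<open>j \<noteq> i\<close> by simp
  qed
  have tree: "dual_tree C"
    unfolding dual_tree_def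
  proof (intro conjI ballI)
    show "nodes C \<subseteq> {{v, w} |v w. v \<in> comps C \<and> w \<in> comps C \<and> v \<noteq> w}"
      using L0(1) by fastforce
    let ?R = "{(a, b). {a, b} \<in> nodes C}"
    have "(v, 0) \<in> ?R\<^sup>*" "(0, v) \<in> ?R\<^sup>*" if "v \<in> comps C" for v
    proof -
      have "v = 0 \<or> (v, 0) \<in> ?R \<and> (0, v) \<in> ?R" using that nb0 nbL[of v 0] by auto
      then show "(v, 0) \<in> ?R\<^sup>*" "(0, v) \<in> ?R\<^sup>*" by blast+
    qed
    then show "(v, w) \<in> ?R\<^sup>*" if "v \<in> comps C" "w \<in> comps C" for v w
      using that by (meson rtrancl_trans)
    have "inj_on (\<lambda>w. {0, w}) L" by (auto simp: inj_on_def doubleton_eq_iff)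
    then show "card (nodes C) + 1 = card (comps C)" using L0 by (simp add: card_image)
  qed (use L0 in auto)
  have "stable_curve C"
    unfolding stable_curve_def
  proof (intro conjI allI ballI tree)
    show "mark_comp C i \<in> comps C" for i by (auto simp: L_def)
  next
    fix v assume "v \<in> comps C"
    then consider "v = 0" | i where "i \<in> coll" "v = Suc (g (x i))" by (auto simp: L_def)
    then have "inj_on (node_pt C v) {w. {v, w} \<in> nodes C} \<and>
        inj_on (mark_pt C) {i. mark_comp C i = v} \<and>
        node_pt C v ` {w. {v, w} \<in> nodes C} \<inter> mark_pt C ` {i. mark_comp C i = v} = {} \<and>
        3 \<le> card {w. {v, w} \<in> nodes C} + card {i. mark_comp C i = v}"
    proof cases
      case 1
      have nb: "{w. {0, w} \<in> nodes C} = L" using nb0 by simp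
      have mk: "{i. mark_comp C i = 0} = - coll" by auto
      have "inj_on (node_pt C 0) L" by (auto simp: inj_on_def L_def inv)
      moreover have inj: "inj_on x (- coll)" by (auto simp: inj_on_def coll_def)
      then have "inj_on (mark_pt C) (- coll)" by (auto simp: inj_on_def)
      moreover have "node_pt C 0 ` L \<inter> mark_pt C ` (- coll) = {}"
      proof -
        have "node_pt C 0 ` L = x ` coll" by (simp add: L_def inv image_image)
        moreover have "mark_pt C ` (- coll) = x ` (- coll)" by (rule image_cong) auto
        moreover have "x ` coll \<inter> x ` (- coll) = {}" using coll_cong by blast
        ultimately show ?thesis by simp
      qed
      moreover have "3 \<le> card L + card (- coll)"
      proof -
        have "L = Suc ` g ` x ` coll" by (auto simp: L_def)
        moreover have "inj_on g (x ` coll)" using g by (rule inj_on_subset) auto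
        ultimately have "card L = card (x ` coll)" by (simp add: card_image)
        moreover have "card (- coll) = card (x ` (- coll))" using inj by (simp add: card_image)
        moreover have "range x = x ` coll \<union> x ` (- coll)" by auto
        ultimately show ?thesis
          using no_triple_card_range[OF x] card_Un_le[of "x ` coll" "x ` (- coll)"] by simp
      qed
      ultimately show ?thesis unfolding 1 nb mk by blast
    next
      case 2
      have nb: "{w. {v, w} \<in> nodes C} = {0}"
        using nbL[of v] 2 by (auto simp: L_def)
      have mk: "{i. mark_comp C i = v} = {k. x k = x i}" using leaf 2 by blast
      have "k \<in> coll" if "x k = x i" for k using coll_cong that 2(1) by metis
      then have mp: "mark_pt C k = Fin (of_nat (h k))" if "k \<in> {k. x k = x i}" for k
        using that by simp
      have "inj_on (\<lambda>k. Fin (of_nat (h k))) {k. x k = x i}"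
        using h by (auto simp: inj_on_def)
      also have "?this \<longleftrightarrow> inj_on (mark_pt C) {k. x k = x i}"
        by (rule inj_on_cong[symmetric]) (rule mp)
      finally have "inj_on (mark_pt C) {k. x k = x i}" .
      moreover have "mark_pt C ` {k. x k = x i} = (\<lambda>k. Fin (of_nat (h k))) ` {k. x k = x i}"
        by (rule image_cong[OF refl mp])
      then have "node_pt C v 0 \<notin> mark_pt C ` {k. x k = x i}"
        using 2 by auto
      then have "node_pt C v ` {0} \<inter> mark_pt C ` {k. x k = x i} = {}" by blast
      moreover have "3 \<le> card {0 :: nat} + card {k. x k = x i}" using leaf_card[OF 2(1)] by simp
      moreover have "inj_on (node_pt C v) {0}" by (simp add: inj_on_def)
      ultimately show ?thesis unfolding nb mk by blast
    qed
    then show "inj_on (node_pt C v) {w. {v, w} \<in> nodes C}" "inj_on (mark_pt C) {i. mark_comp C i = v}"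
        "node_pt C v ` {w. {v, w} \<in> nodes C} \<inter> mark_pt C ` {i. mark_comp C i = v} = {}"
        "3 \<le> card {w. {v, w} \<in> nodes C} + card {i. mark_comp C i = v}"
      by blast+
  qed
  moreover have "centre C 0"
    unfolding centre_def
  proof (intro conjI ballI)
    show "nodes C = (\<lambda>w. {0, w}) ` (comps C - {0})" using L0 by simp
    fix w assume "w \<in> comps C - {0}"
    then obtain i where "i \<in> coll" "w = Suc (g (x i))" by (auto simp: L_def)
    then show "card {i. mark_comp C i = w} = 2" using leaf leaf_card by simp
  qed simp
  moreover from calculation have "branch C 0 i = x i" for i
    by (subst branch_centre) (auto simp: inv)
  then have "branch C 0 = x" by blast
  ultimately show thesis by (rule that)
qed

lemma config_represents:
  assumes "no_triple x"
  obtains p where "represents x p"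
proof -
  obtain C where C: "stable_curve C" "centre C 0" "branch C 0 = x"
    using curve_of_config[OF assms] .
  have "curve_rel `` {C} \<in> M05bar" unfolding M05bar_eq using C(1) by (intro quotientI) simp
  moreover have "C \<in> curve_rel `` {C}" using equiv_class_self[OF equiv_curve_rel] C(1) by simp
  ultimately have "represents x (curve_rel `` {C})"
    unfolding represents_def using assms C centre_comps[OF C(1,2)] by blast
  then show thesis by (rule that)
qed

lemma represents_moebius:
  assumes "represents x p" "moebius m"
  shows "represents (\<lambda>i. m (x i)) p"
proof -
  have "no_triple (\<lambda>i. m (x i))"
    using assms moebius_inj[OF assms(2)] unfolding represents_def no_triple_def by simp
  then obtain p' where p': "represents (\<lambda>i. m (x i)) p'" by (rule config_represents)
  obtain C v where C: "C \<in> p" "stable_curve C" "centre C v" "branch C v = x"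
    using representsE[OF assms(1)] .
  obtain C' v' where C': "C' \<in> p'" "stable_curve C'" "centre C' v'" "branch C' v' = (\<lambda>i. m (x i))"
    using representsE[OF p'] .
  have "curve_iso C C'"
    by (rule curve_isoI[OF C(2) C'(2) C(3) C'(3) assms(2)]) (simp add: C(4) C'(4))
  then have "p = p'"
    using M05bar_eqI C(1) C'(1) assms(1) p' unfolding represents_def by blast
  then show ?thesis using p' by simp
qed

lemma represents_centre:
  assumes "represents x p" "C \<in> p" "centre C v"
  obtains m where "moebius m" "\<And>i. branch C v i = m (x i)"
proof -
  obtain C' v' where C': "C' \<in> p" "stable_curve C'" "centre C' v'" "branch C' v' = x"
    using representsE[OF assms(1)] .
  have p: "p \<in> M05bar" using assms(1) by (simp add: represents_def)
  then have "curve_iso C' C" using M05bar_iso[OF p C'(1)] assms(2) by (simp add: curve_rel_def)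
  then show thesis
    using curve_iso_centre[OF C'(2) M05bar_stable[OF p assms(2)] C'(3) assms(3)] C'(4) that by metis
qed

text \<open>A node of a star separates one leaf, with two marks, from the rest, with three. So the
  side described in \<open>bdiv\<close> is a leaf, and its marks are the ones seen together from the
  centre.\<close>

lemma bdiv_represents:
  assumes x: "represents x p" and "i \<noteq> j"
  shows "p \<in> bdiv i j \<longleftrightarrow> x i = x j"
proof
  assume "p \<in> bdiv i j"
  then obtain C a b where C: "C \<in> p" "{a, b} \<in> nodes C"
    and marks: "{k. (a, mark_comp C k) \<in> {(u, w). {u, w} \<in> nodes C - {{a, b}}}\<^sup>*} = {i, j}"
    by (auto simp: bdiv_def)
  have s: "stable_curve C" using M05bar_stable C(1) x unfolding represents_def by blast
  obtain v where v: "centre C v" using stable_curve_centre[OF s] .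
  let ?R = "{(u, w). {u, w} \<in> nodes C - {{a, b}}}"
  \<comment> \<open>Otherwise \<open>b\<close> is a leaf, and the three marks outside it would all
    lie on the side of \<open>a\<close>.\<close>
  have "b = v"
  proof (rule ccontr)
    assume "b \<noteq> v"
    then have b: "a = v" "b \<in> comps C" using C(2) unfolding centre_edge[OF v] by auto
    have "k \<in> {i, j}" if "mark_comp C k \<noteq> b" for k
    proof -
      have "(a, mark_comp C k) \<in> ?R\<^sup>*"
      proof (cases "mark_comp C k = a")
        case False
        then have "(a, mark_comp C k) \<in> ?R"
          using that b mark_comp_comps[OF s v] by (simp add: centre_edge[OF v] doubleton_eq_iff)
        then show ?thesis by blast
      qed simp
      then show ?thesis using marks by blast
    qed
    then have "- {k. mark_comp C k = b} \<subseteq> {i, j}" by blast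
    then have "card (- {k. mark_comp C k = b}) \<le> card {i, j}" by (intro card_mono) auto
    moreover obtain p q where "p \<noteq> q" "{k. mark_comp C k = b} = {p, q}"
      using leaf_marks[OF s v b(2) \<open>b \<noteq> v\<close>] by metis
    ultimately show False using \<open>i \<noteq> j\<close> by (simp add: Compl_eq_Diff_UNIV card_Diff_subset)
  qed
  then have a: "a \<noteq> v" "a \<in> comps C" using C(2) unfolding centre_edge[OF v] by auto
  have "u = a" if "(a, u) \<in> ?R\<^sup>*" for u
    using that
  proof (induction rule: rtrancl_induct)
    case (step y z)
    then have "{a, z} \<in> nodes C" "{a, z} \<noteq> {a, b}" by auto
    then show ?case using a \<open>b = v\<close> by (auto simp: centre_edge[OF v])
  qed simp
  then have "mark_comp C k = a" if "k \<in> {i, j}" for k using marks that by blast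
  then have "branch C v i = branch C v j"
    using branch_centre_eq_iff[OF s v \<open>i \<noteq> j\<close>] a(1) by simp
  moreover obtain m where "moebius m" "\<And>i. branch C v i = m (x i)"
    using represents_centre[OF x C(1) v] by metis
  ultimately show "x i = x j" using moebius_inj by metis
next
  assume eq: "x i = x j"
  obtain C v where C: "C \<in> p" "stable_curve C" and v: "centre C v" and "branch C v = x"
    using representsE[OF x] .
  then have m: "mark_comp C j = mark_comp C i" "mark_comp C i \<noteq> v"
    using branch_centre_eq_iff[OF C(2) v \<open>i \<noteq> j\<close>] eq by auto
  let ?a = "mark_comp C i"
  let ?R = "{(u, w). {u, w} \<in> nodes C - {{?a, v}}}"
  note mc = mark_comp_comps[OF C(2) v]
  have e: "{?a, v} \<in> nodes C" using m(2) mc by (simp add: centre_edge[OF v])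
  have "u = ?a" if "(?a, u) \<in> ?R\<^sup>*" for u
    using that
  proof (induction rule: rtrancl_induct)
    case (step y z)
    then have "{?a, z} \<in> nodes C" "{?a, z} \<noteq> {?a, v}" by auto
    then show ?case using m(2) by (auto simp: centre_edge[OF v])
  qed simp
  then have "{k. (?a, mark_comp C k) \<in> ?R\<^sup>*} = {k. mark_comp C k = ?a}" by auto
  moreover obtain r s where "{k. mark_comp C k = ?a} = {r, s}"
    using leaf_marks[OF C(2) v mc m(2)] by metis
  moreover from this have "i \<in> {r, s}" "j \<in> {r, s}" using m(1) by blast+
  then have "{r, s} = {i, j}" using \<open>i \<noteq> j\<close> by auto
  ultimately show "p \<in> bdiv i j"
    using x C(1) e unfolding bdiv_def represents_def by blast
qed

section \<open>Multihomogeneous forms and regular functions\<close>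

text \<open>Forms are handled as functions, so that closure under products needs no formula for the
  coefficients.\<close>

definition is_form :: "('i::finite \<Rightarrow> nat) \<Rightarrow> (('i \<Rightarrow> cp1) \<Rightarrow> complex) \<Rightarrow> bool" where
  "is_form d F \<longleftrightarrow> (\<exists>a. F = mform d a)"

lemma finite_multidegrees: "finite {e :: 'i::finite \<Rightarrow> nat. \<forall>i. e i \<le> d i}"
proof -
  have "finite {e :: 'i \<Rightarrow> nat. \<forall>i. (i \<in> UNIV \<longrightarrow> e i \<in> {..Max (range d)}) \<and> (i \<notin> UNIV \<longrightarrow> e i = 0)}"
    by (rule finite_set_of_finite_funs) auto
  moreover have "d i \<le> Max (range d)" for i by (rule Max_ge) auto
  then have "e i \<le> Max (range d)" if "e i \<le> d i" for e :: "'i \<Rightarrow> nat" and i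
    using that order_trans by blast
  then have "{e :: 'i \<Rightarrow> nat. \<forall>i. e i \<le> d i} \<subseteq>
      {e. \<forall>i. (i \<in> UNIV \<longrightarrow> e i \<in> {..Max (range d)}) \<and> (i \<notin> UNIV \<longrightarrow> e i = 0)}"
    by blast
  ultimately show ?thesis by (rule rev_finite_subset)
qed

lemma is_form_mform: "is_form d (mform d a)"
  by (auto simp: is_form_def)

lemma is_form_add:
  assumes "is_form d F" "is_form d G"
  shows "is_form d (\<lambda>x. F x + G x)"
proof -
  obtain a b where "F = mform d a" "G = mform d b" using assms by (auto simp: is_form_def)
  then have "(\<lambda>x. F x + G x) = mform d (\<lambda>e. a e + b e)"
    by (simp add: fun_eq_iff mform_def sum.distrib algebra_simps)
  then show ?thesis by (auto simp: is_form_def)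
qed

lemma is_form_cmult:
  assumes "is_form d F"
  shows "is_form d (\<lambda>x. c * F x)"
proof -
  obtain a where "F = mform d a" using assms by (auto simp: is_form_def)
  then have "(\<lambda>x. c * F x) = mform d (\<lambda>e. c * a e)"
    by (simp add: fun_eq_iff mform_def sum_distrib_left mult.assoc)
  then show ?thesis by (auto simp: is_form_def)
qed

lemma is_form_0: "is_form d (\<lambda>x. 0)"
proof -
  have "(\<lambda>x. 0) = mform d (\<lambda>e. 0)" by (simp add: fun_eq_iff mform_def)
  then show ?thesis by (auto simp: is_form_def)
qed

lemma is_form_sum:
  "(\<And>k. k \<in> K \<Longrightarrow> is_form d (F k)) \<Longrightarrow> is_form d (\<lambda>x. \<Sum>k\<in>K. F k x)"
  by (induction K rule: infinite_finite_induct) (auto intro: is_form_0 is_form_add)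

lemma is_form_monom:
  assumes "\<And>i. e i \<le> d i"
  shows "is_form d (\<lambda>x. \<Prod>i\<in>UNIV. hx (x i) ^ e i * hy (x i) ^ (d i - e i))"
proof -
  have "mform d (\<lambda>e'. if e' = e then 1 else 0) x = (\<Prod>i\<in>UNIV. hx (x i) ^ e i * hy (x i) ^ (d i - e i))" for x
  proof -
    have "mform d (\<lambda>e'. if e' = e then 1 else 0) x = (\<Sum>e' \<in> {e. \<forall>i. e i \<le> d i}.
       if e' = e then \<Prod>i\<in>UNIV. hx (x i) ^ e i * hy (x i) ^ (d i - e i) else 0)"
      unfolding mform_def by (rule sum.cong) auto
    then show ?thesis using assms finite_multidegrees[of d] by (simp add: sum.delta)
  qed
  note * = this[symmetric]
  show ?thesis unfolding is_form_def by (intro exI ext) (rule *)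
qed

lemma is_form_mult:
  assumes "is_form d F" "is_form d' G"
  shows "is_form (\<lambda>i. d i + d' i) (\<lambda>x. F x * G x)"
proof -
  obtain a b where ab: "F = mform d a" "G = mform d' b" using assms by (auto simp: is_form_def)
  let ?m = "\<lambda>d e x. \<Prod>i\<in>UNIV. hx (x i) ^ e i * hy (x i) ^ (d i - e i)"
  have "is_form (\<lambda>i. d i + d' i) (\<lambda>x. (a e * b e') * (?m d e x * ?m d' e' x))"
    if "\<And>i. e i \<le> d i" "\<And>i. e' i \<le> d' i" for e e'
  proof (rule is_form_cmult)
    have "?m d e x * ?m d' e' x = ?m (\<lambda>i. d i + d' i) (\<lambda>i. e i + e' i) x" for x
    proof -
      have "d i + d' i - (e i + e' i) = (d i - e i) + (d' i - e' i)" for i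
        using that[of i] by simp
      then show ?thesis by (simp add: prod.distrib[symmetric] power_add mult_ac)
    qed
    then show "is_form (\<lambda>i. d i + d' i) (\<lambda>x. ?m d e x * ?m d' e' x)"
      using is_form_monom[of "\<lambda>i. e i + e' i" "\<lambda>i. d i + d' i"] that by (simp add: add_mono)
  qed
  then have "is_form (\<lambda>i. d i + d' i) (\<lambda>x. \<Sum>e\<in>{e. \<forall>i. e i \<le> d i}. \<Sum>e'\<in>{e. \<forall>i. e i \<le> d' i}.
       (a e * b e') * (?m d e x * ?m d' e' x))"
    by (intro is_form_sum) auto
  moreover have "(\<lambda>x. \<Sum>e\<in>{e. \<forall>i. e i \<le> d i}. \<Sum>e'\<in>{e. \<forall>i. e i \<le> d' i}.
       (a e * b e') * (?m d e x * ?m d' e' x)) = (\<lambda>x. F x * G x)"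
    unfolding ab mform_def by (simp add: sum_product mult_ac)
  ultimately show ?thesis by simp
qed

lemma is_form_1: "is_form (\<lambda>i. 0) (\<lambda>x. 1)"
  using is_form_monom[of "\<lambda>i. 0" "\<lambda>i. 0"] by simp

lemma is_form_hx: "is_form (\<lambda>i. if i = k then 1 else 0) (\<lambda>x. hx (x k))"
proof -
  have "(\<Prod>i\<in>UNIV. hx (x i) ^ (if i = k then 1 else 0) *
      hy (x i) ^ ((if i = k then 1 else 0) - (if i = k then 1 else 0))) = (\<Prod>i\<in>UNIV. if i = k then hx (x i) else 1)" for x
    by (rule prod.cong) auto
  then show ?thesis
    using is_form_monom[of "\<lambda>i. if i = k then 1 else 0" "\<lambda>i. if i = k then 1 else 0"] by simp
qed

lemma is_form_hy: "is_form (\<lambda>i. if i = k then 1 else 0) (\<lambda>x. hy (x k))"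
proof -
  have "(\<Prod>i\<in>UNIV. hx (x i) ^ 0 * hy (x i) ^ ((if i = k then 1 else 0) - 0)) =
      (\<Prod>i\<in>UNIV. if i = k then hy (x i) else 1)" for x
    by (rule prod.cong) auto
  then show ?thesis
    using is_form_monom[of "\<lambda>i. 0" "\<lambda>i. if i = k then 1 else 0"] by simp
qed

lemma is_form_power:
  assumes "is_form d F"
  shows "is_form (\<lambda>i. n * d i) (\<lambda>x. F x ^ n)"
proof (induction n)
  case (Suc n)
  then show ?case using is_form_mult[OF assms Suc] by simp
qed (simp add: is_form_1)

lemma is_form_prod:
  assumes "finite K" "\<And>k. k \<in> K \<Longrightarrow> is_form (d k) (F k)"
  shows "is_form (\<lambda>i. \<Sum>k\<in>K. d k i) (\<lambda>x. \<Prod>k\<in>K. F k x)"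
  using assms
proof (induction K rule: finite_induct)
  case (insert k K)
  have "is_form (\<lambda>i. d k i + (\<Sum>k\<in>K. d k i)) (\<lambda>x. F k x * (\<Prod>k\<in>K. F k x))"
    using insert by (intro is_form_mult) auto
  then show ?case using insert.hyps by simp
qed (simp add: is_form_1)

lemma zariski_open_iff:
  "zariski_open \<kappa> S U \<longleftrightarrow> U \<subseteq> S \<and>
    (\<forall>p\<in>U. \<exists>d F. is_form d F \<and> F (\<kappa> p) \<noteq> 0 \<and> (\<forall>q\<in>S. F (\<kappa> q) \<noteq> 0 \<longrightarrow> q \<in> U))"
proof
  assume "zariski_open \<kappa> S U"
  then obtain T where U: "U = {p \<in> S. \<exists>(d, a) \<in> T. mform d a (\<kappa> p) \<noteq> 0}"
    by (auto simp: zariski_open_def)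
  show "U \<subseteq> S \<and>
    (\<forall>p\<in>U. \<exists>d F. is_form d F \<and> F (\<kappa> p) \<noteq> 0 \<and> (\<forall>q\<in>S. F (\<kappa> q) \<noteq> 0 \<longrightarrow> q \<in> U))"
  proof (intro conjI ballI)
    fix p assume "p \<in> U"
    then obtain d a where "(d, a) \<in> T" "mform d a (\<kappa> p) \<noteq> 0" by (auto simp: U)
    then show "\<exists>d F. is_form d F \<and> F (\<kappa> p) \<noteq> 0 \<and> (\<forall>q\<in>S. F (\<kappa> q) \<noteq> 0 \<longrightarrow> q \<in> U)"
      by (intro exI[of _ d] exI[of _ "mform d a"]) (auto simp: U is_form_mform)
  qed (auto simp: U)
next
  assume *: "U \<subseteq> S \<and>
    (\<forall>p\<in>U. \<exists>d F. is_form d F \<and> F (\<kappa> p) \<noteq> 0 \<and> (\<forall>q\<in>S. F (\<kappa> q) \<noteq> 0 \<longrightarrow> q \<in> U))"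
  \<comment> \<open>The largest candidate: all forms whose non-vanishing locus in \<open>S\<close>
    lies in \<open>U\<close>.\<close>
  define T where "T = {(d, a). \<forall>q\<in>S. mform d a (\<kappa> q) \<noteq> 0 \<longrightarrow> q \<in> U}"
  have "\<exists>(d, a) \<in> T. mform d a (\<kappa> p) \<noteq> 0" if "p \<in> U" for p
  proof -
    obtain d F where F: "is_form d F" "F (\<kappa> p) \<noteq> 0" "\<forall>q\<in>S. F (\<kappa> q) \<noteq> 0 \<longrightarrow> q \<in> U"
      using * \<open>p \<in> U\<close> by blast
    then obtain a where "F = mform d a" by (auto simp: is_form_def)
    then have "(d, a) \<in> T" "mform d a (\<kappa> p) \<noteq> 0" using F by (auto simp: T_def)
    then show ?thesis by blast
  qed
  moreover have "p \<in> U" if "p \<in> S" "(d, a) \<in> T" "mform d a (\<kappa> p) \<noteq> 0" for p d a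
    using that by (auto simp: T_def)
  ultimately have "U = {p \<in> S. \<exists>(d, a) \<in> T. mform d a (\<kappa> p) \<noteq> 0}"
    using * by auto
  then show "zariski_open \<kappa> S U" unfolding zariski_open_def by blast
qed

lemma zariski_open_form:
  "is_form d F \<Longrightarrow> zariski_open \<kappa> S {p \<in> S. F (\<kappa> p) \<noteq> 0}"
  unfolding zariski_open_iff by blast

lemma zariski_open_Union:
  assumes "\<And>U. U \<in> \<U> \<Longrightarrow> zariski_open \<kappa> S U"
  shows "zariski_open \<kappa> S (\<Union>\<U>)"
  unfolding zariski_open_iff
proof (intro conjI ballI)
  show "\<Union>\<U> \<subseteq> S" using assms unfolding zariski_open_iff by blast
  fix p assume "p \<in> \<Union>\<U>"
  then obtain U where U: "U \<in> \<U>" "p \<in> U" by blast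
  obtain d F where "is_form d F" "F (\<kappa> p) \<noteq> 0" "\<forall>q\<in>S. F (\<kappa> q) \<noteq> 0 \<longrightarrow> q \<in> U"
    using assms[OF U(1)] U(2) unfolding zariski_open_iff by blast
  then show "\<exists>d F. is_form d F \<and> F (\<kappa> p) \<noteq> 0 \<and> (\<forall>q\<in>S. F (\<kappa> q) \<noteq> 0 \<longrightarrow> q \<in> \<Union>\<U>)"
    using U(1) by (intro exI[of _ d] exI[of _ F]) blast
qed

text \<open>The form cutting out the neighbourhood is absorbed into the fraction.\<close>

lemma regular_on_iff:
  "regular_on \<kappa> U f \<longleftrightarrow> (\<forall>p\<in>U. \<exists>d A B. is_form d A \<and> is_form d B \<and> B (\<kappa> p) \<noteq> 0 \<and>
     (\<forall>q\<in>U. B (\<kappa> q) \<noteq> 0 \<longrightarrow> f q = A (\<kappa> q) / B (\<kappa> q)))"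
proof
  assume *: "regular_on \<kappa> U f"
  show "\<forall>p\<in>U. \<exists>d A B. is_form d A \<and> is_form d B \<and> B (\<kappa> p) \<noteq> 0 \<and>
     (\<forall>q\<in>U. B (\<kappa> q) \<noteq> 0 \<longrightarrow> f q = A (\<kappa> q) / B (\<kappa> q))"
  proof
    fix p assume "p \<in> U"
    then obtain V d a b where V: "zariski_open \<kappa> U V" "p \<in> V"
      "\<forall>q\<in>V. mform d b (\<kappa> q) \<noteq> 0 \<and> f q = mform d a (\<kappa> q) / mform d b (\<kappa> q)"
      using * unfolding regular_on_def by blast
    then obtain d' F where F: "is_form d' F" "F (\<kappa> p) \<noteq> 0" "\<And>q. q \<in> U \<Longrightarrow> F (\<kappa> q) \<noteq> 0 \<Longrightarrow> q \<in> V"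
      unfolding zariski_open_iff by blast
    show "\<exists>d A B. is_form d A \<and> is_form d B \<and> B (\<kappa> p) \<noteq> 0 \<and>
     (\<forall>q\<in>U. B (\<kappa> q) \<noteq> 0 \<longrightarrow> f q = A (\<kappa> q) / B (\<kappa> q))"
      by (intro exI[of _ "\<lambda>i. d i + d' i"] exI[of _ "\<lambda>x. mform d a x * F x"]
          exI[of _ "\<lambda>x. mform d b x * F x"] conjI is_form_mult is_form_mform F(1))
        (use V F in auto)
  qed
next
  assume *: "\<forall>p\<in>U. \<exists>d A B. is_form d A \<and> is_form d B \<and> B (\<kappa> p) \<noteq> 0 \<and>
     (\<forall>q\<in>U. B (\<kappa> q) \<noteq> 0 \<longrightarrow> f q = A (\<kappa> q) / B (\<kappa> q))"
  show "regular_on \<kappa> U f"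
    unfolding regular_on_def
  proof
    fix p assume p: "p \<in> U"
    then obtain d A B where AB: "is_form d A" "is_form d B" "B (\<kappa> p) \<noteq> 0"
     "\<forall>q\<in>U. B (\<kappa> q) \<noteq> 0 \<longrightarrow> f q = A (\<kappa> q) / B (\<kappa> q)" using * by blast
    then obtain a b where ab: "A = mform d a" "B = mform d b" by (auto simp: is_form_def)
    have "zariski_open \<kappa> U {q \<in> U. B (\<kappa> q) \<noteq> 0}" using AB(2) by (rule zariski_open_form)
    then show "\<exists>V. zariski_open \<kappa> U V \<and> p \<in> V \<and>
     (\<exists>d a b. \<forall>q\<in>V. mform d b (\<kappa> q) \<noteq> 0 \<and> f q = mform d a (\<kappa> q) / mform d b (\<kappa> q))"
      using p AB ab by (intro exI[of _ "{q \<in> U. B (\<kappa> q) \<noteq> 0}"]) auto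
  qed
qed

lemma regular_onE:
  assumes "regular_on \<kappa> U f" "p \<in> U"
  obtains d A B where "is_form d A" "is_form d B" "B (\<kappa> p) \<noteq> 0"
    "\<And>q. q \<in> U \<Longrightarrow> B (\<kappa> q) \<noteq> 0 \<Longrightarrow> f q = A (\<kappa> q) / B (\<kappa> q)"
  using assms unfolding regular_on_iff by blast

lemma regular_onI:
  assumes "\<And>p. p \<in> U \<Longrightarrow> \<exists>d A B. is_form d A \<and> is_form d B \<and> B (\<kappa> p) \<noteq> 0 \<and>
     (\<forall>q\<in>U. B (\<kappa> q) \<noteq> 0 \<longrightarrow> f q = A (\<kappa> q) / B (\<kappa> q))"
  shows "regular_on \<kappa> U f"
  unfolding regular_on_iff by (intro ballI assms)

lemma regular_on_fraction:
  assumes "is_form d A" "is_form d B" "\<And>p. p \<in> U \<Longrightarrow> B (\<kappa> p) \<noteq> 0 \<and> f p = A (\<kappa> p) / B (\<kappa> p)"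
  shows "regular_on \<kappa> U f"
proof (rule regular_onI)
  fix p assume "p \<in> U"
  then show "\<exists>d A B. is_form d A \<and> is_form d B \<and> B (\<kappa> p) \<noteq> 0 \<and>
     (\<forall>q\<in>U. B (\<kappa> q) \<noteq> 0 \<longrightarrow> f q = A (\<kappa> q) / B (\<kappa> q))"
    using assms by (intro exI[of _ d] exI[of _ A] exI[of _ B]) simp
qed

lemma regular_on_add:
  assumes "regular_on \<kappa> U f" "regular_on \<kappa> U g"
  shows "regular_on \<kappa> U (\<lambda>p. f p + g p)"
proof (rule regular_onI)
  fix p assume p: "p \<in> U"
  obtain d A B where f: "is_form d A" "is_form d B" "B (\<kappa> p) \<noteq> 0"
     "\<And>q. q \<in> U \<Longrightarrow> B (\<kappa> q) \<noteq> 0 \<Longrightarrow> f q = A (\<kappa> q) / B (\<kappa> q)"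
    using regular_onE[OF assms(1) p] by metis
  obtain d' A' B' where g: "is_form d' A'" "is_form d' B'" "B' (\<kappa> p) \<noteq> 0"
     "\<And>q. q \<in> U \<Longrightarrow> B' (\<kappa> q) \<noteq> 0 \<Longrightarrow> g q = A' (\<kappa> q) / B' (\<kappa> q)"
    using regular_onE[OF assms(2) p] by metis
  have "is_form (\<lambda>i. d i + d' i) (\<lambda>x. A x * B' x + B x * A' x)"
    by (intro is_form_add is_form_mult f g)
  moreover have "is_form (\<lambda>i. d i + d' i) (\<lambda>x. B x * B' x)"
    by (intro is_form_mult f g)
  moreover have "f q + g q = (A (\<kappa> q) * B' (\<kappa> q) + B (\<kappa> q) * A' (\<kappa> q)) / (B (\<kappa> q) * B' (\<kappa> q))"
    if "q \<in> U" "B (\<kappa> q) * B' (\<kappa> q) \<noteq> 0" for q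
    using that f(4) g(4) by (simp add: field_simps)
  ultimately show "\<exists>d A B. is_form d A \<and> is_form d B \<and> B (\<kappa> p) \<noteq> 0 \<and>
     (\<forall>q\<in>U. B (\<kappa> q) \<noteq> 0 \<longrightarrow> f q + g q = A (\<kappa> q) / B (\<kappa> q))"
    using f(3) g(3)
    by (intro exI[of _ "\<lambda>i. d i + d' i"] exI[of _ "\<lambda>x. A x * B' x + B x * A' x"]
        exI[of _ "\<lambda>x. B x * B' x"]) auto
qed

lemma regular_on_cmult:
  assumes "regular_on \<kappa> U f"
  shows "regular_on \<kappa> U (\<lambda>p. c * f p)"
proof (rule regular_onI)
  fix p assume p: "p \<in> U"
  obtain d A B where f: "is_form d A" "is_form d B" "B (\<kappa> p) \<noteq> 0"
     "\<And>q. q \<in> U \<Longrightarrow> B (\<kappa> q) \<noteq> 0 \<Longrightarrow> f q = A (\<kappa> q) / B (\<kappa> q)"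
    using regular_onE[OF assms(1) p] by metis
  then show "\<exists>d A B. is_form d A \<and> is_form d B \<and> B (\<kappa> p) \<noteq> 0 \<and>
     (\<forall>q\<in>U. B (\<kappa> q) \<noteq> 0 \<longrightarrow> c * f q = A (\<kappa> q) / B (\<kappa> q))"
    by (intro exI[of _ d] exI[of _ "\<lambda>x. c * A x"] exI[of _ B]) (auto intro: is_form_cmult)
qed

section \<open>Maps given by forms\<close>

lemma form_pullback:
  fixes A B :: "'j::finite \<Rightarrow> ('i::finite \<Rightarrow> cp1) \<Rightarrow> complex"
  assumes "\<And>j. is_form (D j) (A j)" "\<And>j. is_form (D j) (B j)"
    and "is_form d G"
  obtains G' where "is_form (\<lambda>i. \<Sum>j\<in>UNIV. d j * D j i) G'"
    "\<And>x. (\<And>j. A j x \<noteq> 0 \<or> B j x \<noteq> 0) \<Longrightarrow>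
      G' x = (\<Prod>j\<in>UNIV. hscale (A j x) (B j x) ^ d j) * G (\<lambda>j. of_hom (A j x) (B j x))"
proof -
  obtain a where a: "G = mform d a" using assms(3) by (auto simp: is_form_def)
  define G' where "G' x = (\<Sum>e \<in> {e. \<forall>j. e j \<le> d j}.
      a e * (\<Prod>j\<in>UNIV. A j x ^ e j * B j x ^ (d j - e j)))" for x
  have "is_form (\<lambda>i. \<Sum>j\<in>UNIV. d j * D j i) G'"
    unfolding G'_def
  proof (intro is_form_sum is_form_cmult)
    fix e assume e: "e \<in> {e. \<forall>j. e j \<le> d j}"
    have "is_form (\<lambda>i. d j * D j i) (\<lambda>x. A j x ^ e j * B j x ^ (d j - e j))" for j
    proof -
      have "(\<lambda>i. e j * D j i + (d j - e j) * D j i) = (\<lambda>i. d j * D j i)"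
        using e by (simp add: add_mult_distrib[symmetric])
      then show ?thesis
        using is_form_mult[OF is_form_power[OF assms(1), of "e j"] is_form_power[OF assms(2), of "d j - e j"], of j j]
        by simp
    qed
    then show "is_form (\<lambda>i. \<Sum>j\<in>UNIV. d j * D j i) (\<lambda>x. \<Prod>j\<in>UNIV. A j x ^ e j * B j x ^ (d j - e j))"
      by (intro is_form_prod) auto
  qed
  moreover have "G' x = (\<Prod>j\<in>UNIV. hscale (A j x) (B j x) ^ d j) * G (\<lambda>j. of_hom (A j x) (B j x))"
    if nz: "\<And>j. A j x \<noteq> 0 \<or> B j x \<noteq> 0" for x
  proof -
    let ?s = "\<lambda>j. hscale (A j x) (B j x)" and ?p = "\<lambda>j. of_hom (A j x) (B j x)"
    have "(\<Prod>j\<in>UNIV. A j x ^ e j * B j x ^ (d j - e j)) =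
       (\<Prod>j\<in>UNIV. ?s j ^ d j) * (\<Prod>j\<in>UNIV. hx (?p j) ^ e j * hy (?p j) ^ (d j - e j))"
      if e: "\<forall>j. e j \<le> d j" for e
    proof -
      have "A j x ^ e j * B j x ^ (d j - e j) = ?s j ^ d j * (hx (?p j) ^ e j * hy (?p j) ^ (d j - e j))" for j
      proof -
        have "A j x ^ e j * B j x ^ (d j - e j) =
          (?s j * hx (?p j)) ^ e j * (?s j * hy (?p j)) ^ (d j - e j)"
          unfolding hscale_hx[OF nz] hscale_hy[OF nz] ..
        also have "\<dots> = ?s j ^ (e j + (d j - e j)) * (hx (?p j) ^ e j * hy (?p j) ^ (d j - e j))"
          by (simp add: power_mult_distrib power_add mult_ac)
        finally show ?thesis using e by simp
      qed
      then show ?thesis by (simp add: prod.distrib)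
    qed
    then show ?thesis
      unfolding G'_def a mform_def sum_distrib_left by (intro sum.cong) auto
  qed
  ultimately show thesis by (rule that)
qed

text \<open>At a given point the scaling factor of a pulled back form is nonzero and depends only on
  the multidegree, so it affects neither non-vanishing nor a quotient of two forms of equal
  multidegree.\<close>

lemma morphism_forms:
  fixes A B :: "'j::finite \<Rightarrow> ('i::finite \<Rightarrow> cp1) \<Rightarrow> complex"
  assumes AB: "\<And>j. is_form (D j) (A j)" "\<And>j. is_form (D j) (B j)"
    and nz: "\<And>p j. p \<in> S \<Longrightarrow> A j (\<kappa> p) \<noteq> 0 \<or> B j (\<kappa> p) \<noteq> 0"
    and f: "\<And>p j. p \<in> S \<Longrightarrow> \<kappa>' (f p) j = of_hom (A j (\<kappa> p)) (B j (\<kappa> p))"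
    and "f ` S \<subseteq> T"
  shows "morphism \<kappa> S \<kappa>' T f"
proof -
  define E where "E d = (\<lambda>i. \<Sum>j\<in>UNIV. d j * D j i)" for d
  define s where "s d p = (\<Prod>j\<in>UNIV. hscale (A j (\<kappa> p)) (B j (\<kappa> p)) ^ d j)" for d p
  have s: "s d p \<noteq> 0" if "p \<in> S" for d p
    using nz[OF that] by (simp add: s_def hscale_nonzero)
  have pb: "\<exists>G'. is_form (E d) G' \<and> (\<forall>p\<in>S. G' (\<kappa> p) = s d p * G (\<kappa>' (f p)))"
    if G: "is_form d G" for d G
  proof (rule form_pullback[OF AB G])
    fix G' assume G': "is_form (\<lambda>i. \<Sum>j\<in>UNIV. d j * D j i) G'"
      "\<And>x. (\<And>j. A j x \<noteq> 0 \<or> B j x \<noteq> 0) \<Longrightarrow>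
          G' x = (\<Prod>j\<in>UNIV. hscale (A j x) (B j x) ^ d j) * G (\<lambda>j. of_hom (A j x) (B j x))"
    have "G' (\<kappa> p) = s d p * G (\<kappa>' (f p))" if p: "p \<in> S" for p
    proof -
      have "\<kappa>' (f p) = (\<lambda>j. of_hom (A j (\<kappa> p)) (B j (\<kappa> p)))" using f[OF p] by (rule ext)
      then show ?thesis unfolding s_def using G'(2)[OF nz[OF p]] by simp
    qed
    then show ?thesis using G'(1) unfolding E_def by blast
  qed
  show ?thesis
    unfolding morphism_def
  proof (intro conjI allI impI)
    show "f ` S \<subseteq> T" by fact
  next
    fix V assume V: "zariski_open \<kappa>' T V"
    show "zariski_open \<kappa> S {p \<in> S. f p \<in> V}"
      unfolding zariski_open_iff
    proof (intro conjI ballI)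
      fix p assume p: "p \<in> {p \<in> S. f p \<in> V}"
      then obtain d G where G: "is_form d G" "G (\<kappa>' (f p)) \<noteq> 0" "\<And>q. q \<in> T \<Longrightarrow> G (\<kappa>' q) \<noteq> 0 \<Longrightarrow> q \<in> V"
        using V unfolding zariski_open_iff by blast
      obtain G' where G': "is_form (E d) G'" "\<And>p. p \<in> S \<Longrightarrow> G' (\<kappa> p) = s d p * G (\<kappa>' (f p))"
        using pb[OF G(1)] by blast
      show "\<exists>d F. is_form d F \<and> F (\<kappa> p) \<noteq> 0 \<and> (\<forall>q\<in>S. F (\<kappa> q) \<noteq> 0 \<longrightarrow> q \<in> {p \<in> S. f p \<in> V})"
        using G G' s p \<open>f ` S \<subseteq> T\<close> by (intro exI[of _ "E d"] exI[of _ G']) auto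
    qed blast
  next
    fix V g assume V: "zariski_open \<kappa>' T V" and g: "regular_on \<kappa>' V g"
    show "regular_on \<kappa> {p \<in> S. f p \<in> V} (\<lambda>p. g (f p))"
    proof (rule regular_onI)
      fix p assume p: "p \<in> {p \<in> S. f p \<in> V}"
      then obtain d F G where FG: "is_form d F" "is_form d G" "G (\<kappa>' (f p)) \<noteq> 0"
         "\<And>q. q \<in> V \<Longrightarrow> G (\<kappa>' q) \<noteq> 0 \<Longrightarrow> g q = F (\<kappa>' q) / G (\<kappa>' q)"
        using regular_onE[OF g, of "f p"] by auto
      obtain F' where F': "is_form (E d) F'" "\<And>p. p \<in> S \<Longrightarrow> F' (\<kappa> p) = s d p * F (\<kappa>' (f p))"
        using pb[OF FG(1)] by blast
      obtain G' where G': "is_form (E d) G'" "\<And>p. p \<in> S \<Longrightarrow> G' (\<kappa> p) = s d p * G (\<kappa>' (f p))"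
        using pb[OF FG(2)] by blast
      show "\<exists>d A B. is_form d A \<and> is_form d B \<and> B (\<kappa> p) \<noteq> 0 \<and>
       (\<forall>q\<in>{p \<in> S. f p \<in> V}. B (\<kappa> q) \<noteq> 0 \<longrightarrow> g (f q) = A (\<kappa> q) / B (\<kappa> q))"
        using FG F' G' s p by (intro exI[of _ "E d"] exI[of _ F'] exI[of _ G']) auto
    qed
  qed
qed

section \<open>Laurent polynomials\<close>

text \<open>The outer variable is \<open>y\<close> and the inner one \<open>x\<close>. The nesting
  provides gcds, and \<open>coeff P 0\<close> is the restriction to \<open>y = 0\<close>.\<close>

definition bipoly :: "complex poly poly \<Rightarrow> complex \<Rightarrow> complex \<Rightarrow> complex" where
  "bipoly P x y = poly (poly P [:y:]) x"

lemma bipoly_simps [simp]: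
  "bipoly 0 x y = 0" "bipoly 1 x y = 1" "bipoly (P + Q) x y = bipoly P x y + bipoly Q x y"
  "bipoly (P - Q) x y = bipoly P x y - bipoly Q x y" "bipoly (P * Q) x y = bipoly P x y * bipoly Q x y"
  "bipoly (P ^ n) x y = bipoly P x y ^ n" "bipoly (pCons p P) x y = poly p x + y * bipoly P x y"
  "bipoly (smult p P) x y = poly p x * bipoly P x y"
  "bipoly (monom p n) x y = poly p x * y ^ n"
  by (simp_all add: bipoly_def poly_monom)

lemma bipoly_sum [simp]: "bipoly (sum P A) x y = (\<Sum>k\<in>A. bipoly (P k) x y)"
  by (induction A rule: infinite_finite_induct) simp_all

lemma bipoly_map_poly: "bipoly P x y = poly (map_poly (\<lambda>p. poly p x) P) y"
  by (induction P) (simp_all add: map_poly_pCons)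

lemma poly_eq_0I:
  fixes p :: "'a::idom poly"
  assumes "infinite A" "\<And>x. x \<in> A \<Longrightarrow> poly p x = 0"
  shows "p = 0"
proof (rule ccontr)
  assume "p \<noteq> 0"
  then have "finite {x. poly p x = 0}" by (rule poly_roots_finite)
  then show False using assms finite_subset[of A "{x. poly p x = 0}"] by blast
qed

lemma infinite_nonzero: "infinite (UNIV - {0 :: complex})"
  by (simp add: infinite_UNIV_char_0)

lemma bipoly_eq_0I:
  assumes "\<And>x y. x \<noteq> 0 \<Longrightarrow> y \<noteq> 0 \<Longrightarrow> bipoly P x y = 0"
  shows "P = 0"
proof (rule poly_eq_0I)
  have "inj (\<lambda>y :: complex. [:y:])" by (auto simp: inj_def)
  then show "infinite ((\<lambda>y. [:y:]) ` (UNIV - {0 :: complex}))"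
    using infinite_nonzero by (metis finite_imageD inj_on_subset subset_UNIV)
  fix q assume "q \<in> (\<lambda>y. [:y:]) ` (UNIV - {0 :: complex})"
  then obtain y where y: "y \<noteq> 0" "q = [:y:]" by auto
  show "poly P q = 0"
    by (rule poly_eq_0I[OF infinite_nonzero]) (use assms y in \<open>auto simp: bipoly_def\<close>)
qed

text \<open>The product \<open>D * P\<close> vanishes on the whole torus, and the polynomial ring is
  a domain. This serves as density of the complement of a curve.\<close>

lemma bipoly_eq_0I':
  assumes "D \<noteq> 0" "\<And>x y. x \<noteq> 0 \<Longrightarrow> y \<noteq> 0 \<Longrightarrow> bipoly D x y \<noteq> 0 \<Longrightarrow> bipoly P x y = 0"
  shows "P = 0"
proof -
  have "D * P = 0" by (rule bipoly_eq_0I) (use assms(2) in auto)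
  then show ?thesis using assms(1) by simp
qed

lemma bipoly_eqI:
  assumes "D \<noteq> 0" "\<And>x y. x \<noteq> 0 \<Longrightarrow> y \<noteq> 0 \<Longrightarrow> bipoly D x y \<noteq> 0 \<Longrightarrow> bipoly P x y = bipoly Q x y"
  shows "P = Q"
  using bipoly_eq_0I'[of D "P - Q"] assms by simp

text \<open>After the power of the variable is split off, the cofactor has no root, not even 0, and
  is constant by the fundamental theorem of algebra.\<close>

lemma poly_nonvanishing_monom:
  fixes q :: "complex poly"
  assumes "\<And>x. x \<noteq> 0 \<Longrightarrow> poly q x \<noteq> 0"
  obtains c m where "c \<noteq> 0" "q = monom c m"
proof -
  have "q \<noteq> 0" using assms[of 1] by auto
  then obtain r where r: "q = [:0, 1:] ^ order 0 q * r" "\<not> [:0, 1:] dvd r"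
    using order_decomp[of q 0] by auto
  have "poly r x \<noteq> 0" for x
  proof (cases "x = 0")
    case True
    then show ?thesis using r(2) poly_eq_0_iff_dvd[of r 0] by simp
  next
    case False
    then show ?thesis using assms[of x] r(1) by (metis mult_zero_right poly_mult)
  qed
  then have "constant (poly r)" using fundamental_theorem_of_algebra by blast
  then have "degree r = 0" by (simp add: constant_degree)
  then obtain c where c: "r = [:c:]" by (auto elim: degree_eq_zeroE)
  have "q = monom c (order 0 q)"
    using r(1) c by (simp add: monom_altdef)
  then show thesis using that[of c] \<open>q \<noteq> 0\<close> by (metis monom_eq_0)
qed

text \<open>If two powers of \<open>y\<close> occurred, both would survive at some
  \<open>x \<noteq> 0\<close>, although the resulting polynomial in \<open>y\<close> has no nonzero
  root and must be a monomial.\<close>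

lemma bipoly_nonvanishing_monom:
  assumes "\<And>x y. x \<noteq> 0 \<Longrightarrow> y \<noteq> 0 \<Longrightarrow> bipoly Q x y \<noteq> 0"
  obtains c m n where "c \<noteq> 0" "\<And>x y. bipoly Q x y = c * x ^ m * y ^ n"
proof -
  define n where "n = degree Q"
  have "Q \<noteq> 0" using assms[of 1 1] by auto
  then have n: "coeff Q n \<noteq> 0" by (simp add: n_def)
  have "coeff Q j = 0" if "j \<noteq> n" for j
  proof (rule ccontr)
    assume j: "coeff Q j \<noteq> 0"
    \<comment> \<open>The factor \<open>[:0, 1:]\<close> makes the point \<open>x\<close> found
      below nonzero.\<close>
    then have "[:0, 1:] * coeff Q j * coeff Q n \<noteq> 0" using n by simp
    then obtain x where x: "poly ([:0, 1:] * coeff Q j * coeff Q n) x \<noteq> 0"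
      using poly_all_0_iff_0 by blast
    then have "x \<noteq> 0" by auto
    then have "poly (map_poly (\<lambda>p. poly p x) Q) y \<noteq> 0" if "y \<noteq> 0" for y
      using assms[of x y] that by (simp add: bipoly_map_poly)
    then obtain c k where "map_poly (\<lambda>p. poly p x) Q = monom c k"
      by (rule poly_nonvanishing_monom)
    then have "poly (coeff Q l) x = (if l = k then c else 0)" for l
      by (metis coeff_map_poly coeff_monom poly_0)
    then show False using x \<open>j \<noteq> n\<close> by (auto split: if_splits)
  qed
  then have Q: "Q = monom (coeff Q n) n"
    by (intro poly_eqI) (simp add: coeff_monom)
  have bipoly: "bipoly Q x y = poly (coeff Q n) x * y ^ n" for x y
    by (subst Q) simp
  have "poly (coeff Q n) x \<noteq> 0" if "x \<noteq> 0" for x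
    using assms[OF that, of 1] bipoly[of x 1] by simp
  then obtain c m where "c \<noteq> 0" "coeff Q n = monom c m" by (rule poly_nonvanishing_monom)
  then show thesis using that[of c m n] bipoly by (simp add: poly_monom)
qed

lemma torus_form:
  assumes "is_form d F"
  obtains P where "\<And>x y. F (torus_coord (x, y)) = bipoly P x y"
proof -
  obtain a where "F = mform d a" using assms by (auto simp: is_form_def)
  then have "F (torus_coord (x, y)) =
     bipoly (\<Sum>e\<in>{e. \<forall>i. e i \<le> d i}. monom (monom (a e) (e True)) (e False)) x y" for x y
    by (simp add: mform_def torus_coord_def UNIV_bool poly_monom mult_ac)
  then show thesis by (rule that)
qed

definition laurent :: "(complex \<Rightarrow> complex \<Rightarrow> complex) \<Rightarrow> bool" where
  "laurent F \<longleftrightarrow> (\<exists>N P. \<forall>x y. x \<noteq> 0 \<longrightarrow> y \<noteq> 0 \<longrightarrow> F x y * (x * y) ^ N = bipoly P x y)"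

text \<open>In lowest terms, the fraction representing a function near one point represents it near every
  other point, because the ring of polynomials is factorial.\<close>

lemma regular_on_torus_laurent:
  assumes "regular_on torus_coord torus f"
  shows "laurent (\<lambda>x y. f (x, y))"
proof -
  have loc: "\<exists>P Q. bipoly Q x0 y0 \<noteq> 0 \<and> (\<forall>x y. x \<noteq> 0 \<longrightarrow> y \<noteq> 0 \<longrightarrow> bipoly Q x y \<noteq> 0 \<longrightarrow> f (x, y) = bipoly P x y / bipoly Q x y)"
    if "x0 \<noteq> 0" "y0 \<noteq> 0" for x0 y0
  proof -
    have "(x0, y0) \<in> torus" using that by (simp add: torus_def)
    then obtain d A B where AB: "is_form d A" "is_form d B" "B (torus_coord (x0, y0)) \<noteq> 0"
      "\<And>q. q \<in> torus \<Longrightarrow> B (torus_coord q) \<noteq> 0 \<Longrightarrow> f q = A (torus_coord q) / B (torus_coord q)"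
      using regular_onE[OF assms] by metis
    obtain P where P: "\<And>x y. A (torus_coord (x, y)) = bipoly P x y" using torus_form[OF AB(1)] by metis
    obtain Q where Q: "\<And>x y. B (torus_coord (x, y)) = bipoly Q x y" using torus_form[OF AB(2)] by metis
    show ?thesis
      using AB(3) AB(4)[unfolded torus_def]
      by (intro exI[of _ P] exI[of _ Q]) (simp add: P Q)
  qed
  obtain P0 Q0 where 0: "bipoly Q0 1 1 \<noteq> 0"
    "\<And>x y. x \<noteq> 0 \<Longrightarrow> y \<noteq> 0 \<Longrightarrow> bipoly Q0 x y \<noteq> 0 \<Longrightarrow> f (x, y) = bipoly P0 x y / bipoly Q0 x y"
    using loc[of 1 1] by auto
  then have "Q0 \<noteq> 0" by auto
  then have "gcd P0 Q0 \<noteq> 0" by simp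
  then obtain P Q g where g: "P0 = P * g" "Q0 = Q * g" "coprime P Q" "g \<noteq> 0"
    using gcd_coprime_exists by blast
  have frac: "bipoly Q x0 y0 \<noteq> 0 \<and> f (x0, y0) = bipoly P x0 y0 / bipoly Q x0 y0"
    if xy: "x0 \<noteq> 0" "y0 \<noteq> 0" for x0 y0
  proof -
    obtain P' Q' where 1: "bipoly Q' x0 y0 \<noteq> 0"
      "\<And>x y. x \<noteq> 0 \<Longrightarrow> y \<noteq> 0 \<Longrightarrow> bipoly Q' x y \<noteq> 0 \<Longrightarrow> f (x, y) = bipoly P' x y / bipoly Q' x y"
      using loc[OF xy] by auto
    then have "Q' \<noteq> 0" by auto
    have "P0 * Q' = P' * Q0"
    proof (rule bipoly_eqI)
      show "Q0 * Q' \<noteq> 0" using \<open>Q0 \<noteq> 0\<close> \<open>Q' \<noteq> 0\<close> by simp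
      fix x y :: complex assume "x \<noteq> 0" "y \<noteq> 0" "bipoly (Q0 * Q') x y \<noteq> 0"
      then show "bipoly (P0 * Q') x y = bipoly (P' * Q0) x y"
        using 0(2)[of x y] 1(2)[of x y] by (simp add: field_simps)
    qed
    then have eq: "P * Q' = P' * Q" using g by simp
    then have "Q dvd P * Q'" by simp
    \<comment> \<open>The reduced denominator divides every local denominator, so it has no zero on
      the torus and is a monomial.\<close>
    then have "Q dvd Q'" using g(3) by (simp add: coprime_commute coprime_dvd_mult_right_iff)
    then have "bipoly Q x0 y0 \<noteq> 0" using 1(1) by auto
    moreover have "bipoly P x0 y0 * bipoly Q' x0 y0 = bipoly P' x0 y0 * bipoly Q x0 y0"
      using arg_cong[OF eq, of "\<lambda>P. bipoly P x0 y0"] by simp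
    ultimately show ?thesis
      using 1(1) unfolding 1(2)[OF xy 1(1)] by (simp add: frac_eq_eq)
  qed
  then obtain c m n where c: "c \<noteq> 0" "\<And>x y. bipoly Q x y = c * x ^ m * y ^ n"
    using bipoly_nonvanishing_monom[of Q] by metis
  \<comment> \<open>Multiplying a fraction with denominator \<open>c * x ^ m * y ^ n\<close> by
    \<open>(x * y) ^ (m + n)\<close> leaves the factor \<open>x ^ n * y ^ m / c\<close>; hence the
    exchanged exponents.\<close>
  define R where "R = monom (monom (1 / c) n) m * P"
  have "f (x, y) * (x * y) ^ (m + n) = bipoly R x y" if "x \<noteq> 0" "y \<noteq> 0" for x y
    using frac[OF that] that c
    by (simp add: R_def poly_monom power_mult_distrib power_add field_simps)
  then show ?thesis unfolding laurent_def by blast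
qed

lemma laurent_exponents:
  assumes "laurent F"
  obtains N0 where "\<And>K N. N0 \<le> K \<Longrightarrow> N0 \<le> N \<Longrightarrow>
    \<exists>P. \<forall>x y. x \<noteq> 0 \<longrightarrow> y \<noteq> 0 \<longrightarrow> F x y * x ^ K * y ^ N = bipoly P x y"
proof -
  obtain N0 P where P: "\<And>x y. x \<noteq> 0 \<Longrightarrow> y \<noteq> 0 \<Longrightarrow> F x y * (x * y) ^ N0 = bipoly P x y"
    using assms unfolding laurent_def by auto
  have "F x y * x ^ K * y ^ N = bipoly (monom (monom 1 (K - N0)) (N - N0) * P) x y"
    if "N0 \<le> K" "N0 \<le> N" "x \<noteq> 0" "y \<noteq> 0" for K N x y
  proof -
    have "F x y * x ^ K * y ^ N = F x y * (x ^ N0 * x ^ (K - N0)) * (y ^ N0 * y ^ (N - N0))"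
      using that by (simp add: power_add[symmetric])
    also have "\<dots> = x ^ (K - N0) * y ^ (N - N0) * (F x y * (x * y) ^ N0)"
      by (simp add: power_mult_distrib mult_ac)
    finally show ?thesis using P[OF that(3,4)] by (simp add: poly_monom)
  qed
  then show thesis by (intro that) blast
qed

lemma laurentI:
  assumes "\<And>x y. x \<noteq> 0 \<Longrightarrow> y \<noteq> 0 \<Longrightarrow> F x y * (x * y) ^ N = bipoly P x y"
  shows "laurent F"
  using assms unfolding laurent_def by blast

lemma laurentE:
  assumes "laurent F"
  obtains N P where "\<And>x y. x \<noteq> 0 \<Longrightarrow> y \<noteq> 0 \<Longrightarrow> F x y * (x * y) ^ N = bipoly P x y"
  using assms unfolding laurent_def by blast

lemma laurent_cong:
  assumes "laurent F" "\<And>x y. x \<noteq> 0 \<Longrightarrow> y \<noteq> 0 \<Longrightarrow> G x y = F x y"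
  shows "laurent G"
proof -
  obtain N P where "\<And>x y. x \<noteq> 0 \<Longrightarrow> y \<noteq> 0 \<Longrightarrow> F x y * (x * y) ^ N = bipoly P x y"
    using laurentE[OF assms(1)] by metis
  then show ?thesis using assms(2) by (intro laurentI[of G N P]) simp
qed

lemma laurent_mult:
  assumes "laurent F" "laurent G"
  shows "laurent (\<lambda>x y. F x y * G x y)"
proof -
  obtain N P where F: "\<And>x y. x \<noteq> 0 \<Longrightarrow> y \<noteq> 0 \<Longrightarrow> F x y * (x * y) ^ N = bipoly P x y"
    using laurentE[OF assms(1)] by metis
  obtain N' P' where G: "\<And>x y. x \<noteq> 0 \<Longrightarrow> y \<noteq> 0 \<Longrightarrow> G x y * (x * y) ^ N' = bipoly P' x y"
    using laurentE[OF assms(2)] by metis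
  show ?thesis
    by (rule laurentI[of _ "N + N'" "P * P'"]) (simp add: F[symmetric] G[symmetric] power_add mult_ac)
qed

lemma laurent_add:
  assumes "laurent F" "laurent G"
  shows "laurent (\<lambda>x y. F x y + G x y)"
proof -
  obtain N P where F: "\<And>x y. x \<noteq> 0 \<Longrightarrow> y \<noteq> 0 \<Longrightarrow> F x y * (x * y) ^ N = bipoly P x y"
    using laurentE[OF assms(1)] by metis
  obtain N' P' where G: "\<And>x y. x \<noteq> 0 \<Longrightarrow> y \<noteq> 0 \<Longrightarrow> G x y * (x * y) ^ N' = bipoly P' x y"
    using laurentE[OF assms(2)] by metis
  show ?thesis
    by (rule laurentI[of _ "N + N'" "monom (monom 1 N') N' * P + monom (monom 1 N) N * P'"])
       (simp add: F[symmetric] G[symmetric] power_add power_mult_distrib poly_monom algebra_simps)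
qed

lemma laurent_const: "laurent (\<lambda>x y. c)"
  by (rule laurentI[of _ 0 "[:[:c:]:]"]) simp

lemma laurent_x: "laurent (\<lambda>x y. x)"
  by (rule laurentI[of _ 0 "[:[:0, 1:]:]"]) simp

lemma laurent_y: "laurent (\<lambda>x y. y)"
  by (rule laurentI[of _ 0 "[:0, 1:]"]) simp

lemma laurent_inv_x: "laurent (\<lambda>x y. 1 / x)"
  by (rule laurentI[of _ 1 "[:0, 1:]"]) simp

lemma laurent_inv_y: "laurent (\<lambda>x y. 1 / y)"
  by (rule laurentI[of _ 1 "[:[:0, 1:]:]"]) simp

lemma laurent_power: "laurent F \<Longrightarrow> laurent (\<lambda>x y. F x y ^ n)"
  by (induction n) (simp_all add: laurent_const laurent_mult)

lemma laurent_sum: "(\<And>k. k \<in> A \<Longrightarrow> laurent (F k)) \<Longrightarrow> laurent (\<lambda>x y. \<Sum>k\<in>A. F k x y)"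
  by (induction A rule: infinite_finite_induct) (simp_all add: laurent_const laurent_add)

lemma bipoly_altdef: "bipoly P x y = (\<Sum>j\<le>degree P. \<Sum>i\<le>degree (coeff P j). coeff (coeff P j) i * x ^ i * y ^ j)"
  unfolding bipoly_def poly_altdef[of P] by (simp add: poly_sum poly_altdef[of "coeff P _" x] sum_distrib_right)

lemma bipoly_swap:
  obtains P' where "\<And>x y. bipoly P' x y = bipoly P y x"
proof
  show "bipoly (\<Sum>j\<le>degree P. \<Sum>i\<le>degree (coeff P j). monom (monom (coeff (coeff P j) i) j) i) x y = bipoly P y x" for x y
    by (simp add: bipoly_altdef[of P y x] poly_monom mult_ac)
qed

text \<open>\<open>G\<close> and \<open>H\<close> are substituted in the numerator and, through
  their Laurent inverses \<open>G'\<close> and \<open>H'\<close>, in the monomial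
  denominator.\<close>

lemma laurent_subst:
  assumes F: "laurent F" and "laurent G" "laurent G'" "laurent H" "laurent H'"
    and inv: "\<And>x y. x \<noteq> 0 \<Longrightarrow> y \<noteq> 0 \<Longrightarrow> G x y * G' x y = 1 \<and> H x y * H' x y = 1"
  shows "laurent (\<lambda>x y. F (G x y) (H x y))"
proof -
  obtain N P where P: "\<And>x y. x \<noteq> 0 \<Longrightarrow> y \<noteq> 0 \<Longrightarrow> F x y * (x * y) ^ N = bipoly P x y"
    using laurentE[OF F] by metis
  show ?thesis
  proof (rule laurent_cong)
    show "laurent (\<lambda>x y. (\<Sum>j\<le>degree P. \<Sum>i\<le>degree (coeff P j).
       coeff (coeff P j) i * G x y ^ i * H x y ^ j) * (G' x y * H' x y) ^ N)"
      by (intro laurent_mult laurent_sum laurent_power laurent_const assms)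
    fix x y :: complex assume "x \<noteq> 0" "y \<noteq> 0"
    note i = inv[OF this]
    then have "G x y \<noteq> 0" "H x y \<noteq> 0" by auto
    then have "F (G x y) (H x y) * (G x y * H x y) ^ N * (G' x y * H' x y) ^ N
        = bipoly P (G x y) (H x y) * (G' x y * H' x y) ^ N"
      by (simp add: P)
    moreover have "(G x y * H x y) ^ N * (G' x y * H' x y) ^ N = 1"
    proof -
      have "(G x y * H x y) * (G' x y * H' x y) = (G x y * G' x y) * (H x y * H' x y)" by simp
      then show ?thesis using i by (simp add: power_mult_distrib[symmetric])
    qed
    ultimately show "F (G x y) (H x y) = (\<Sum>j\<le>degree P. \<Sum>i\<le>degree (coeff P j).
       coeff (coeff P j) i * G x y ^ i * H x y ^ j) * (G' x y * H' x y) ^ N"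
      by (simp add: bipoly_altdef mult.assoc)
  qed
qed

lemma laurent_swap: "laurent F \<Longrightarrow> laurent (\<lambda>x y. F y x)"
  by (rule laurent_subst[where G = "\<lambda>x y. y" and G' = "\<lambda>x y. 1 / y" and H = "\<lambda>x y. x" and H' = "\<lambda>x y. 1 / x"])
     (simp_all add: laurent_x laurent_y laurent_inv_x laurent_inv_y)

section \<open>Cluster monomials\<close>

text \<open>The substitution \<open>b = x (1 + a)\<close> is the passage to an adjacent chart, where \<open>b = 0\<close> is
  reached along \<open>a = -1\<close>.\<close>

definition laurent_adjacent :: "(complex \<Rightarrow> complex \<Rightarrow> complex) \<Rightarrow> bool" where
  "laurent_adjacent F \<longleftrightarrow> (\<exists>H. laurent H \<and> (\<forall>a x. a \<noteq> 0 \<longrightarrow> a \<noteq> -1 \<longrightarrow> x \<noteq> 0 \<longrightarrow> F a (x * (1 + a)) = H a x))"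

lemma laurent_adjacentI:
  assumes "laurent H" "\<And>a x. a \<noteq> 0 \<Longrightarrow> 1 + a \<noteq> 0 \<Longrightarrow> x \<noteq> 0 \<Longrightarrow> F a (x * (1 + a)) = H a x"
  shows "laurent_adjacent F"
  using assms unfolding laurent_adjacent_def by (metis add.right_inverse add_left_cancel)

lemma laurent_adjacentE:
  assumes "laurent_adjacent F"
  obtains H where "laurent H" "\<And>a x. a \<noteq> 0 \<Longrightarrow> 1 + a \<noteq> 0 \<Longrightarrow> x \<noteq> 0 \<Longrightarrow> F a (x * (1 + a)) = H a x"
proof -
  obtain H where H: "laurent H" "\<forall>a x. a \<noteq> 0 \<longrightarrow> a \<noteq> -1 \<longrightarrow> x \<noteq> 0 \<longrightarrow> F a (x * (1 + a)) = H a x"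
    using assms unfolding laurent_adjacent_def by blast
  have "F a (x * (1 + a)) = H a x" if "a \<noteq> 0" "1 + a \<noteq> 0" "x \<noteq> 0" for a x
  proof -
    have "a \<noteq> -1" using that(2) by auto
    then show ?thesis using H(2) that by blast
  qed
  with H(1) show thesis by (rule that)
qed

lemma laurent_adjacent_mult:
  assumes "laurent_adjacent F" "laurent_adjacent G"
  shows "laurent_adjacent (\<lambda>a b. F a b * G a b)"
proof -
  obtain H where H: "laurent H" "\<And>a x. a \<noteq> 0 \<Longrightarrow> 1 + a \<noteq> 0 \<Longrightarrow> x \<noteq> 0 \<Longrightarrow> F a (x * (1 + a)) = H a x"
    using laurent_adjacentE[OF assms(1)] by metis
  obtain H' where H': "laurent H'" "\<And>a x. a \<noteq> 0 \<Longrightarrow> 1 + a \<noteq> 0 \<Longrightarrow> x \<noteq> 0 \<Longrightarrow> G a (x * (1 + a)) = H' a x"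
    using laurent_adjacentE[OF assms(2)] by metis
  show ?thesis by (rule laurent_adjacentI[OF laurent_mult[OF H(1) H'(1)]]) (simp add: H(2) H'(2))
qed

lemma laurent_adjacent_add:
  assumes "laurent_adjacent F" "laurent_adjacent G"
  shows "laurent_adjacent (\<lambda>a b. F a b + G a b)"
proof -
  obtain H where H: "laurent H" "\<And>a x. a \<noteq> 0 \<Longrightarrow> 1 + a \<noteq> 0 \<Longrightarrow> x \<noteq> 0 \<Longrightarrow> F a (x * (1 + a)) = H a x"
    using laurent_adjacentE[OF assms(1)] by metis
  obtain H' where H': "laurent H'" "\<And>a x. a \<noteq> 0 \<Longrightarrow> 1 + a \<noteq> 0 \<Longrightarrow> x \<noteq> 0 \<Longrightarrow> G a (x * (1 + a)) = H' a x"
    using laurent_adjacentE[OF assms(2)] by metis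
  show ?thesis by (rule laurent_adjacentI[OF laurent_add[OF H(1) H'(1)]]) (simp add: H(2) H'(2))
qed

lemma laurent_adjacent_const: "laurent_adjacent (\<lambda>a b. c)"
  by (rule laurent_adjacentI[OF laurent_const]) simp

lemma laurent_adjacent_power: "laurent_adjacent F \<Longrightarrow> laurent_adjacent (\<lambda>a b. F a b ^ n)"
  by (induction n) (simp_all add: laurent_adjacent_const laurent_adjacent_mult)

lemma laurent_adjacent_cong:
  assumes "laurent_adjacent F" "\<And>a b. a \<noteq> 0 \<Longrightarrow> b \<noteq> 0 \<Longrightarrow> G a b = F a b"
  shows "laurent_adjacent G"
proof -
  obtain H where H: "laurent H" "\<And>a x. a \<noteq> 0 \<Longrightarrow> 1 + a \<noteq> 0 \<Longrightarrow> x \<noteq> 0 \<Longrightarrow> F a (x * (1 + a)) = H a x"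
    using laurent_adjacentE[OF assms(1)] by metis
  show ?thesis by (rule laurent_adjacentI[OF H(1)]) (simp add: H(2)[symmetric] assms(2))
qed

text \<open>Here \<open>x\<close> is the inverse of \<open>(1 + a) / b\<close>. In the fourth
  function \<open>1 + a\<close> divides \<open>1 + a + x * (1 + a)\<close> and cancels the new
  denominator.\<close>

lemma laurent_adjacent_cluster:
  "laurent_adjacent (\<lambda>a b. a)" "laurent_adjacent (\<lambda>a b. b)" "laurent_adjacent (\<lambda>a b. (1 + b) / a)"
  "laurent_adjacent (\<lambda>a b. (1 + a + b) / (a * b))" "laurent_adjacent (\<lambda>a b. (1 + a) / b)"
proof -
  show "laurent_adjacent (\<lambda>a b. a)" by (rule laurent_adjacentI[OF laurent_x]) simp
  have "laurent (\<lambda>a x. x * (1 + a))"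
    by (intro laurent_mult laurent_add laurent_const laurent_x laurent_y)
  then show "laurent_adjacent (\<lambda>a b. b)" by (rule laurent_adjacentI) (rule refl)
  have "laurent (\<lambda>a x. (1 + x * (1 + a)) * (1 / a))"
    by (intro laurent_mult laurent_add laurent_const laurent_x laurent_y laurent_inv_x)
  then show "laurent_adjacent (\<lambda>a b. (1 + b) / a)" by (rule laurent_adjacentI) simp
  have "laurent (\<lambda>a x. (1 + x) * ((1 / a) * (1 / x)))"
    by (intro laurent_mult laurent_add laurent_const laurent_y laurent_inv_x laurent_inv_y)
  then show "laurent_adjacent (\<lambda>a b. (1 + a + b) / (a * b))"
  proof (rule laurent_adjacentI)
    fix a x :: complex assume *: "a \<noteq> 0" "1 + a \<noteq> 0" "x \<noteq> 0"
    have "(1 + a + x * (1 + a)) / (a * (x * (1 + a))) = ((1 + x) * (1 + a)) / ((a * x) * (1 + a))"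
      by (simp add: algebra_simps)
    also have "\<dots> = (1 + x) * ((1 / a) * (1 / x))" using *(2) by simp
    finally show "(1 + a + x * (1 + a)) / (a * (x * (1 + a))) = (1 + x) * ((1 / a) * (1 / x))" .
  qed
  show "laurent_adjacent (\<lambda>a b. (1 + a) / b)" by (rule laurent_adjacentI[OF laurent_inv_y]) simp
qed

text \<open>Together with \<open>nat i\<close> and \<open>nat j\<close>, the three exponents write
  \<open>(i, j)\<close> as a nonnegative combination of the rays (1, 0), (0, 1), (-1, 0), (-1, -1),
  (0, -1); all vanish except those of the rays bounding the cone that contains
  \<open>(i, j)\<close>.\<close>

definition cluster_num :: "int \<Rightarrow> int \<Rightarrow> complex poly poly" where
  "cluster_num i j = [:1, 1:] ^ nat (min j 0 - i) * [:[:1, 1:], 1:] ^ nat (min (- i) (- j)) * [:[:1, 1:]:] ^ nat (min i 0 - j)"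

text \<open>The cluster monomials, indexed by their lowest exponent as Laurent polynomials in one cluster.\<close>

definition cluster_mon :: "int \<Rightarrow> int \<Rightarrow> complex \<Rightarrow> complex \<Rightarrow> complex" where
  "cluster_mon i j a b = a powi i * b powi j * bipoly (cluster_num i j) a b"

lemma bipoly_cluster_num: "bipoly (cluster_num i j) a b =
  (1 + b) ^ nat (min j 0 - i) * (1 + a + b) ^ nat (min (- i) (- j)) * (1 + a) ^ nat (min i 0 - j)"
  by (simp add: cluster_num_def add.commute)

lemma cluster_mon_swap: "cluster_mon i j a b = cluster_mon j i b a"
  by (simp add: cluster_mon_def bipoly_cluster_num min.commute add_ac mult_ac)

lemma cluster_mon_cluster:
  assumes "a \<noteq> 0" "b \<noteq> 0"
  shows "cluster_mon i j a b = a ^ nat i * b ^ nat j * ((1 + b) / a) ^ nat (min j 0 - i) *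
    ((1 + a + b) / (a * b)) ^ nat (min (- i) (- j)) * ((1 + a) / b) ^ nat (min i 0 - j)"
proof -
  have "i = int (nat i) - int (nat (min j 0 - i)) - int (nat (min (- i) (- j)))" by auto
  then have "a powi i = a ^ nat i / a ^ nat (min j 0 - i) / a ^ nat (min (- i) (- j))"
    using assms by (metis power_int_diff power_int_of_nat)
  moreover have "j = int (nat j) - int (nat (min i 0 - j)) - int (nat (min (- i) (- j)))" by auto
  then have "b powi j = b ^ nat j / b ^ nat (min i 0 - j) / b ^ nat (min (- i) (- j))"
    using assms by (metis power_int_diff power_int_of_nat)
  ultimately show ?thesis
    by (simp add: cluster_mon_def bipoly_cluster_num power_divide power_mult_distrib mult_ac)
qed

lemma laurent_adjacent_cluster_mon: "laurent_adjacent (cluster_mon i j)"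
  by (rule laurent_adjacent_cong[OF _ cluster_mon_cluster]) (intro laurent_adjacent_mult laurent_adjacent_power laurent_adjacent_cluster)

text \<open>Indices may repeat in the list, so that the sum of two combinations is a
  concatenation.\<close>

definition cluster_comb :: "(complex \<Rightarrow> complex \<Rightarrow> complex) \<Rightarrow> bool" where
  "cluster_comb F \<longleftrightarrow> (\<exists>cs. F = (\<lambda>a b. \<Sum>(c, i, j)\<leftarrow>cs. c * cluster_mon i j a b))"

lemma cluster_comb_add:
  assumes "cluster_comb F" "cluster_comb G"
  shows "cluster_comb (\<lambda>a b. F a b + G a b)"
proof -
  obtain cs where "F = (\<lambda>a b. \<Sum>(c, i, j)\<leftarrow>cs. c * cluster_mon i j a b)" using assms(1) by (auto simp: cluster_comb_def)
  moreover obtain ds where "G = (\<lambda>a b. \<Sum>(c, i, j)\<leftarrow>ds. c * cluster_mon i j a b)"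
    using assms(2) by (auto simp: cluster_comb_def)
  ultimately have "(\<lambda>a b. F a b + G a b) = (\<lambda>a b. \<Sum>(c, i, j)\<leftarrow>cs @ ds. c * cluster_mon i j a b)" by simp
  then show ?thesis unfolding cluster_comb_def by blast
qed

lemma cluster_comb_0: "cluster_comb (\<lambda>a b. 0)"
  unfolding cluster_comb_def by (intro exI[of _ "[]"]) simp

lemma cluster_comb_M: "cluster_comb (\<lambda>a b. c * cluster_mon i j a b)"
  unfolding cluster_comb_def by (intro exI[of _ "[(c, i, j)]"]) simp

lemma cluster_comb_sum: "(\<And>k. k \<in> A \<Longrightarrow> cluster_comb (F k)) \<Longrightarrow> cluster_comb (\<lambda>a b. \<Sum>k\<in>A. F k a b)"
  by (induction A rule: infinite_finite_induct) (simp_all add: cluster_comb_0 cluster_comb_add)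

lemma cluster_comb_swap:
  assumes "cluster_comb F"
  shows "cluster_comb (\<lambda>a b. F b a)"
proof -
  obtain cs where cs: "F = (\<lambda>a b. \<Sum>(c, i, j)\<leftarrow>cs. c * cluster_mon i j a b)" using assms by (auto simp: cluster_comb_def)
  have "F b a = (\<Sum>(c, i, j)\<leftarrow>map (\<lambda>(c, i, j). (c, j, i)) cs. c * cluster_mon i j a b)" for a b
    unfolding cs by (induction cs) (auto simp: cluster_mon_swap[of _ _ b a])
  then have "(\<lambda>a b. F b a) = (\<lambda>a b. \<Sum>(c, i, j)\<leftarrow>map (\<lambda>(c, i, j). (c, j, i)) cs. c * cluster_mon i j a b)" by blast
  then show ?thesis unfolding cluster_comb_def by blast
qed

lemma laurent_adjacent_cluster_comb:
  assumes "cluster_comb F"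
  shows "laurent_adjacent F"
proof -
  obtain cs where cs: "F = (\<lambda>a b. \<Sum>(c, i, j)\<leftarrow>cs. c * cluster_mon i j a b)" using assms by (auto simp: cluster_comb_def)
  show ?thesis unfolding cs
  proof (induction cs)
    case (Cons z cs)
    obtain c i j where "z = (c, i, j)" by (cases z)
    then show ?case using laurent_adjacent_add[OF laurent_adjacent_mult[OF laurent_adjacent_const laurent_adjacent_cluster_mon, of c i j] Cons] by simp
  qed (simp add: laurent_adjacent_const)
qed

section \<open>Removal of polar parts\<close>

lemma laurent_adjacent_diff: "laurent_adjacent F \<Longrightarrow> laurent_adjacent G \<Longrightarrow> laurent_adjacent (\<lambda>a b. F a b - G a b)"
  using laurent_adjacent_add[of F "\<lambda>a b. (-1) * G a b"] laurent_adjacent_mult[OF laurent_adjacent_const, of G "-1"] by simp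

lemma poly_poly_const: "poly (poly P q) a = poly (poly P [:poly q a:]) a"
  by (induction P) simp_all

text \<open>In terms of \<open>a\<close> and \<open>x\<close>, \<open>P\<close> becomes
  \<open>H * a ^ K * x ^ N * (1 + a) ^ N\<close>. Its coefficient at \<open>x ^ 0\<close> is still
  \<open>coeff P 0\<close>, the denominators of \<open>H\<close> are monomials, and
  \<open>1 + a\<close> is coprime to \<open>a\<close>.\<close>

lemma laurent_adjacent_dvd:
  assumes "laurent_adjacent F" and P: "\<And>a b. a \<noteq> 0 \<Longrightarrow> b \<noteq> 0 \<Longrightarrow> F a b * a ^ K * b ^ N = bipoly P a b"
  shows "[:1, 1:] ^ N dvd coeff P 0"
proof -
  obtain H where H: "laurent H" "\<And>a x. a \<noteq> 0 \<Longrightarrow> 1 + a \<noteq> 0 \<Longrightarrow> x \<noteq> 0 \<Longrightarrow> F a (x * (1 + a)) = H a x"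
    using laurent_adjacentE[OF assms(1)] by metis
  obtain N0 where N0: "\<And>K N. N0 \<le> K \<Longrightarrow> N0 \<le> N \<Longrightarrow>
    \<exists>P. \<forall>x y. x \<noteq> 0 \<longrightarrow> y \<noteq> 0 \<longrightarrow> H x y * x ^ K * y ^ N = bipoly P x y"
    using laurent_exponents[OF H(1)] by metis
  \<comment> \<open>Clears the denominators of \<open>H\<close> and is at least \<open>N\<close>, so
    that \<open>x ^ N\<close> can be divided out of the coefficient at \<open>x ^ n\<close>.\<close>
  define n where "n = N0 + N"
  obtain Q where Q: "\<And>a x. a \<noteq> 0 \<Longrightarrow> x \<noteq> 0 \<Longrightarrow> H a x * a ^ n * x ^ n = bipoly Q a x"
    using N0[of n n] by (auto simp: n_def)
  define P' where "P' = pcompose P [:0, [:1, 1:]:]"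
  have P': "bipoly P' a x = bipoly P a (x * (1 + a))" for a x
  proof -
    have "bipoly P' a x = poly (poly P ([:x:] * [:1, 1:])) a"
      by (simp add: bipoly_def P'_def poly_pcompose)
    also have "\<dots> = poly (poly P [:poly ([:x:] * [:1, 1:]) a:]) a" by (rule poly_poly_const)
    also have "poly ([:x:] * [:1, 1:]) a = x * (1 + a)" by (simp add: algebra_simps)
    finally show ?thesis by (simp add: bipoly_def)
  qed
  have eq: "monom (monom 1 n) n * P' = monom (monom 1 K * [:1, 1:] ^ N) N * Q"
  proof (rule bipoly_eqI)
    show "[:[:1, 1:]:] \<noteq> (0 :: complex poly poly)" by simp
    fix a x :: complex assume a: "a \<noteq> 0" and x: "x \<noteq> 0" and "bipoly [:[:1, 1:]:] a x \<noteq> 0"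
    then have a': "1 + a \<noteq> 0" by simp
    have "bipoly P' a x = H a x * a ^ K * (x * (1 + a)) ^ N"
      unfolding P' using P[of a "x * (1 + a)"] H(2)[OF a a' x] a a' x by simp
    then show "bipoly (monom (monom 1 n) n * P') a x = bipoly (monom (monom 1 K * [:1, 1:] ^ N) N * Q) a x"
      using Q[OF a x] by (simp add: poly_monom power_mult_distrib mult_ac)
  qed
  have "coeff (monom (monom 1 n) n * P') n = monom 1 n * coeff P' 0"
    by (simp add: coeff_monom_mult)
  moreover have "coeff P' 0 = coeff P 0"
    by (simp add: poly_0_coeff_0[symmetric] P'_def poly_pcompose)
  moreover have "coeff (monom (monom 1 K * [:1, 1:] ^ N) N * Q) n = monom 1 K * [:1, 1:] ^ N * coeff Q (n - N)"
    by (simp add: coeff_monom_mult n_def)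
  ultimately have "monom 1 n * coeff P 0 = [:1, 1:] ^ N * (monom 1 K * coeff Q (n - N))"
    using eq by (metis mult.assoc mult.commute)
  then have "[:1, 1:] ^ N dvd monom 1 n * coeff P 0"
    by (rule dvdI)
  moreover have "coprime [:1, 1 :: complex:] [:0, 1:]"
  proof (rule coprimeI)
    fix d :: "complex poly" assume "d dvd [:1, 1:]" "d dvd [:0, 1:]"
    then have "d dvd [:1, 1:] - [:0, 1:]" by (rule dvd_diff)
    then show "is_unit d" by (simp add: one_pCons)
  qed
  then have "coprime ([:1, 1 :: complex:] ^ N) (monom 1 n)"
    by (simp add: monom_altdef)
  ultimately show ?thesis by (simp add: coprime_dvd_mult_right_iff)
qed

lemma cluster_mon_lowest:
  assumes "a \<noteq> 0" "b \<noteq> 0" "0 \<le> i + int K" "0 \<le> j + int N"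
  shows "cluster_mon i j a b * a ^ K * b ^ N = bipoly (monom (monom 1 (nat (i + int K))) (nat (j + int N)) * cluster_num i j) a b"
proof -
  have pow: "x powi l * x ^ L = x ^ nat (l + int L)" if "x \<noteq> 0" "0 \<le> l + int L" for x :: complex and l L
  proof -
    have "x powi l * x ^ L = x powi l * x powi int L" by (simp only: power_int_of_nat)
    also have "\<dots> = x powi (l + int L)" using that(1) by (intro power_int_add[symmetric] disjI1)
    also have "l + int L = int (nat (l + int L))" using that(2) by simp
    finally show ?thesis by (simp only: power_int_of_nat)
  qed
  have "cluster_mon i j a b * a ^ K * b ^ N = (a powi i * a ^ K) * (b powi j * b ^ N) * bipoly (cluster_num i j) a b"
    by (simp only: cluster_mon_def mult_ac)
  also have "\<dots> = a ^ nat (i + int K) * b ^ nat (j + int N) * bipoly (cluster_num i j) a b"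
    unfolding pow[OF assms(1,3)] pow[OF assms(2,4)] ..
  finally have "cluster_mon i j a b * a ^ K * b ^ N = a ^ nat (i + int K) * b ^ nat (j + int N) * bipoly (cluster_num i j) a b" .
  then show ?thesis by (simp add: poly_monom)
qed

text \<open>At \<open>b = 0\<close> both \<open>1 + a + b\<close> and \<open>1 + a\<close> become
  \<open>1 + a\<close>. For \<open>j < 0\<close> the total exponent is \<open>- j\<close> whatever
  \<open>i\<close> is, exactly the power that regularity on the adjacent chart forces.\<close>

lemma coeff_cluster_num_0: "coeff (cluster_num i j) 0 = [:1, 1:] ^ (nat (min (- i) (- j)) + nat (min i 0 - j))"
  by (simp add: poly_0_coeff_0[symmetric] cluster_num_def power_add)

text \<open>The coefficient at the lowest power of \<open>b\<close> is, up to a power of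
  \<open>a\<close>, \<open>(1 + a) ^ Suc N * h\<close>. The cluster monomials with this lowest power
  have the coefficients \<open>(1 + a) ^ Suc N\<close> times any power of \<open>a\<close>, so
  \<open>h\<close> tells which of them to subtract.\<close>

lemma laurent_adjacent_step:
  assumes "laurent_adjacent F" and P: "\<And>a b. a \<noteq> 0 \<Longrightarrow> b \<noteq> 0 \<Longrightarrow> F a b * a ^ K * b ^ Suc N = bipoly P a b"
  obtains G P' where "cluster_comb G" "\<And>a b. a \<noteq> 0 \<Longrightarrow> b \<noteq> 0 \<Longrightarrow> (F a b - G a b) * a ^ K * b ^ N = bipoly P' a b"
proof -
  obtain h where h: "coeff P 0 = [:1, 1:] ^ Suc N * h"
    using laurent_adjacent_dvd[OF assms] by (auto elim: dvdE)
  \<comment> \<open>The exponents start at \<open>- K\<close>, so the subtraction does not increase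
    the pole along \<open>a = 0\<close>.\<close>
  define i where "i m = int m - int K" for m
  define j where "j = - int (Suc N)"
  define G where "G a b = (\<Sum>m\<le>degree h. coeff h m * cluster_mon (i m) j a b)" for a b
  have "cluster_comb (\<lambda>a b. G a b)" unfolding G_def by (intro cluster_comb_sum cluster_comb_M)
  then have G: "cluster_comb G" .
  define D where "D = P - (\<Sum>m\<le>degree h. [:[:coeff h m:]:] * (monom (monom 1 m) 0 * cluster_num (i m) j))"
  have D: "(F a b - G a b) * a ^ K * b ^ Suc N = bipoly D a b" if ab: "a \<noteq> 0" "b \<noteq> 0" for a b
  proof -
    have "cluster_mon (i m) j a b * a ^ K * b ^ Suc N = bipoly (monom (monom 1 m) 0 * cluster_num (i m) j) a b" for m
      using cluster_mon_lowest[OF ab, of "i m" K j "Suc N"] by (simp add: i_def j_def)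
    then have "G a b * a ^ K * b ^ Suc N =
       (\<Sum>m\<le>degree h. coeff h m * bipoly (monom (monom 1 m) 0 * cluster_num (i m) j) a b)"
      unfolding G_def by (simp only: sum_distrib_right mult.assoc)
    then show ?thesis
      using P[OF ab] by (simp add: D_def left_diff_distrib)
  qed
  have "coeff D 0 = coeff P 0 - (\<Sum>m\<le>degree h. [:coeff h m:] * (monom 1 m * coeff (cluster_num (i m) j) 0))"
    by (simp add: poly_0_coeff_0[symmetric] D_def poly_sum poly_monom)
  also have "coeff (cluster_num (i m) j) 0 = [:1, 1:] ^ Suc N" for m
  proof -
    have "nat (min (- i m) (- j)) + nat (min (i m) 0 - j) = Suc N" by (auto simp: j_def)
    then show ?thesis by (simp only: coeff_cluster_num_0)
  qed
  then have "(\<Sum>m\<le>degree h. [:coeff h m:] * (monom 1 m * coeff (cluster_num (i m) j) 0))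
      = (\<Sum>m\<le>degree h. monom (coeff h m) m) * [:1, 1:] ^ Suc N"
    by (simp add: sum_distrib_right smult_monom mult.assoc[symmetric])
  also have "(\<Sum>m\<le>degree h. monom (coeff h m) m) = h" by (rule poly_as_sum_of_monoms)
  finally have "coeff D 0 = 0" unfolding h by (simp add: mult.commute)
  then obtain P' where P': "D = pCons 0 P'" by (metis coeff_pCons_0 pCons_cases)
  have "(F a b - G a b) * a ^ K * b ^ N = bipoly P' a b" if "a \<noteq> 0" "b \<noteq> 0" for a b
    using D[OF that] that unfolding P' by (simp add: mult.assoc)
  then show thesis using that[OF G] by blast
qed

lemma laurent_adjacent_strip:
  assumes "laurent_adjacent F" and "\<And>a b. a \<noteq> 0 \<Longrightarrow> b \<noteq> 0 \<Longrightarrow> F a b * a ^ K * b ^ N = bipoly P a b"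
  obtains G P' where "cluster_comb G" "\<And>a b. a \<noteq> 0 \<Longrightarrow> b \<noteq> 0 \<Longrightarrow> (F a b - G a b) * a ^ K = bipoly P' a b"
proof -
  have "\<exists>G P'. cluster_comb G \<and> (\<forall>a b. a \<noteq> 0 \<longrightarrow> b \<noteq> 0 \<longrightarrow> (F a b - G a b) * a ^ K = bipoly P' a b)"
    using assms
  proof (induction N arbitrary: F P)
    case 0
    then show ?case using cluster_comb_0 by (intro exI[of _ "\<lambda>a b. 0"] exI[of _ P]) auto
  next
    case (Suc N)
    obtain G P' where G: "cluster_comb G"
      "\<And>a b. a \<noteq> 0 \<Longrightarrow> b \<noteq> 0 \<Longrightarrow> (F a b - G a b) * a ^ K * b ^ N = bipoly P' a b"
      using laurent_adjacent_step[OF Suc.prems] by metis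
    obtain G' P'' where G': "cluster_comb G'"
      "\<And>a b. a \<noteq> 0 \<Longrightarrow> b \<noteq> 0 \<Longrightarrow> (F a b - G a b - G' a b) * a ^ K = bipoly P'' a b"
      using Suc.IH[OF laurent_adjacent_diff[OF Suc.prems(1) laurent_adjacent_cluster_comb[OF G(1)]] G(2)] by metis
    show ?case
      using G'(2) by (intro exI[of _ "\<lambda>a b. G a b + G' a b"] exI[of _ P''] conjI cluster_comb_add G(1) G'(1))
        (simp add: diff_diff_eq)
  qed
  then show thesis using that by blast
qed

text \<open>The second removal runs with the variables exchanged and with exponent 0 for
  \<open>b\<close>, so it does not bring back the pole along \<open>b = 0\<close>. What remains is a
  polynomial, and its monomials are the cluster monomials with nonnegative indices.\<close>

lemma laurent_cluster_comb:
  assumes "laurent F" "laurent_adjacent F" "laurent_adjacent (\<lambda>a b. F b a)"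
  obtains G where "cluster_comb G" "\<And>a b. a \<noteq> 0 \<Longrightarrow> b \<noteq> 0 \<Longrightarrow> F a b = G a b"
proof -
  obtain N P where P: "\<And>a b. a \<noteq> 0 \<Longrightarrow> b \<noteq> 0 \<Longrightarrow> F a b * (a * b) ^ N = bipoly P a b"
    using laurentE[OF assms(1)] by metis
  then have "\<And>a b. a \<noteq> 0 \<Longrightarrow> b \<noteq> 0 \<Longrightarrow> F a b * a ^ N * b ^ N = bipoly P a b"
    by (simp add: power_mult_distrib mult.assoc)
  then obtain G P1 where G: "cluster_comb G" "\<And>a b. a \<noteq> 0 \<Longrightarrow> b \<noteq> 0 \<Longrightarrow> (F a b - G a b) * a ^ N = bipoly P1 a b"
    using laurent_adjacent_strip[OF assms(2)] by metis
  obtain P2 where P2: "\<And>a b. bipoly P2 b a = bipoly P1 a b" using bipoly_swap[of P1] by metis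
  define D where "D = (\<lambda>b a. F a b - G a b)"
  have D: "laurent_adjacent D"
    unfolding D_def by (intro laurent_adjacent_diff assms(3) laurent_adjacent_cluster_comb cluster_comb_swap[OF G(1)])
  have D': "D b a * b ^ 0 * a ^ N = bipoly P2 b a" if "b \<noteq> 0" "a \<noteq> 0" for a b
    using G(2)[OF that(2,1)] P2[of b a] by (simp add: D_def)
  obtain G' P3 where G': "cluster_comb G'"
    "\<And>b a. b \<noteq> 0 \<Longrightarrow> a \<noteq> 0 \<Longrightarrow> (D b a - G' b a) * b ^ 0 = bipoly P3 b a"
    using laurent_adjacent_strip[OF D D'] by metis
  obtain P4 where P4: "\<And>a b. bipoly P4 a b = bipoly P3 b a" using bipoly_swap[of P3] by metis
  have mon: "cluster_mon (int i) (int j) a b = a ^ i * b ^ j" for i j a b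
    by (simp add: cluster_mon_def bipoly_cluster_num)
  define G'' where "G'' a b = (\<Sum>j\<le>degree P4. \<Sum>i\<le>degree (coeff P4 j).
      coeff (coeff P4 j) i * cluster_mon (int i) (int j) a b)" for a b
  have "cluster_comb (\<lambda>a b. G'' a b)" unfolding G''_def by (intro cluster_comb_sum cluster_comb_M)
  then have "cluster_comb (\<lambda>a b. G a b + G' b a + G'' a b)"
    by (rule cluster_comb_add[OF cluster_comb_add[OF G(1) cluster_comb_swap[OF G'(1)]]])
  moreover have "F a b = G a b + G' b a + G'' a b" if "a \<noteq> 0" "b \<noteq> 0" for a b
  proof -
    have "G'' a b = bipoly P4 a b" by (simp add: G''_def mon bipoly_altdef mult.assoc)
    then show ?thesis using G'(2)[OF that(2,1)] P4[of a b] by (simp add: D_def algebra_simps)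
  qed
  ultimately show thesis by (rule that)
qed

text \<open>Exponents are compared lexicographically with \<open>b\<close> before \<open>a\<close>.
  At the least exponent that occurs, its own cluster monomial has coefficient 1 and all others have
  0.\<close>

lemma cluster_mon_independent:
  assumes "finite T" and sum: "\<And>a b. a \<noteq> 0 \<Longrightarrow> b \<noteq> 0 \<Longrightarrow> (\<Sum>(i, j)\<in>T. c (i, j) * cluster_mon i j a b) = 0"
    and "z \<in> T"
  shows "c z = 0"
proof (rule ccontr)
  assume "c z \<noteq> 0"
  define T' where "T' = {z \<in> T. c z \<noteq> 0}"
  have T': "finite T'" "T' \<noteq> {}" using assms(1,3) \<open>c z \<noteq> 0\<close> unfolding T'_def by (simp, blast)
  define j0 where "j0 = Min (snd ` T')"
  define S where "S = {z \<in> T'. snd z = j0}"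
  have "j0 \<in> snd ` T'" unfolding j0_def using T' by (intro Min_in) auto
  then have S: "finite S" "S \<noteq> {}" using T' by (auto simp: S_def)
  define i0 where "i0 = Min (fst ` S)"
  have "i0 \<in> fst ` S" unfolding i0_def using S by (intro Min_in) auto
  then have z0: "(i0, j0) \<in> T'" by (auto simp: S_def)
  have j0: "j0 \<le> snd z" if "z \<in> T'" for z unfolding j0_def using T' that by (intro Min_le) auto
  have i0: "i0 \<le> fst z" if "z \<in> S" for z unfolding i0_def using S that by (intro Min_le) auto
  \<comment> \<open>This minimum is over all exponents and serves to clear denominators; it may be
    smaller than \<open>i0\<close>.\<close>
  define i1 where "i1 = Min (fst ` T')"
  have i1: "i1 \<le> fst z" if "z \<in> T'" for z unfolding i1_def using T' that by (intro Min_le) auto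
  define K where "K = nat (- i1)"
  define N where "N = nat (- j0)"
  have nonneg: "0 \<le> fst z + int K \<and> 0 \<le> snd z + int N" if "z \<in> T'" for z
    using j0[OF that] i1[OF that] by (auto simp: K_def N_def)
  define E where "E z = [:[:c z:]:] * (monom (monom 1 (nat (fst z + int K))) (nat (snd z + int N)) * cluster_num (fst z) (snd z))" for z
  have "sum E T' = 0"
  proof (rule bipoly_eq_0I)
    fix a b :: complex assume ab: "a \<noteq> 0" "b \<noteq> 0"
    have "bipoly (E z) a b = c z * cluster_mon (fst z) (snd z) a b * a ^ K * b ^ N" if "z \<in> T'" for z
      using cluster_mon_lowest[OF ab, of "fst z" K "snd z" N] nonneg[OF that] by (simp add: E_def mult.assoc)
    then have "bipoly (sum E T') a b = (\<Sum>z\<in>T'. c z * cluster_mon (fst z) (snd z) a b) * a ^ K * b ^ N"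
      by (simp add: sum_distrib_right)
    also have "(\<Sum>z\<in>T'. c z * cluster_mon (fst z) (snd z) a b) = (\<Sum>z\<in>T. c z * cluster_mon (fst z) (snd z) a b)"
      unfolding T'_def using \<open>finite T\<close> by (intro sum.mono_neutral_left) auto
    also have "\<dots> = 0" using sum[OF ab] by (simp add: case_prod_unfold)
    finally show "bipoly (sum E T') a b = 0" by simp
  qed
  define k where "k = nat (i0 + int K)"
  define l where "l = nat (j0 + int N)"
  have "coeff (coeff (E z) l) k = (if z = (i0, j0) then c z else 0)" if z: "z \<in> T'" for z
  proof (cases "snd z = j0")
    case True
    then have "z \<in> S" using z by (simp add: S_def)
    have "coeff (E z) l = [:c z:] * (monom 1 (nat (fst z + int K)) * coeff (cluster_num (fst z) (snd z)) 0)"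
      using True by (simp add: E_def coeff_monom_mult l_def)
    moreover have "coeff (coeff (cluster_num (fst z) (snd z)) 0) 0 = 1"
      unfolding coeff_cluster_num_0 by (simp add: poly_0_coeff_0[symmetric])
    moreover have "\<not> nat (fst z + int K) \<le> k" if "z \<noteq> (i0, j0)"
      using i0[OF \<open>z \<in> S\<close>] True that nonneg[OF z] nonneg[OF z0]
      by (cases z) (auto simp: k_def nat_le_eq_zle)
    moreover have "nat (fst z + int K) = k" if "z = (i0, j0)" using that by (simp add: k_def)
    ultimately show ?thesis
      by (cases "z = (i0, j0)") (simp_all add: coeff_monom_mult del: nat_le_iff)
  next
    case False
    then have "\<not> nat (snd z + int N) \<le> l"
      using j0[OF z] nonneg[OF z] nonneg[OF z0] by (auto simp: l_def nat_le_eq_zle)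
    then show ?thesis using False by (auto simp: E_def coeff_monom_mult)
  qed
  then have "coeff (coeff (sum E T') l) k = (\<Sum>z\<in>T'. if z = (i0, j0) then c z else 0)"
    by (simp add: coeff_sum)
  also have "\<dots> = c (i0, j0)" using T'(1) z0 by (simp add: sum.delta)
  finally show False using \<open>sum E T' = 0\<close> z0 by (simp add: T'_def)
qed

section \<open>The charts\<close>

lemma no_tripleD:
  assumes "no_triple x" "i \<noteq> j" "i \<noteq> k" "j \<noteq> k"
  shows "\<not> (x i = x j \<and> x i = x k)"
  using assms unfolding no_triple_def by blast

text \<open>The pairs that may still coincide are 1, 3 and 1, 4 and 2, 4. They form a path, which
  contains no triangle.\<close>

lemma no_tripleI:
  assumes "x 0 \<noteq> x 1" "x 0 \<noteq> x 2" "x 0 \<noteq> x 3" "x 0 \<noteq> x 4" "x 1 \<noteq> x 2" "x 2 \<noteq> x 3" "x 3 \<noteq> x 4"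
  shows "no_triple x"
proof -
  define P where "P i j \<longleftrightarrow> i = j \<or> i = 1 \<and> j = 3 \<or> i = 3 \<and> j = 1 \<or> i = 1 \<and> j = 4 \<or> i = 4 \<and> j = 1 \<or>
    i = 2 \<and> j = 4 \<or> i = 4 \<and> j = 2" for i j :: 5
  have P: "P i j" if "x i = x j" for i j
    using five_cases[of i] five_cases[of j] that assms assms[symmetric]
    unfolding P_def by (elim disjE) simp_all
  show ?thesis
    unfolding no_triple_def
  proof (intro allI impI notI)
    fix i j k :: 5 assume ijk: "i \<noteq> j" "i \<noteq> k" "j \<noteq> k" "x i = x j \<and> x i = x k"
    then have "P i j" "P i k" "P j k" using P[of i j] P[of i k] P[of j k] ijk(4) by metis+
    then show False using ijk(1-3) unfolding P_def by (elim disjE conjE) simp_all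
  qed
qed

lemma no_triple_base_config:
  assumes "X \<noteq> 0" "Y \<noteq> 0"
  shows "no_triple (\<lambda>i. base_config X Y (i - c))"
proof -
  have "no_triple (base_config X Y)"
    by (rule no_tripleI) (use assms in \<open>simp_all add: base_config_def\<close>)
  then have "\<not> (base_config X Y (i - c) = base_config X Y (j - c) \<and>
      base_config X Y (i - c) = base_config X Y (k - c))" if "i \<noteq> j" "i \<noteq> k" "j \<noteq> k" for i j k
  proof -
    have "i - c \<noteq> j - c" "i - c \<noteq> k - c" "j - c \<noteq> k - c" using that by simp_all
    then show ?thesis using \<open>no_triple (base_config X Y)\<close> unfolding no_triple_def by blast
  qed
  then show ?thesis unfolding no_triple_def by blast
qed

lemma represents_psi:
  assumes "X \<noteq> 0" "Y \<noteq> 0"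
  shows "represents (\<lambda>i. base_config X Y (i - c)) (psi c (X, Y))"
proof -
  obtain p where "represents (\<lambda>i. base_config X Y (i - c)) p"
    using config_represents[OF no_triple_base_config[OF assms, of c]] .
  then show ?thesis using config_point_eqI by (simp add: psi_def)
qed

lemma psi_eqI: "represents (\<lambda>i. base_config X Y (i - c)) p \<Longrightarrow> psi c (X, Y) = p"
  by (simp add: psi_def config_point_eqI)

lemma mcoord_represents:
  "represents x p \<Longrightarrow> mcoord p i = cross_ratio (x (i + 1)) (x (i + 2)) (x (i + 3)) (x (i + 4))"
  unfolding mcoord_def by (rule mcross_represents) simp_all

text \<open>On the chart \<open>psi c\<close> these two coordinates will be \<open>X\<close> and the
  inverse of \<open>Y\<close>.\<close>

lemma mcoord_chart:
  assumes "represents x p"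
  shows "mcoord p (c + 4) = cross_ratio (x c) (x (c + 1)) (x (c + 2)) (x (c + 3))"
    and "mcoord p (c + 1) = cross_ratio (x (c + 2)) (x (c + 3)) (x (c + 4)) (x c)"
proof -
  have "c + 4 + 1 = c" "c + 4 + 2 = c + 1" "c + 4 + 3 = c + 2" "c + 4 + 4 = c + 3"
    "c + 1 + 1 = c + 2" "c + 1 + 2 = c + 3" "c + 1 + 3 = c + 4" "c + 1 + 4 = c"
    by simp_all
  then show "mcoord p (c + 4) = cross_ratio (x c) (x (c + 1)) (x (c + 2)) (x (c + 3))"
    "mcoord p (c + 1) = cross_ratio (x (c + 2)) (x (c + 3)) (x (c + 4)) (x c)"
    by (simp_all only: mcoord_represents[OF assms])
qed

lemma mcoord_psi:
  assumes "X \<noteq> 0" "Y \<noteq> 0"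
  shows "mcoord (psi c (X, Y)) (c + 4) = Fin X"
    and "mcoord (psi c (X, Y)) c = of_hom Y (1 + X + X * Y)"
    and "mcoord (psi c (X, Y)) (c + 1) = of_hom 1 Y"
    and "mcoord (psi c (X, Y)) (c + 2) = of_hom (X * Y) (1 + X)"
    and "mcoord (psi c (X, Y)) (c + 3) = of_hom 1 (X * (1 + Y))"
proof -
  note m = mcoord_represents[OF represents_psi[OF assms, of c]]
  show "mcoord (psi c (X, Y)) (c + 4) = Fin X"
    using assms by (simp add: m cross_ratio_def base_config_def pdiff_def of_hom_def)
  have "mcoord (psi c (X, Y)) c = of_hom (X * Y) (X * (1 + X + X * Y))"
    by (simp add: m cross_ratio_def base_config_def pdiff_def algebra_simps)
  then show "mcoord (psi c (X, Y)) c = of_hom Y (1 + X + X * Y)"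
    using assms by (simp add: of_hom_scale)
  have "mcoord (psi c (X, Y)) (c + 1) = of_hom (X * 1) (X * Y)"
    by (simp add: m cross_ratio_def base_config_def pdiff_def algebra_simps)
  then show "mcoord (psi c (X, Y)) (c + 1) = of_hom 1 Y"
    using assms of_hom_scale[of X 1 Y] by simp
  have "mcoord (psi c (X, Y)) (c + 2) = of_hom ((-1) * (X * Y)) ((-1) * (1 + X))"
    by (simp add: m cross_ratio_def base_config_def pdiff_def algebra_simps)
  then show "mcoord (psi c (X, Y)) (c + 2) = of_hom (X * Y) (1 + X)"
    using of_hom_scale[of "-1" "X * Y" "1 + X"] by simp
  show "mcoord (psi c (X, Y)) (c + 3) = of_hom 1 (X * (1 + Y))"
    by (simp add: m cross_ratio_def base_config_def pdiff_def algebra_simps)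
qed

lemma psi_M05bar: "X \<noteq> 0 \<Longrightarrow> Y \<noteq> 0 \<Longrightarrow> psi c (X, Y) \<in> M05bar"
  using represents_psi[of X Y c] by (simp add: represents_def)

lemma of_hom_cases: "of_hom u v = Infty \<longleftrightarrow> v = 0" "of_hom u v = Fin 0 \<longleftrightarrow> v \<noteq> 0 \<and> u = 0"
  by (auto simp: of_hom_def)

text \<open>The two cross-ratios are 0 or infinity exactly at collisions of adjacent points or of
  \<open>x c\<close> with another point. Otherwise \<open>x c\<close>, \<open>x (c + 1)\<close>,
  \<open>x (c + 2)\<close> can be moved to infinity, -1, 0, and the other two points yield
  \<open>X\<close> and \<open>Y\<close>.\<close>

lemma chart_iff:
  assumes p: "p \<in> M05bar"
  shows "p \<in> psi c ` torus \<longleftrightarrow> mcoord p (c + 4) \<notin> {Fin 0, Infty} \<and> mcoord p (c + 1) \<notin> {Fin 0, Infty}"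
proof
  assume "p \<in> psi c ` torus"
  then obtain X Y where "X \<noteq> 0" "Y \<noteq> 0" "p = psi c (X, Y)" by (auto simp: torus_def)
  then show "mcoord p (c + 4) \<notin> {Fin 0, Infty} \<and> mcoord p (c + 1) \<notin> {Fin 0, Infty}"
    using mcoord_psi(1,3)[of X Y c] by (simp add: of_hom_def)
next
  assume r: "mcoord p (c + 4) \<notin> {Fin 0, Infty} \<and> mcoord p (c + 1) \<notin> {Fin 0, Infty}"
  obtain x where x: "represents x p" using represents_exists[OF p] .
  have ne: "x c \<noteq> x (c + 1)" "x (c + 2) \<noteq> x (c + 3)" "x c \<noteq> x (c + 3)" "x (c + 1) \<noteq> x (c + 2)"
    "x (c + 4) \<noteq> x c" "x (c + 2) \<noteq> x c" "x (c + 3) \<noteq> x (c + 4)"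
    using r by (auto simp: mcoord_chart[OF x] cross_ratio_def of_hom_cases)
  obtain m where m: "moebius m" "m (x c) = Infty" "m (x (c + 1)) = Fin (-1)" "m (x (c + 2)) = Fin 0"
    using moebius_three_points[of "x c" "x (c + 1)" "x (c + 2)" Infty "Fin (-1)" "Fin 0"] ne by auto
  have "m (x (c + 3)) \<noteq> Infty" "m (x (c + 3)) \<noteq> Fin 0" "m (x (c + 4)) \<noteq> Infty"
    unfolding m(2,4)[symmetric] moebius_inj[OF m(1)] using ne by auto
  then obtain X Z where XZ: "m (x (c + 3)) = Fin X" "X \<noteq> 0" "m (x (c + 4)) = Fin Z"
    by (metis cp1.exhaust)
  have "X \<noteq> Z" using XZ moebius_inj[OF m(1)] ne(7) by metis
  define Y where "Y = (Z - X) / X"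
  have Y: "Y \<noteq> 0" "X * (1 + Y) = Z" using \<open>X \<noteq> Z\<close> XZ(2) by (simp_all add: Y_def field_simps)
  have "m (x i) = base_config X Y (i - c)" for i
  proof -
    have "i - c = 0 \<Longrightarrow> i = c" "i - c = k \<Longrightarrow> i = c + k" for k by auto
    then show ?thesis
      using five_cases[of "i - c"] m XZ Y(2) by (elim disjE) (auto simp: base_config_def)
  qed
  then have "represents (\<lambda>i. base_config X Y (i - c)) p"
    using represents_moebius[OF x m(1)] by simp
  then have "psi c (X, Y) = p" by (rule psi_eqI)
  then show "p \<in> psi c ` torus" using XZ(2) Y(1) by (auto simp: torus_def)
qed

lemma psi_coords:
  assumes "p \<in> psi c ` torus"
  obtains X Y where "X \<noteq> 0" "Y \<noteq> 0" "p = psi c (X, Y)"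
  using assms by (auto simp: torus_def)

lemma psi_inj: "inj_on (psi c) torus"
proof (rule inj_onI)
  fix z z' assume z: "z \<in> torus" "z' \<in> torus" "psi c z = psi c z'"
  obtain X Y X' Y' where [simp]: "z = (X, Y)" "z' = (X', Y')" by (metis prod.exhaust)
  have nz: "X \<noteq> 0" "Y \<noteq> 0" "X' \<noteq> 0" "Y' \<noteq> 0" using z by (auto simp: torus_def)
  have "Fin X = Fin X'" "of_hom 1 Y = of_hom 1 Y'"
    using mcoord_psi(1,3)[of X Y c] mcoord_psi(1,3)[of X' Y' c] nz z(3) by simp_all
  then show "z = z'" using nz by (simp add: of_hom_def)
qed

text \<open>The two charts share \<open>mcoord p (c + 1)\<close>, the inverse of \<open>Y\<close> in
  one and the first coordinate in the other. Their remaining coordinates are related by the exchange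
  relation.\<close>

lemma psi_transition:
  assumes "X \<noteq> 0" "Y \<noteq> 0" "1 + Y \<noteq> 0"
  shows "psi c (X, Y) = psi (c + 2) (1 / Y, X * (1 + Y))"
proof -
  let ?p = "psi c (X, Y)"
  note m = mcoord_psi[OF assms(1,2), of c]
  have idx: "c + 2 + 4 = c + 1" "c + 2 + 1 = c + 3" by simp_all
  have "?p \<in> psi (c + 2) ` torus"
    unfolding chart_iff[OF psi_M05bar[OF assms(1,2)]] idx
    using m(3,5) assms by (simp add: of_hom_def)
  then obtain X' Y' where p: "X' \<noteq> 0" "Y' \<noteq> 0" "?p = psi (c + 2) (X', Y')" by (rule psi_coords)
  have "Fin X' = of_hom 1 Y" "of_hom 1 Y' = of_hom 1 (X * (1 + Y))"
    using mcoord_psi(1,3)[OF p(1,2), of "c + 2", unfolded idx] m(3,5) p(3) by simp_all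
  then have "X' = 1 / Y" "Y' = X * (1 + Y)" using assms p(2) by (simp_all add: of_hom_def)
  then show ?thesis using p(3) by simp
qed

lemma morphism_formsI:
  fixes \<kappa> :: "'a \<Rightarrow> 'i::finite \<Rightarrow> cp1" and \<kappa>' :: "'b \<Rightarrow> 'j::finite \<Rightarrow> cp1"
  assumes "\<And>j. \<exists>d A B. is_form d A \<and> is_form d B \<and>
      (\<forall>p\<in>S. (A (\<kappa> p) \<noteq> 0 \<or> B (\<kappa> p) \<noteq> 0) \<and> \<kappa>' (f p) j = of_hom (A (\<kappa> p)) (B (\<kappa> p)))"
    and "f ` S \<subseteq> T"
  shows "morphism \<kappa> S \<kappa>' T f"
proof -
  have "\<forall>j. \<exists>dAB. is_form (fst dAB) (fst (snd dAB)) \<and> is_form (fst dAB) (snd (snd dAB)) \<and>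
      (\<forall>p\<in>S. (fst (snd dAB) (\<kappa> p) \<noteq> 0 \<or> snd (snd dAB) (\<kappa> p) \<noteq> 0) \<and>
         \<kappa>' (f p) j = of_hom (fst (snd dAB) (\<kappa> p)) (snd (snd dAB) (\<kappa> p)))"
  proof
    fix j
    obtain d A B where "is_form d A \<and> is_form d B \<and>
      (\<forall>p\<in>S. (A (\<kappa> p) \<noteq> 0 \<or> B (\<kappa> p) \<noteq> 0) \<and> \<kappa>' (f p) j = of_hom (A (\<kappa> p)) (B (\<kappa> p)))"
      using assms(1)[of j] by blast
    then show "\<exists>dAB. is_form (fst dAB) (fst (snd dAB)) \<and> is_form (fst dAB) (snd (snd dAB)) \<and>
      (\<forall>p\<in>S. (fst (snd dAB) (\<kappa> p) \<noteq> 0 \<or> snd (snd dAB) (\<kappa> p) \<noteq> 0) \<and>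
         \<kappa>' (f p) j = of_hom (fst (snd dAB) (\<kappa> p)) (snd (snd dAB) (\<kappa> p)))"
      by (intro exI[of _ "(d, A, B)"]) simp
  qed
  note ex = this
  obtain dAB where *: "\<forall>j. is_form (fst (dAB j)) (fst (snd (dAB j))) \<and> is_form (fst (dAB j)) (snd (snd (dAB j))) \<and>
      (\<forall>p\<in>S. (fst (snd (dAB j)) (\<kappa> p) \<noteq> 0 \<or> snd (snd (dAB j)) (\<kappa> p) \<noteq> 0) \<and>
         \<kappa>' (f p) j = of_hom (fst (snd (dAB j)) (\<kappa> p)) (snd (snd (dAB j)) (\<kappa> p)))"
    using choice[OF ex] by blast
  show ?thesis
    by (rule morphism_forms[of "\<lambda>j. fst (dAB j)" "\<lambda>j. fst (snd (dAB j))" "\<lambda>j. snd (snd (dAB j))"])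
      (use * assms(2) in auto)
qed

text \<open>The five coordinates of \<open>psi c\<close> are quotients of polynomials of degree at
  most one in \<open>X\<close> and in \<open>Y\<close>, so forms of bidegree (1, 1) suffice.\<close>

lemma is_form_bilinear:
  "is_form (\<lambda>i. 1) (\<lambda>x :: bool \<Rightarrow> cp1. a * (hx (x True) * hx (x False)) + b * (hx (x True) * hy (x False))
    + c * (hy (x True) * hx (x False)) + d * (hy (x True) * hy (x False)))"
proof -
  have deg: "(\<lambda>i. (if i = True then 1 else 0) + (if i = False then 1 else 0)) = (\<lambda>i. 1 :: nat)"
    by auto
  have "is_form (\<lambda>i. 1) (\<lambda>x :: bool \<Rightarrow> cp1. h (x True) * h' (x False))"
    if "h = hx \<or> h = hy" "h' = hx \<or> h' = hy" for h h'
  proof -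
    have 1: "is_form (\<lambda>i. if i = True then 1 else 0) (\<lambda>x :: bool \<Rightarrow> cp1. h (x True))"
      using that(1) by (elim disjE) (simp_all only: is_form_hx is_form_hy)
    have 2: "is_form (\<lambda>i. if i = False then 1 else 0) (\<lambda>x :: bool \<Rightarrow> cp1. h' (x False))"
      using that(2) by (elim disjE) (simp_all only: is_form_hx is_form_hy)
    show ?thesis using is_form_mult[OF 1 2] unfolding deg .
  qed
  then show ?thesis by (intro is_form_add is_form_cmult) auto
qed

lemma psi_morphism: "morphism torus_coord torus mcoord M05bar (psi c)"
proof (rule morphism_formsI)
  show "psi c ` torus \<subseteq> M05bar" using psi_M05bar by (auto simp: torus_def)
  fix j :: 5
  have "\<exists>a b e d a' b' e' d'. \<forall>X Y. X \<noteq> 0 \<longrightarrow> Y \<noteq> 0 \<longrightarrow>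
      (a * (X * Y) + b * X + e * Y + d \<noteq> 0 \<or> a' * (X * Y) + b' * X + e' * Y + d' \<noteq> 0) \<and>
      mcoord (psi c (X, Y)) j = of_hom (a * (X * Y) + b * X + e * Y + d) (a' * (X * Y) + b' * X + e' * Y + d')"
  proof -
    consider "j = c" | "j = c + 1" | "j = c + 2" | "j = c + 3" | "j = c + 4"
      using five_cases[of "j - c"] by (metis add.right_neutral add_diff_cancel_left' diff_add_cancel add.commute)
    moreover have e: "X + 1 = 1 + X" "X * Y + X = X * (1 + Y)" for X Y :: complex
      by (simp_all add: algebra_simps)
    ultimately show ?thesis
    proof cases
      case 1
      show ?thesis unfolding 1
        by (rule exI[of _ 0], rule exI[of _ 0], rule exI[of _ 1], rule exI[of _ 0],
            rule exI[of _ 1], rule exI[of _ 1], rule exI[of _ 0], rule exI[of _ 1])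
          (simp add: mcoord_psi add_ac)
    next
      case 2
      show ?thesis unfolding 2
        by (rule exI[of _ 0], rule exI[of _ 0], rule exI[of _ 0], rule exI[of _ 1],
            rule exI[of _ 0], rule exI[of _ 0], rule exI[of _ 1], rule exI[of _ 0])
          (simp add: mcoord_psi)
    next
      case 3
      show ?thesis unfolding 3
        by (rule exI[of _ 1], rule exI[of _ 0], rule exI[of _ 0], rule exI[of _ 0],
            rule exI[of _ 0], rule exI[of _ 1], rule exI[of _ 0], rule exI[of _ 1])
          (simp add: mcoord_psi e(1))
    next
      case 4
      show ?thesis unfolding 4
        by (rule exI[of _ 0], rule exI[of _ 0], rule exI[of _ 0], rule exI[of _ 1],
            rule exI[of _ 1], rule exI[of _ 1], rule exI[of _ 0], rule exI[of _ 0])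
          (simp add: mcoord_psi e(2))
    next
      case 5
      show ?thesis unfolding 5
        by (rule exI[of _ 0], rule exI[of _ 1], rule exI[of _ 0], rule exI[of _ 0],
            rule exI[of _ 0], rule exI[of _ 0], rule exI[of _ 0], rule exI[of _ 1])
          (simp add: mcoord_psi of_hom_def)
    qed
  qed
  then obtain a b e d a' b' e' d' where *: "\<And>X Y. X \<noteq> 0 \<Longrightarrow> Y \<noteq> 0 \<Longrightarrow>
      (a * (X * Y) + b * X + e * Y + d \<noteq> 0 \<or> a' * (X * Y) + b' * X + e' * Y + d' \<noteq> 0) \<and>
      mcoord (psi c (X, Y)) j = of_hom (a * (X * Y) + b * X + e * Y + d) (a' * (X * Y) + b' * X + e' * Y + d')"
    by blast
  show "\<exists>d A B. is_form d A \<and> is_form d B \<and> (\<forall>p\<in>torus.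
      (A (torus_coord p) \<noteq> 0 \<or> B (torus_coord p) \<noteq> 0) \<and>
      mcoord (psi c p) j = of_hom (A (torus_coord p)) (B (torus_coord p)))"
    by (intro exI conjI, rule is_form_bilinear[of a b e d], rule is_form_bilinear[of a' b' e' d'])
      (use * in \<open>auto simp: torus_def torus_coord_def\<close>)
qed

lemma psi_inverse_morphism: "morphism mcoord (psi c ` torus) torus_coord torus (inv_into torus (psi c))"
proof (rule morphism_formsI)
  show "inv_into torus (psi c) ` psi c ` torus \<subseteq> torus"
    by (rule image_subsetI) (rule inv_into_into)
  fix s :: bool
  have inv: "inv_into torus (psi c) (psi c (X, Y)) = (X, Y)" if "X \<noteq> 0" "Y \<noteq> 0" for X Y
    using that psi_inj by (intro inv_into_f_f) (auto simp: torus_def)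
  show "\<exists>d A B. is_form d A \<and> is_form d B \<and> (\<forall>p\<in>psi c ` torus.
      (A (mcoord p) \<noteq> 0 \<or> B (mcoord p) \<noteq> 0) \<and>
      torus_coord (inv_into torus (psi c) p) s = of_hom (A (mcoord p)) (B (mcoord p)))"
  proof (cases s)
    case True
    show ?thesis
      by (intro exI conjI, rule is_form_hx[of "c + 4"], rule is_form_hy[of "c + 4"], rule ballI, erule psi_coords)
        (use True in \<open>simp add: torus_coord_def inv mcoord_psi of_hom_def\<close>)
  next
    case False
    \<comment> \<open>\<open>mcoord p (c + 1)\<close> is the inverse of \<open>Y\<close>, so
      numerator and denominator are exchanged.\<close>
    show ?thesis
      by (intro exI conjI, rule is_form_hy[of "c + 1"], rule is_form_hx[of "c + 1"], rule ballI, erule psi_coords)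
        (use False in \<open>simp add: torus_coord_def inv mcoord_psi of_hom_def\<close>)
  qed
qed

lemma psi_embedding: "embedding torus_coord torus mcoord M05bar (psi c)"
  unfolding embedding_def using psi_inj psi_morphism psi_inverse_morphism by blast

lemma chart_open: "zariski_open mcoord M05bar (psi c ` torus)"
proof -
  have nz: "hx r * hy r \<noteq> 0 \<longleftrightarrow> r \<notin> {Fin 0, Infty}" for r by (cases r) auto
  have "psi c ` torus = {p \<in> M05bar. (hx (mcoord p (c + 4)) * hy (mcoord p (c + 4))) *
      (hx (mcoord p (c + 1)) * hy (mcoord p (c + 1))) \<noteq> 0}"
    using chart_iff[of _ c] psi_M05bar[of _ _ c] unfolding mult_eq_0_iff[of "hx _ * hy _" "hx _ * hy _"] de_Morgan_disj nz
    by (auto simp: torus_def)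
  also have "zariski_open mcoord M05bar \<dots>"
    by (rule zariski_open_form) (rule is_form_mult is_form_hx is_form_hy)+
  finally show ?thesis .
qed

section \<open>The covering by the five charts\<close>

lemma chart_represents:
  assumes x: "represents x p"
  shows "p \<in> psi c ` torus \<longleftrightarrow> x c \<noteq> x (c + 1) \<and> x (c + 1) \<noteq> x (c + 2) \<and> x (c + 2) \<noteq> x (c + 3) \<and>
    x (c + 3) \<noteq> x (c + 4) \<and> x (c + 4) \<noteq> x c \<and> x c \<noteq> x (c + 2) \<and> x c \<noteq> x (c + 3)"
proof -
  have "p \<in> M05bar" using x by (simp add: represents_def)
  then show ?thesis
    by (auto simp: chart_iff mcoord_chart[OF x] cross_ratio_def of_hom_cases)
qed

lemma Mcyc_represents:
  assumes x: "represents x p"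
  shows "p \<in> Mcyc \<longleftrightarrow> (\<forall>c. x c \<noteq> x (c + 1))"
proof -
  have "p \<in> M05bar" using x by (simp add: represents_def)
  then show ?thesis by (simp add: Mcyc_def bdiv_represents[OF x])
qed

lemma Mcyc_charts: "Mcyc = (\<Union>c. psi c ` torus)"
proof -
  have "p \<in> Mcyc \<longleftrightarrow> (\<exists>c. p \<in> psi c ` torus)" if p: "p \<in> M05bar" for p
  proof -
    obtain x where x: "represents x p" using represents_exists[OF p] .
    then have nt: "no_triple x" by (simp add: represents_def)
    have num: "(5 :: 5) = 0" "(6 :: 5) = 1" "(7 :: 5) = 2" "(8 :: 5) = 3" by simp_all
    have adj: "(\<forall>c. x c \<noteq> x (c + 1)) \<longleftrightarrow> x 0 \<noteq> x 1 \<and> x 1 \<noteq> x 2 \<and> x 2 \<noteq> x 3 \<and> x 3 \<noteq> x 4 \<and> x 4 \<noteq> x 0"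
    proof
      assume "\<forall>c. x c \<noteq> x (c + 1)"
      from this[rule_format, of 0] this[rule_format, of 1] this[rule_format, of 2]
        this[rule_format, of 3] this[rule_format, of 4]
      show "x 0 \<noteq> x 1 \<and> x 1 \<noteq> x 2 \<and> x 2 \<noteq> x 3 \<and> x 3 \<noteq> x 4 \<and> x 4 \<noteq> x 0" by (simp add: num)
    next
      assume *: "x 0 \<noteq> x 1 \<and> x 1 \<noteq> x 2 \<and> x 2 \<noteq> x 3 \<and> x 3 \<noteq> x 4 \<and> x 4 \<noteq> x 0"
      show "\<forall>c. x c \<noteq> x (c + 1)"
      proof
        fix c show "x c \<noteq> x (c + 1)"
          using five_cases[of c] * by (elim disjE) (simp_all add: num)
      qed
    qed
    have no: "\<not> (x 0 = x 2 \<and> x 0 = x 3)" "\<not> (x 1 = x 3 \<and> x 1 = x 4)" "\<not> (x 2 = x 4 \<and> x 0 = x 2)"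
      "\<not> (x 0 = x 3 \<and> x 1 = x 3)" "\<not> (x 1 = x 4 \<and> x 2 = x 4)"
      using no_tripleD[OF nt, of 0 2 3] no_tripleD[OF nt, of 1 3 4] no_tripleD[OF nt, of 2 4 0]
        no_tripleD[OF nt, of 3 0 1] no_tripleD[OF nt, of 4 1 2] by auto
    \<comment> \<open>The letters stand for coincidences along the five diagonals, arranged in a
      cycle in which neighbours share a vertex. Neighbours do not both occur, and since five is odd,
      some two neighbours are both absent.\<close>
    have some: "\<not> a \<and> \<not> b \<or> \<not> c \<and> \<not> d \<or> \<not> e \<and> \<not> a \<or>
        \<not> b \<and> \<not> c \<or> \<not> d \<and> \<not> e"
      if "\<not> (a \<and> b)" "\<not> (c \<and> d)" "\<not> (e \<and> a)" "\<not> (b \<and> c)" "\<not> (d \<and> e)" for a b c d e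
      using that by blast
    let ?adj = "x 0 \<noteq> x 1 \<and> x 1 \<noteq> x 2 \<and> x 2 \<noteq> x 3 \<and> x 3 \<noteq> x 4 \<and> x 4 \<noteq> x 0"
    have charts: "p \<in> psi 0 ` torus \<longleftrightarrow> ?adj \<and> x 0 \<noteq> x 2 \<and> x 0 \<noteq> x 3"
      "p \<in> psi 1 ` torus \<longleftrightarrow> ?adj \<and> x 1 \<noteq> x 3 \<and> x 1 \<noteq> x 4"
      "p \<in> psi 2 ` torus \<longleftrightarrow> ?adj \<and> x 2 \<noteq> x 4 \<and> x 0 \<noteq> x 2"
      "p \<in> psi 3 ` torus \<longleftrightarrow> ?adj \<and> x 0 \<noteq> x 3 \<and> x 1 \<noteq> x 3"
      "p \<in> psi 4 ` torus \<longleftrightarrow> ?adj \<and> x 1 \<noteq> x 4 \<and> x 2 \<noteq> x 4"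
      unfolding chart_represents[OF x] by (auto simp: num)
    have chart: "(\<exists>c. p \<in> psi c ` torus) \<longleftrightarrow> p \<in> psi 0 ` torus \<or> p \<in> psi 1 ` torus \<or> p \<in> psi 2 ` torus \<or>
        p \<in> psi 3 ` torus \<or> p \<in> psi 4 ` torus"
    proof
      assume "\<exists>c. p \<in> psi c ` torus"
      then obtain c where "p \<in> psi c ` torus" ..
      then show "p \<in> psi 0 ` torus \<or> p \<in> psi 1 ` torus \<or> p \<in> psi 2 ` torus \<or>
          p \<in> psi 3 ` torus \<or> p \<in> psi 4 ` torus"
        using five_cases[of c] by (elim disjE) simp_all
    qed blast
    show ?thesis
      unfolding Mcyc_represents[OF x] chart adj charts using some[OF no] by blast
  qed
  moreover have "Mcyc \<subseteq> M05bar" by (auto simp: Mcyc_def)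
  moreover have "psi c ` torus \<subseteq> M05bar" for c using psi_M05bar by (auto simp: torus_def)
  ultimately show ?thesis by blast
qed

section \<open>Regular functions\<close>

text \<open>The value at infinity is 0. A division by 0 occurs only at \<open>Fin 0\<close>, which
  is not attained on \<open>Mcyc\<close>.\<close>

definition vcoord :: "5 \<Rightarrow> mpoint \<Rightarrow> complex" where
  "vcoord i p = hy (mcoord p i) / hx (mcoord p i)"

lemma hx_of_hom_nonzero: "u \<noteq> 0 \<Longrightarrow> hx (of_hom u v) \<noteq> 0"
  by (simp add: of_hom_def)

lemma hy_div_hx_of_hom: "u \<noteq> 0 \<Longrightarrow> hy (of_hom u v) / hx (of_hom u v) = v / u"
  by (simp add: of_hom_def)

lemma vcoord_psi:
  assumes "X \<noteq> 0" "Y \<noteq> 0"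
  shows "vcoord (c + 4) (psi c (X, Y)) = 1 / X" "vcoord c (psi c (X, Y)) = (1 + X + X * Y) / Y"
    "vcoord (c + 1) (psi c (X, Y)) = Y" "vcoord (c + 2) (psi c (X, Y)) = (1 + X) / (X * Y)"
    "vcoord (c + 3) (psi c (X, Y)) = X * (1 + Y)"
  using assms by (simp_all add: vcoord_def mcoord_psi hy_div_hx_of_hom)

lemma five_shift_cases:
  fixes i c :: 5
  obtains "i = c" | "i = c + 1" | "i = c + 2" | "i = c + 3" | "i = c + 4"
proof -
  have "i = c + (i - c)" by simp
  then show thesis using five_cases[of "i - c"] that by (elim disjE) auto
qed

lemma hx_mcoord_Mcyc:
  assumes "p \<in> Mcyc"
  shows "hx (mcoord p i) \<noteq> 0"
proof -
  obtain c where "p \<in> psi c ` torus" using assms unfolding Mcyc_charts by blast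
  then obtain X Y where "X \<noteq> 0" "Y \<noteq> 0" "p = psi c (X, Y)" by (rule psi_coords)
  then show ?thesis
    by (cases rule: five_shift_cases[of i c]) (simp_all add: mcoord_psi hx_of_hom_nonzero)
qed

lemma psi_Mcyc: "X \<noteq> 0 \<Longrightarrow> Y \<noteq> 0 \<Longrightarrow> psi c (X, Y) \<in> Mcyc"
  unfolding Mcyc_charts torus_def by blast

lemma cp1_power_nonpos:
  assumes "n \<le> 0"
  shows "cp1_power r n = (hy r / hx r) ^ nat (- n)"
proof -
  define m where "m = nat (- n)"
  have "n = - int m" using assms by (simp add: m_def)
  then show ?thesis
    by (simp add: cp1_power_def power_int_minus power_divide field_simps)
qed

text \<open>A cyclic rotation of four points inverts the cross-ratio, so the second cross-ratio is
  the inverse of \<open>mcoord p (c + 1)\<close>. The signs of \<open>a\<close> and \<open>b\<close>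
  then make both factors nonnegative powers of regular functions.\<close>

lemma Xfun_vcoord:
  assumes "p \<in> Mcyc" "a \<le> 0" "0 \<le> b"
  shows "Xfun a b c p = vcoord (c + 4) p ^ nat (- a) * vcoord (c + 1) p ^ nat b"
proof -
  have "p \<in> M05bar" using assms(1) by (simp add: Mcyc_def)
  then obtain x where x: "represents x p" using represents_exists by blast
  have adj: "x c \<noteq> x (c + 1)" for c using assms(1) unfolding Mcyc_represents[OF x] by blast
  have "mcross p c (c + 1) (c + 2) (c + 3) = mcoord p (c + 4)"
    unfolding mcoord_chart[OF x] by (rule mcross_represents[OF x]) simp
  then have 1: "cp1_power (mcross p c (c + 1) (c + 2) (c + 3)) a = vcoord (c + 4) p ^ nat (- a)"
    by (simp add: cp1_power_nonpos[OF assms(2)] vcoord_def)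
  define A where "A = pdiff (x c) (x (c + 2)) * pdiff (x (c + 3)) (x (c + 4))"
  define B where "B = pdiff (x c) (x (c + 4)) * pdiff (x (c + 2)) (x (c + 3))"
  have idx: "c + 4 + 1 = c" "c + 2 + 1 = c + 3" by simp_all
  have "x c \<noteq> x (c + 4)" "x (c + 2) \<noteq> x (c + 3)"
    using adj[of "c + 4"] adj[of "c + 2"] unfolding idx by auto
  then have B: "B \<noteq> 0" by (simp add: B_def)
  have "mcross p c (c + 2) (c + 3) (c + 4) = of_hom A B"
    unfolding A_def B_def cross_ratio_def[symmetric] by (rule mcross_represents[OF x]) simp
  then have "mcross p c (c + 2) (c + 3) (c + 4) = Fin (A / B)" using B by (simp add: of_hom_def)
  then have "cp1_power (mcross p c (c + 2) (c + 3) (c + 4)) b = (A / B) ^ nat b"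
    using assms(3) by (simp add: cp1_power_def power_int_def)
  moreover have "mcoord p (c + 1) = of_hom (- B) (- A)"
    unfolding mcoord_chart[OF x] cross_ratio_def A_def B_def
    by (simp add: pdiff_commute[of "x c" "x (c + 4)"] pdiff_commute[of "x c" "x (c + 2)"] mult.commute)
  then have "vcoord (c + 1) p = A / B" using B by (simp add: vcoord_def hy_div_hx_of_hom)
  ultimately show ?thesis using 1 assms(1) by (simp add: Xfun_def)
qed

text \<open>The cluster variables \<open>w\<^sub>0, \<dots>, w\<^sub>4\<close> are \<^term>\<open>vcoord i\<close> for \<open>i = 4, 1, 3, 0, 2\<close>.\<close>

definition cluster_fun :: "int \<Rightarrow> int \<Rightarrow> mpoint \<Rightarrow> complex" where
  "cluster_fun i j = (\<lambda>p. if p \<in> Mcyc then vcoord 4 p ^ nat i * vcoord 1 p ^ nat j *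
     vcoord 3 p ^ nat (min j 0 - i) * vcoord 0 p ^ nat (min (- i) (- j)) * vcoord 2 p ^ nat (min i 0 - j) else 0)"

lemma cluster_fun_psi:
  assumes "a \<noteq> 0" "b \<noteq> 0"
  shows "cluster_fun i j (psi 0 (1 / a, b)) = cluster_mon i j a b"
proof -
  have v: "vcoord 4 (psi 0 (1 / a, b)) = a" "vcoord 1 (psi 0 (1 / a, b)) = b"
    "vcoord 3 (psi 0 (1 / a, b)) = (1 + b) / a"
    "vcoord 0 (psi 0 (1 / a, b)) = (1 + a + b) / (a * b)"
    "vcoord 2 (psi 0 (1 / a, b)) = (1 + a) / b"
    using vcoord_psi[of "1 / a" b 0] assms by (simp_all add: field_simps)
  show ?thesis
    unfolding cluster_fun_def v cluster_mon_cluster[OF assms] using psi_Mcyc[of "1 / a" b 0] assms by simp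
qed

text \<open>\<open>vcoord (c + 4)\<close> and \<open>vcoord (c + 1)\<close> are consecutive cluster
  variables, so each \<open>c\<close> fills one cone of exponents; \<open>c = 0, 2, 4, 1, 3\<close>
  is the cyclic order of the cones.\<close>

lemma Xfun_cluster_fun:
  assumes "a \<le> 0" "0 \<le> b"
  shows "Xfun a b 0 = cluster_fun (- a) b" "Xfun a b 2 = cluster_fun (- b) (- a)" "Xfun a b 4 = cluster_fun (a - b) (- b)"
    "Xfun a b 1 = cluster_fun a (a - b)" "Xfun a b 3 = cluster_fun b a"
proof -
  have 0: "Xfun a b c p = 0 \<and> cluster_fun i j p = 0" if "p \<notin> Mcyc" for i j c p
    using that by (simp add: Xfun_def cluster_fun_def)
  have num: "(5 :: 5) = 0" "(6 :: 5) = 1" "(7 :: 5) = 2" "(8 :: 5) = 3" by simp_all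
  show "Xfun a b 0 = cluster_fun (- a) b"
  proof
    fix p show "Xfun a b 0 p = cluster_fun (- a) b p"
      using 0[of p] Xfun_vcoord[of p a b 0] assms by (cases "p \<in> Mcyc") (simp_all add: cluster_fun_def num)
  qed
  show "Xfun a b 2 = cluster_fun (- b) (- a)"
  proof
    fix p show "Xfun a b 2 p = cluster_fun (- b) (- a) p"
      using 0[of p] Xfun_vcoord[of p a b 2] assms by (cases "p \<in> Mcyc") (simp_all add: cluster_fun_def num)
  qed
  show "Xfun a b 4 = cluster_fun (a - b) (- b)"
  proof
    fix p show "Xfun a b 4 p = cluster_fun (a - b) (- b) p"
      using 0[of p] Xfun_vcoord[of p a b 4] assms by (cases "p \<in> Mcyc") (simp_all add: cluster_fun_def num)
  qed
  show "Xfun a b 1 = cluster_fun a (a - b)"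
  proof
    fix p show "Xfun a b 1 p = cluster_fun a (a - b) p"
      using 0[of p] Xfun_vcoord[of p a b 1] assms by (cases "p \<in> Mcyc") (simp_all add: cluster_fun_def num)
  qed
  show "Xfun a b 3 = cluster_fun b a"
  proof
    fix p show "Xfun a b 3 p = cluster_fun b a p"
      using 0[of p] Xfun_vcoord[of p a b 3] assms by (cases "p \<in> Mcyc") (simp_all add: cluster_fun_def num mult.commute)
  qed
qed

lemma cluster_fun_in_range: "cluster_fun i j \<in> range (\<lambda>(i, j). cluster_fun i j)"
  by (rule range_eqI[of _ _ "(i, j)"]) simp

lemma Xfun_family: "{Xfun a b c |a b c. a \<le> 0 \<and> 0 \<le> b} = range (\<lambda>(i, j). cluster_fun i j)"
proof (intro subset_antisym subsetI)
  fix f assume "f \<in> {Xfun a b c |a b c. a \<le> 0 \<and> 0 \<le> b}"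
  then obtain a b c where f: "f = Xfun a b c" "a \<le> 0" "0 \<le> b" by blast
  have "\<exists>i j. Xfun a b c = cluster_fun i j"
    using five_cases[of c] Xfun_cluster_fun[OF f(2,3)] by (elim disjE) metis+
  then show "f \<in> range (\<lambda>(i, j). cluster_fun i j)" unfolding f(1) using cluster_fun_in_range by auto
next
  fix f assume "f \<in> range (\<lambda>(i, j). cluster_fun i j)"
  then obtain i j where f: "f = cluster_fun i j" by auto
  \<comment> \<open>The five cones cover the plane. On a common ray two values of \<open>c\<close>
    give the same function.\<close>
  consider "0 \<le> i" "0 \<le> j" | "i \<le> 0" "0 \<le> j" | "i \<le> j" "j \<le> 0" | "j \<le> i" "i \<le> 0" | "0 \<le> i" "j \<le> 0"
    by linarith
  then have "\<exists>a b c. a \<le> 0 \<and> 0 \<le> b \<and> Xfun a b c = cluster_fun i j"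
  proof cases
    case 1
    then show ?thesis using Xfun_cluster_fun(1)[of "- i" j] by (intro exI[of _ "- i"] exI[of _ j] exI[of _ 0]) simp
  next
    case 2
    then show ?thesis using Xfun_cluster_fun(2)[of "- j" "- i"] by (intro exI[of _ "- j"] exI[of _ "- i"] exI[of _ 2]) simp
  next
    case 3
    then show ?thesis using Xfun_cluster_fun(3)[of "i - j" "- j"] by (intro exI[of _ "i - j"] exI[of _ "- j"] exI[of _ 4]) simp
  next
    case 4
    then show ?thesis using Xfun_cluster_fun(4)[of i "i - j"] by (intro exI[of _ i] exI[of _ "i - j"] exI[of _ 1]) simp
  next
    case 5
    then show ?thesis using Xfun_cluster_fun(5)[of j i] by (intro exI[of _ j] exI[of _ i] exI[of _ 3]) simp
  qed
  then obtain a b c where "a \<le> 0" "0 \<le> b" "f = Xfun a b c" using f by metis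
  then show "f \<in> {Xfun a b c |a b c. a \<le> 0 \<and> 0 \<le> b}" by blast
qed

lemma Xfun_regular:
  assumes "a \<le> 0" "0 \<le> b"
  shows "Xfun a b c \<in> regular_functions_Mcyc"
proof -
  let ?m = "nat (- a)" and ?n = "nat b"
  let ?d = "\<lambda>i. ?m * (if i = c + 4 then 1 else 0) + ?n * (if i = c + 1 then 1 else 0)"
  have "regular_on mcoord Mcyc (Xfun a b c)"
  proof (rule regular_on_fraction)
    show "is_form ?d (\<lambda>x. hy (x (c + 4)) ^ ?m * hy (x (c + 1)) ^ ?n)"
      by (intro is_form_mult is_form_power is_form_hy)
    show "is_form ?d (\<lambda>x. hx (x (c + 4)) ^ ?m * hx (x (c + 1)) ^ ?n)"
      by (intro is_form_mult is_form_power is_form_hx)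
    show "hx (mcoord p (c + 4)) ^ ?m * hx (mcoord p (c + 1)) ^ ?n \<noteq> 0 \<and>
      Xfun a b c p = hy (mcoord p (c + 4)) ^ ?m * hy (mcoord p (c + 1)) ^ ?n /
        (hx (mcoord p (c + 4)) ^ ?m * hx (mcoord p (c + 1)) ^ ?n)" if p: "p \<in> Mcyc" for p
      using hx_mcoord_Mcyc[OF p] Xfun_vcoord[OF p assms] by (simp add: vcoord_def power_divide)
  qed
  then show ?thesis by (simp add: regular_functions_Mcyc_def Xfun_def)
qed

section \<open>Span and independence in the space of regular functions\<close>

interpretation fun_space: vector_space fun_scale
  by (rule vector_space_fun_scale)

lemma regular_functions_subspace: "fun_space.subspace regular_functions_Mcyc"
proof (rule fun_space.subspaceI)
  have "regular_on mcoord Mcyc (\<lambda>p. 0)"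
    by (rule regular_on_fraction[OF is_form_0[of "\<lambda>i. 0"] is_form_1]) simp
  then show "0 \<in> regular_functions_Mcyc"
    by (simp add: regular_functions_Mcyc_def zero_fun_def)
  show "f + g \<in> regular_functions_Mcyc" if "f \<in> regular_functions_Mcyc" "g \<in> regular_functions_Mcyc" for f g
    using that regular_on_add[of mcoord Mcyc f g] by (simp add: regular_functions_Mcyc_def plus_fun_def)
  show "fun_scale k f \<in> regular_functions_Mcyc" if "f \<in> regular_functions_Mcyc" for k f
    using that regular_on_cmult[of mcoord Mcyc f k] by (simp add: regular_functions_Mcyc_def fun_scale_def)
qed

lemma Mcyc_open: "zariski_open mcoord M05bar Mcyc"
  unfolding Mcyc_charts by (rule zariski_open_Union) (auto simp: chart_open)

lemma regular_chart_laurent: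
  assumes "regular_on mcoord Mcyc f"
  shows "laurent (\<lambda>X Y. f (psi c (X, Y)))"
proof -
  have "regular_on torus_coord {z \<in> torus. psi c z \<in> Mcyc} (\<lambda>z. f (psi c z))"
    using psi_morphism[of c] Mcyc_open assms unfolding morphism_def by blast
  moreover have "{z \<in> torus. psi c z \<in> Mcyc} = torus"
    using psi_Mcyc by (auto simp: torus_def)
  ultimately have "regular_on torus_coord torus (\<lambda>z. f (psi c z))" by simp
  then show ?thesis by (rule regular_on_torus_laurent)
qed

text \<open>In the chart \<open>c + 2\<close> the overlap with the chart \<open>c\<close> is the
  complement of \<open>1 + x = 0\<close>, and a Laurent polynomial that vanishes there is
  zero.\<close>

lemma regular_vanishing_transition:
  assumes f: "regular_on mcoord Mcyc f"
    and zero: "\<And>X Y. X \<noteq> 0 \<Longrightarrow> Y \<noteq> 0 \<Longrightarrow> f (psi c (X, Y)) = 0"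
    and nz: "X \<noteq> 0" "Y \<noteq> 0"
  shows "f (psi (c + 2) (X, Y)) = 0"
proof -
  obtain N P where P: "\<And>X Y. X \<noteq> 0 \<Longrightarrow> Y \<noteq> 0 \<Longrightarrow> f (psi (c + 2) (X, Y)) * (X * Y) ^ N = bipoly P X Y"
    using laurentE[OF regular_chart_laurent[OF f, of "c + 2"]] by metis
  have "P = 0"
  proof (rule bipoly_eq_0I')
    show "[:[:1, 1:]:] \<noteq> (0 :: complex poly poly)" by simp
    fix x y :: complex assume x: "x \<noteq> 0" and y: "y \<noteq> 0" and "bipoly [:[:1, 1:]:] x y \<noteq> 0"
    then have "1 + x \<noteq> 0" by simp
    then have 1: "1 + 1 / x \<noteq> 0" using x by (simp add: field_simps)
    have "psi c (y / (1 + 1 / x), 1 / x) = psi (c + 2) (x, y)"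
      using psi_transition[of "y / (1 + 1 / x)" "1 / x" c] x y 1 by simp
    then have "f (psi (c + 2) (x, y)) = 0"
      using zero[of "y / (1 + 1 / x)" "1 / x"] x y 1 by simp
    then show "bipoly P x y = 0" using P[OF x y] by simp
  qed
  then show ?thesis using P[OF nz] nz by simp
qed

text \<open>Steps by 2 modulo 5 reach every chart, in the order 0, 2, 4, 1, 3.\<close>

lemma regular_vanishing:
  assumes f: "regular_on mcoord Mcyc f"
    and zero: "\<And>X Y. X \<noteq> 0 \<Longrightarrow> Y \<noteq> 0 \<Longrightarrow> f (psi 0 (X, Y)) = 0"
    and p: "p \<in> Mcyc"
  shows "f p = 0"
proof -
  have num: "(0 :: 5) + 2 = 2" "(2 :: 5) + 2 = 4" "(4 :: 5) + 2 = 1" "(1 :: 5) + 2 = 3" by simp_all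
  note step = regular_vanishing_transition[OF f]
  have 2: "f (psi 2 (X, Y)) = 0" if "X \<noteq> 0" "Y \<noteq> 0" for X Y
    using step[OF zero that] unfolding num by simp
  have 4: "f (psi 4 (X, Y)) = 0" if "X \<noteq> 0" "Y \<noteq> 0" for X Y
    using step[OF 2 that] unfolding num by simp
  have 1: "f (psi 1 (X, Y)) = 0" if "X \<noteq> 0" "Y \<noteq> 0" for X Y
    using step[OF 4 that] unfolding num by simp
  have 3: "f (psi 3 (X, Y)) = 0" if "X \<noteq> 0" "Y \<noteq> 0" for X Y
    using step[OF 1 that] unfolding num by simp
  obtain c where "p \<in> psi c ` torus" using p unfolding Mcyc_charts by blast
  then obtain X Y where "X \<noteq> 0" "Y \<noteq> 0" "p = psi c (X, Y)" by (rule psi_coords)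
  then show ?thesis using five_cases[of c] zero 1 2 3 4 by (elim disjE) simp_all
qed

text \<open>The charts 3 and 2 are those that share a coordinate with the chart 0. The first has the
  coordinates \<open>(x, a)\<close> with \<open>b = x * (1 + a)\<close>; the second gives the same
  substitution with \<open>a\<close> and \<open>b\<close> exchanged, both coordinates being
  inverted.\<close>

lemma regular_laurent_adjacent:
  assumes f: "regular_on mcoord Mcyc f"
  defines "F \<equiv> \<lambda>a b. f (psi 0 (1 / a, b))"
  shows "laurent F" "laurent_adjacent F" "laurent_adjacent (\<lambda>a b. F b a)"
proof -
  note L = regular_chart_laurent[OF f]
  show "laurent F"
    unfolding F_def
    by (rule laurent_subst[OF L[of 0] laurent_inv_x laurent_x laurent_y laurent_inv_y]) simp
  have num: "(3 :: 5) + 2 = 0" "(0 :: 5) + 2 = 2" by simp_all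
  show "laurent_adjacent F"
  proof (rule laurent_adjacentI[OF laurent_swap[OF L[of 3]]])
    fix a x :: complex assume "a \<noteq> 0" "1 + a \<noteq> 0" "x \<noteq> 0"
    then show "F a (x * (1 + a)) = f (psi 3 (x, a))"
      using psi_transition[of x a 3] unfolding num F_def by simp
  qed
  have "laurent (\<lambda>a x. f (psi 2 (1 / a, 1 / x)))"
    by (rule laurent_subst[OF L[of 2] laurent_inv_x laurent_x laurent_inv_y laurent_y]) simp
  then show "laurent_adjacent (\<lambda>a b. F b a)"
  proof (rule laurent_adjacentI)
    fix a x :: complex assume "a \<noteq> 0" "1 + a \<noteq> 0" "x \<noteq> 0"
    then show "F (x * (1 + a)) a = f (psi 2 (1 / a, 1 / x))"
      using psi_transition[of "1 / (x * (1 + a))" a 0] unfolding num F_def by simp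
  qed
qed

text \<open>The combination found on the chart 0 defines a regular function on all of
  \<open>Mcyc\<close>. Its difference from \<open>f\<close> vanishes on that chart, hence
  everywhere.\<close>

lemma regular_functions_spanned:
  assumes "f \<in> regular_functions_Mcyc"
  shows "f \<in> fun_space.span (range (\<lambda>(i, j). cluster_fun i j))"
proof -
  have f: "regular_on mcoord Mcyc f" "\<And>p. p \<notin> Mcyc \<Longrightarrow> f p = 0"
    using assms by (auto simp: regular_functions_Mcyc_def)
  obtain G where "cluster_comb G" and G: "\<And>a b. a \<noteq> 0 \<Longrightarrow> b \<noteq> 0 \<Longrightarrow> f (psi 0 (1 / a, b)) = G a b"
    using laurent_cluster_comb[OF regular_laurent_adjacent[OF f(1)]] by metis
  then obtain cs where cs: "G = (\<lambda>a b. \<Sum>(c, i, j)\<leftarrow>cs. c * cluster_mon i j a b)" by (auto simp: cluster_comb_def)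
  have "\<exists>g \<in> fun_space.span (range (\<lambda>(i, j). cluster_fun i j)).
      \<forall>a b. a \<noteq> 0 \<longrightarrow> b \<noteq> 0 \<longrightarrow> g (psi 0 (1 / a, b)) = (\<Sum>(c, i, j)\<leftarrow>cs. c * cluster_mon i j a b)"
  proof (induction cs)
    case Nil
    show ?case by (rule bexI[of _ 0]) (simp_all add: fun_space.span_zero)
  next
    case (Cons z cs)
    obtain c i j where z: "z = (c, i, j)" by (cases z)
    obtain g where g: "g \<in> fun_space.span (range (\<lambda>(i, j). cluster_fun i j))"
      "\<forall>a b. a \<noteq> 0 \<longrightarrow> b \<noteq> 0 \<longrightarrow> g (psi 0 (1 / a, b)) = (\<Sum>(c, i, j)\<leftarrow>cs. c * cluster_mon i j a b)"
      using Cons.IH by blast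
    have "cluster_fun i j \<in> fun_space.span (range (\<lambda>(i, j). cluster_fun i j))"
      by (rule fun_space.span_base) (rule cluster_fun_in_range)
    then have "fun_scale c (cluster_fun i j) + g \<in> fun_space.span (range (\<lambda>(i, j). cluster_fun i j))"
      by (intro fun_space.span_add fun_space.span_scale g(1))
    then show ?case
      by (rule bexI[rotated]) (use g(2) in \<open>simp add: z fun_scale_def cluster_fun_psi\<close>)
  qed
  then obtain g where g: "g \<in> fun_space.span (range (\<lambda>(i, j). cluster_fun i j))"
      "\<And>a b. a \<noteq> 0 \<Longrightarrow> b \<noteq> 0 \<Longrightarrow> g (psi 0 (1 / a, b)) = G a b"
    unfolding cs by blast
  have "range (\<lambda>(i, j). cluster_fun i j) \<subseteq> regular_functions_Mcyc"
    unfolding Xfun_family[symmetric] using Xfun_regular by blast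
  then have "g \<in> regular_functions_Mcyc"
    using g(1) fun_space.span_minimal[OF _ regular_functions_subspace] by blast
  then have g': "regular_on mcoord Mcyc g" "\<And>p. p \<notin> Mcyc \<Longrightarrow> g p = 0"
    by (auto simp: regular_functions_Mcyc_def)
  have "regular_on mcoord Mcyc (\<lambda>p. f p + (-1) * g p)"
    by (intro regular_on_add regular_on_cmult f(1) g'(1))
  moreover have "f (psi 0 (X, Y)) + (-1) * g (psi 0 (X, Y)) = 0" if "X \<noteq> 0" "Y \<noteq> 0" for X Y
    using G[of "1 / X" Y] g(2)[of "1 / X" Y] that by simp
  ultimately have "f p + (-1) * g p = 0" if "p \<in> Mcyc" for p
    using regular_vanishing[of "\<lambda>p. f p + (-1) * g p"] that by blast
  then have "f p = g p" for p
    using f(2) g'(2) by (cases "p \<in> Mcyc") simp_all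
  then have "f = g" by (rule ext)
  then show ?thesis using g(1) by simp
qed

text \<open>On the chart 0 a linear relation becomes one between cluster monomials; choosing one
  index \<open>z v\<close> for each function \<open>v\<close> in it makes the exponents
  distinct.\<close>

lemma cluster_fun_independent: "\<not> fun_space.dependent (range (\<lambda>(i, j). cluster_fun i j))"
proof
  assume "fun_space.dependent (range (\<lambda>(i, j). cluster_fun i j))"
  then obtain t u v where t: "finite t" "t \<subseteq> range (\<lambda>(i, j). cluster_fun i j)"
    and sum: "(\<Sum>v\<in>t. fun_scale (u v) v) = 0" and v: "v \<in> t" "u v \<noteq> 0"
    unfolding fun_space.dependent_explicit by blast
  have "\<forall>v\<in>t. \<exists>z. v = cluster_fun (fst z) (snd z)" using t(2) by force
  then obtain z where z: "\<And>v. v \<in> t \<Longrightarrow> v = cluster_fun (fst (z v)) (snd (z v))" by metis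
  then have inj: "inj_on z t" by (metis inj_onI)
  define c where "c y = u (cluster_fun (fst y) (snd y))" for y
  have "c (z v) = 0"
  proof (rule cluster_mon_independent[of "z ` t"])
    fix a b :: complex assume ab: "a \<noteq> 0" "b \<noteq> 0"
    have "(\<Sum>(i, j)\<in>z ` t. c (i, j) * cluster_mon i j a b) = (\<Sum>w\<in>t. u w * w (psi 0 (1 / a, b)))"
      unfolding sum.reindex[OF inj] o_def case_prod_unfold
    proof (rule sum.cong[OF refl])
      fix w assume "w \<in> t"
      then have w: "cluster_fun (fst (z w)) (snd (z w)) = w" using z by simp
      show "c (fst (z w), snd (z w)) * cluster_mon (fst (z w)) (snd (z w)) a b = u w * w (psi 0 (1 / a, b))"
        unfolding cluster_fun_psi[OF ab, symmetric] c_def fst_conv snd_conv w ..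
    qed
    also have "\<dots> = (\<Sum>w\<in>t. fun_scale (u w) w) (psi 0 (1 / a, b))"
      using t(1) by (induction t rule: finite_induct) (simp_all add: fun_scale_def)
    also have "\<dots> = 0" unfolding sum by simp
    finally show "(\<Sum>(i, j)\<in>z ` t. c (i, j) * cluster_mon i j a b) = 0" .
  qed (use t(1) v(1) in auto)
  then show False using v z[OF v(1)] by (simp add: c_def)
qed

theorem theorem3p2:
  shows
    "((\<forall>c. embedding torus_coord torus mcoord M05bar (psi c)) \<and>
      (\<forall>c. zariski_open mcoord M05bar (psi c ` torus)) \<and>
      Mcyc = (\<Union>c. psi c ` torus)) \<and>
     (\<not> module.dependent fun_scale {Xfun a b c |a b c. a \<le> 0 \<and> 0 \<le> b} \<and>
      module.span fun_scale {Xfun a b c |a b c. a \<le> 0 \<and> 0 \<le> b} = regular_functions_Mcyc)"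
proof (intro conjI allI)
  show "\<not> fun_space.dependent {Xfun a b c |a b c. a \<le> 0 \<and> 0 \<le> b}"
    unfolding Xfun_family by (rule cluster_fun_independent)
  have "{Xfun a b c |a b c. a \<le> 0 \<and> 0 \<le> b} \<subseteq> regular_functions_Mcyc"
    using Xfun_regular by blast
  then show "fun_space.span {Xfun a b c |a b c. a \<le> 0 \<and> 0 \<le> b} = regular_functions_Mcyc"
    using fun_space.span_minimal[OF _ regular_functions_subspace] regular_functions_spanned
    unfolding Xfun_family by blast
qed (rule psi_embedding chart_open Mcyc_charts)+

end
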